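(* For all integers $n\geq 1$ let \[u_n=\frac{\overline{p}(n-1)\,\overline{p}(n+1)}{\overline{p}(n)^2}.\] Then for all $n\geq 16$, \[4(1-u_n)(1-u_{n+1})-(1-u_nu_{n+1})^2>0.\]
   Context: An overpartition of a nonnegative integer $n$ is a partition of $n$ in which the first occurrence of each distinct part may be overlined. $\overline{p}(n)$ denotes the number of overpartitions of $n$, with $\overline{p}(0)=1$. *)

theory Defs
  imports Complex_Main "HOL-Library.Multiset"
begin

text \<open>An overpartition of n: a partition of n (a multiset of positive parts summing to n)
  together with the set of distinct parts whose first occurrence is overlined.\<close>
definition overpartitions :: "nat \<Rightarrow> (nat multiset \<times> nat set) set" where
  "overpartitions n = {(M, S). (\<forall>k \<in># M. 0 < k) \<and> sum_mset M = n \<and> S \<subseteq> set_mset M}"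

definition overpart :: "nat \<Rightarrow> nat" where
  "overpart n = card (overpartitions n)"

definition u_op :: "nat \<Rightarrow> real" where
  "u_op n = real (overpart (n - 1)) * real (overpart (n + 1)) / (real (overpart n))^2"

end

theory Submission
  imports Defs "HOL-Complex_Analysis.Complex_Analysis" "HOL-Probability.Probability"
begin

text \<open>The generating function of overpartitions is \<open>P(q) = (\<Prod>k. (1 + q^k) / (1 - q^k))\<close>, and by Gauss
  \<open>P(q) * (\<Sum>s. (-1)^s q^(s^2)) = 1\<close> with \<open>s\<close> running over the integers. The transformation formula of
  this theta series gives \<open>P(exp (-t))\<close>, for \<open>Re t > 0\<close>, as \<open>sqrt t / (2 sqrt pi) * exp (pi^2 / (4 t))\<close>
  up to an exponentially small relative error. In the Fourier integral of the \<open>n\<close>-th coefficient over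
  \<open>Re t = \<sigma> = pi / (2 sqrt n)\<close> the arc \<open>\<bar>Im t\<bar> \<le> 2 \<sigma>\<close> then contributes \<open>exp \<mu> / (8 n) * (1 - 1 / \<mu>)\<close> with
  \<open>\<mu> = pi sqrt n\<close>; on the rest, comparing the factors of the product with those at \<open>exp (-\<sigma>)\<close> saves
  a factor \<open>exp (- sqrt n)\<close>. With \<open>a = 1 - u_n\<close> and \<open>b = 1 - u_(n+1)\<close> the claim reads
  \<open>(a - b)^2 < a b (2 (a + b) - a b)\<close>. Here \<open>a\<close> and \<open>b\<close> are of order \<open>n^(-3/2)\<close> and \<open>a - b\<close> is of order
  \<open>n^(-5/2)\<close>, so differences of the logarithm of the main term settle the case \<open>n \<ge> 730\<close>; smaller \<open>n\<close>
  are computed from Gauss's recurrence.\<close>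

section \<open>Overpartitions and their generating function\<close>

text \<open>In \<open>(a - b)^2 < a b (2 (a + b) - a b)\<close> the two sides have sizes
  \<open>n^(-5)\<close> and \<open>n^(-9/2)\<close>: the margin is only a factor
  \<open>sqrt n\<close>. So \<open>ln (overpart n)\<close> is needed up to an error of order
  \<open>n^(-5/2)\<close>, and the factor \<open>1 - 1 / \<mu>\<close> cannot be dropped. It comes
  in closed form because the weight \<open>sqrt t\<close> makes the main integral a Bessel function
  of half-integer order, \<open>I_(3/2)\<close>, which is elementary.

  The arc ends at \<open>2 \<sigma>\<close> because there the gain off the axis is about
  \<open>4/5 * 1 / \<sigma>\<close>, just above the \<open>pi / 4 * 1 / \<sigma>\<close> that
  amounts to the saving \<open>exp (- sqrt n)\<close>, while on the arc \<open>Re (1 / t)\<close> is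
  still at least \<open>1 / (5 \<sigma>)\<close>, so that the transformed theta series stays close
  to 1.

  The bound 730 comes from the requirement that \<open>n exp (- sqrt n)\<close> be a small multiple
  of \<open>n^(-5/2)\<close>: the inequality \<open>25 s^7 \<le> exp s\<close> fails at
  \<open>s = 26\<close> and holds from \<open>s = 27\<close> on, and \<open>n - 1 \<ge> 27^2\<close>
  is needed.\<close>

definition bounded_overpartitions :: "nat \<Rightarrow> nat \<Rightarrow> (nat multiset \<times> nat set) set" where
  "bounded_overpartitions k n =
    {(M, S). (\<forall>j \<in># M. 0 < j \<and> j \<le> k) \<and> sum_mset M = n \<and> S \<subseteq> set_mset M}"

definition bounded_overpart :: "nat \<Rightarrow> nat \<Rightarrow> nat" where
  "bounded_overpart k n = card (bounded_overpartitions k n)"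

lemma bounded_overpartitions_0:
  "bounded_overpartitions 0 n = (if n = 0 then {({#}, {})} else {})"
proof -
  have *: "(\<forall>j \<in># M. 0 < j \<and> j \<le> (0::nat)) \<longleftrightarrow> M = {#}" for M
    by (metis multiset_nonemptyE not_less set_mset_empty empty_iff)
  show ?thesis
    unfolding bounded_overpartitions_def * by auto
qed

lemma member_le_sum_mset: "j \<in># M \<Longrightarrow> j \<le> sum_mset (M :: nat multiset)"
  by (metis le_add1 sum_mset.remove)

lemma bounded_overpartitions_small:
  "n < Suc k \<Longrightarrow> bounded_overpartitions (Suc k) n = bounded_overpartitions k n"
  unfolding bounded_overpartitions_def
  by (intro Collect_cong) (auto simp: le_Suc_eq dest: member_le_sum_mset)

text \<open>When \<open>Suc k\<close> occurs, remove one copy. Either the rest still supports every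
  overline in \<open>S\<close>, or the removed copy was the only one and was overlined, and then the
  rest has parts at most \<open>k\<close>. The three cases mirror the factor
  \<open>(1 + q^(k+1)) / (1 - q^(k+1))\<close>; bounding the parts is what lets the product be built
  factor by factor.\<close>

lemma bounded_overpartitions_Suc:
  assumes "Suc k \<le> n"
  shows "bounded_overpartitions (Suc k) n = bounded_overpartitions k n \<union>
     (\<lambda>(M, S). (add_mset (Suc k) M, S)) ` bounded_overpartitions (Suc k) (n - Suc k) \<union>
     (\<lambda>(M, S). (add_mset (Suc k) M, insert (Suc k) S)) ` bounded_overpartitions k (n - Suc k)"
    (is "?L = ?A \<union> ?B \<union> ?C")
proof (intro equalityI subsetI)
  fix x assume x: "x \<in> ?L"
  obtain M S where xMS: "x = (M, S)" by force
  have M: "\<forall>j \<in># M. 0 < j \<and> j \<le> Suc k" "sum_mset M = n" "S \<subseteq> set_mset M"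
    using x by (auto simp: bounded_overpartitions_def xMS)
  show "x \<in> ?A \<union> ?B \<union> ?C"
  proof (cases "Suc k \<in># M")
    case False
    then have "x \<in> ?A"
      using M by (auto simp: bounded_overpartitions_def xMS le_Suc_eq)
    then show ?thesis by blast
  next
    case True
    then obtain M' where M': "M = add_mset (Suc k) M'"
      by (meson multi_member_split)
    show ?thesis
    proof (cases "S \<subseteq> set_mset M'")
      case True
      then have "(M', S) \<in> bounded_overpartitions (Suc k) (n - Suc k)"
        using M M' by (auto simp: bounded_overpartitions_def)
      then have "x \<in> ?B" unfolding xMS M' by force
      then show ?thesis by blast
    next
      case False
      then have *: "Suc k \<notin># M'" "Suc k \<in> S" using M(3) M' by auto
      then have "(M', S - {Suc k}) \<in> bounded_overpartitions k (n - Suc k)"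
        using M M' by (auto simp: bounded_overpartitions_def le_Suc_eq)
      then have "x \<in> ?C" unfolding xMS M' using *
        by (intro image_eqI[of _ _ "(M', S - {Suc k})"]) auto
      then show ?thesis by blast
    qed
  qed
next
  fix x assume "x \<in> ?A \<union> ?B \<union> ?C"
  then consider "x \<in> ?A" | "x \<in> ?B" | "x \<in> ?C" by blast
  then show "x \<in> ?L"
  proof cases
    case 1
    then show ?thesis by (auto simp: bounded_overpartitions_def le_Suc_eq)
  next
    case 2
    then show ?thesis using assms by (auto simp: bounded_overpartitions_def le_Suc_eq)
  next
    case 3
    then show ?thesis using assms by (auto simp: bounded_overpartitions_def le_Suc_eq)
  qed
qed

lemma finite_bounded_overpartitions: "finite (bounded_overpartitions k n)"
proof (induction k arbitrary: n)
  case 0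
  then show ?case by (simp add: bounded_overpartitions_0)
next
  case (Suc k)
  show ?case
  proof (induction n rule: less_induct)
    case (less n)
    show ?case
    proof (cases "Suc k \<le> n")
      case True
      then show ?thesis using Suc less by (simp add: bounded_overpartitions_Suc)
    next
      case False
      then show ?thesis using Suc by (simp add: bounded_overpartitions_small)
    qed
  qed
qed

lemma bounded_overpart_Suc:
  assumes "Suc k \<le> n"
  shows "bounded_overpart (Suc k) n = bounded_overpart k n +
     bounded_overpart (Suc k) (n - Suc k) + bounded_overpart k (n - Suc k)"
proof -
  let ?A = "bounded_overpartitions k n"
  let ?f = "\<lambda>(M, S :: nat set). (add_mset (Suc k) M, S)"
  let ?g = "\<lambda>(M, S). (add_mset (Suc k) M, insert (Suc k) S)"
  let ?B = "?f ` bounded_overpartitions (Suc k) (n - Suc k)"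
  let ?C = "?g ` bounded_overpartitions k (n - Suc k)"
  have notin: "Suc k \<notin># M" if "(M, S) \<in> bounded_overpartitions k m" for M S m
    using that by (force simp: bounded_overpartitions_def)
  have notin': "Suc k \<notin> S" if "(M, S) \<in> bounded_overpartitions k m" for M S m
    using that notin[OF that] by (auto simp: bounded_overpartitions_def)
  have AB: "?A \<inter> ?B = {}"
    using notin[of "add_mset (Suc k) _"] by auto
  have ABC: "(?A \<union> ?B) \<inter> ?C = {}"
  proof -
    have "?A \<inter> ?C = {}" using notin[of "add_mset (Suc k) _"] by auto
    moreover have False if "(M, insert (Suc k) S) \<in> bounded_overpartitions (Suc k) m"
        "(M, S) \<in> bounded_overpartitions k m" for M S m
      using that(1) notin[OF that(2)] by (auto simp: bounded_overpartitions_def)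
    then have "?B \<inter> ?C = {}" by auto
    ultimately show ?thesis by blast
  qed
  have B: "card ?B = bounded_overpart (Suc k) (n - Suc k)"
    unfolding bounded_overpart_def by (rule card_image) (auto simp: inj_on_def)
  have C: "card ?C = bounded_overpart k (n - Suc k)"
    unfolding bounded_overpart_def
  proof (rule card_image, rule inj_onI)
    fix x y
    assume "x \<in> bounded_overpartitions k (n - Suc k)" "y \<in> bounded_overpartitions k (n - Suc k)"
      and *: "?g x = ?g y"
    then have "Suc k \<notin> snd x" "Suc k \<notin> snd y" using notin' by (metis prod.collapse)+
    then have "snd x = snd y" using * by (metis (no_types, lifting) insert_ident case_prod_beta prod.inject)
    then show "x = y" using * by (simp add: case_prod_beta prod_eq_iff)
  qed
  have "bounded_overpart (Suc k) n = card (?A \<union> ?B) + card ?C"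
    unfolding bounded_overpart_def bounded_overpartitions_Suc[OF assms]
    by (rule card_Un_disjoint) (use ABC in \<open>auto intro: finite_bounded_overpartitions\<close>)
  also have "card (?A \<union> ?B) = card ?A + card ?B"
    by (rule card_Un_disjoint) (use AB in \<open>auto intro: finite_bounded_overpartitions\<close>)
  finally show ?thesis
    by (simp add: B C bounded_overpart_def)
qed

lemma bounded_overpart_small: "n < Suc k \<Longrightarrow> bounded_overpart (Suc k) n = bounded_overpart k n"
  by (simp add: bounded_overpart_def bounded_overpartitions_small)

lemma bounded_overpart_0: "bounded_overpart 0 n = (if n = 0 then 1 else 0)"
  by (simp add: bounded_overpart_def bounded_overpartitions_0)

lemma bounded_overpart_eq: "n \<le> k \<Longrightarrow> bounded_overpart k n = overpart n"
proof -
  assume "n \<le> k"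
  have "j \<le> k" if "j \<in># M" "sum_mset M = n" for j :: nat and M
    using that member_le_sum_mset[of j M] \<open>n \<le> k\<close> by simp
  then have "(\<forall>j \<in># M. 0 < j \<and> j \<le> k) \<and> sum_mset M = n \<and> S \<subseteq> set_mset M \<longleftrightarrow>
      (\<forall>j \<in># M. 0 < j) \<and> sum_mset M = n \<and> S \<subseteq> set_mset M" for M S
    by metis
  then have "bounded_overpartitions k n = overpartitions n"
    unfolding bounded_overpartitions_def overpartitions_def by simp
  then show ?thesis by (simp add: bounded_overpart_def overpart_def)
qed

lemma bounded_overpart_mono: "bounded_overpart k n \<le> bounded_overpart (Suc k) n"
  by (cases "Suc k \<le> n") (auto simp: bounded_overpart_Suc bounded_overpart_small)

lemma bounded_overpart_le: "bounded_overpart k n \<le> overpart n"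
proof (cases "n \<le> k")
  case False
  then have "bounded_overpart k n \<le> bounded_overpart n n"
    using lift_Suc_mono_le[of "\<lambda>k. bounded_overpart k n" k n] bounded_overpart_mono by simp
  then show ?thesis by (simp add: bounded_overpart_eq)
qed (simp add: bounded_overpart_eq)

lemma overpart_0: "overpart 0 = 1"
  using bounded_overpart_eq[of 0 0] by (simp add: bounded_overpart_0)

section \<open>Power series of overpartitions on the unit disc\<close>

definition bounded_overpart_fps :: "nat \<Rightarrow> complex fps" where
  "bounded_overpart_fps k = Abs_fps (\<lambda>n. of_nat (bounded_overpart k n))"

definition overpart_fps :: "complex fps" where
  "overpart_fps = Abs_fps (\<lambda>n. of_nat (overpart n))"

lemma fps_conv_radius_ge_1I:
  fixes f :: "complex fps"
  assumes "\<And>r. 0 < r \<Longrightarrow> r < 1 \<Longrightarrow> summable (\<lambda>n. norm (fps_nth f n) * r ^ n)"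
  shows "fps_conv_radius f \<ge> 1"
  unfolding fps_conv_radius_def
proof (rule conv_radius_geI_ex')
  fix r :: real assume "0 < r" "ereal r < 1"
  then have "summable (\<lambda>n. norm (fps_nth f n * of_real r ^ n))"
    using assms[of r] by (simp add: norm_mult norm_power)
  then show "summable (\<lambda>n. fps_nth f n * of_real r ^ n)"
    by (rule summable_norm_cancel)
qed

lemma fps_conv_radius_ge_1_bounded:
  fixes f :: "complex fps"
  assumes "\<And>n. norm (fps_nth f n) \<le> B"
  shows "fps_conv_radius f \<ge> 1"
proof (rule fps_conv_radius_ge_1I)
  fix r :: real assume r: "0 < r" "r < 1"
  have "summable (\<lambda>n. B * r ^ n)" using r by (intro summable_mult summable_geometric) auto
  then show "summable (\<lambda>n. norm (fps_nth f n) * r ^ n)"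
    by (rule summable_comparison_test') (use assms r in \<open>auto intro!: mult_right_mono\<close>)
qed

lemma one_minus_power_nonzero:
  fixes z :: complex assumes "norm z < 1" "0 < i" shows "1 - z ^ i \<noteq> 0" "1 + z ^ i \<noteq> 0"
proof -
  have "norm (z ^ i) < 1" using assms by (simp add: norm_power power_less_one_iff)
  then show "1 - z ^ i \<noteq> 0" "1 + z ^ i \<noteq> 0"
    by (auto simp: eq_neg_iff_add_eq_0[symmetric])
       (metis add_diff_cancel_left' diff_0 norm_minus_cancel norm_one order_less_irrefl)
qed

lemma bounded_overpart_fps_Suc:
  "bounded_overpart_fps (Suc k) * (1 - fps_X ^ Suc k) =
     bounded_overpart_fps k * (1 + fps_X ^ Suc k)"
proof (rule fps_ext)
  fix n
  show "fps_nth (bounded_overpart_fps (Suc k) * (1 - fps_X ^ Suc k)) n =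
     fps_nth (bounded_overpart_fps k * (1 + fps_X ^ Suc k)) n"
    unfolding right_diff_distrib distrib_left mult_1_right fps_sub_nth fps_add_nth
      fps_X_power_mult_right_nth bounded_overpart_fps_def fps_nth_Abs_fps
    by (cases "n < Suc k")
       (simp_all add: bounded_overpart_small bounded_overpart_Suc del: power_Suc)
qed

text \<open>An explicit inverse with bounded coefficients. It carries the radius of convergence from
  \<open>k\<close> to \<open>Suc k\<close>; mere invertibility as a formal series would say nothing
  about the radius.\<close>

lemma one_minus_X_power_mult_geometric:
  fixes K :: nat assumes "0 < K"
  shows "(1 - fps_X ^ K) * Abs_fps (\<lambda>n. if K dvd n then 1 else 0) = (1 :: complex fps)"
  by (rule fps_ext)
     (use assms in \<open>auto simp: left_diff_distrib fps_X_power_mult_nth dvd_minus_self dest: dvd_imp_le\<close>)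

lemma fps_conv_radius_bounded_overpart_fps: "fps_conv_radius (bounded_overpart_fps k) \<ge> 1"
proof (induction k)
  case 0
  show ?case
    by (rule fps_conv_radius_ge_1_bounded[of _ 1])
       (auto simp: bounded_overpart_fps_def bounded_overpart_0)
next
  case (Suc k)
  define G :: "complex fps" where "G = Abs_fps (\<lambda>n. if Suc k dvd n then 1 else 0)"
  have "bounded_overpart_fps (Suc k) = bounded_overpart_fps (Suc k) * ((1 - fps_X ^ Suc k) * G)"
    using one_minus_X_power_mult_geometric[of "Suc k"] by (simp add: G_def)
  also have "\<dots> = bounded_overpart_fps k * (1 + fps_X ^ Suc k) * G"
    by (simp only: mult.assoc[symmetric] bounded_overpart_fps_Suc)
  finally have *: "bounded_overpart_fps (Suc k) = bounded_overpart_fps k * (1 + fps_X ^ Suc k) * G" .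
  have G: "fps_conv_radius G \<ge> 1"
    by (rule fps_conv_radius_ge_1_bounded[of _ 1]) (auto simp: G_def)
  have X: "fps_conv_radius (1 + fps_X ^ Suc k :: complex fps) \<ge> 1"
    by (rule order.trans[OF _ fps_conv_radius_add]) (simp del: power_Suc)
  show ?case unfolding *
    by (rule order.trans[OF _ fps_conv_radius_mult], rule min.boundedI,
        rule order.trans[OF _ fps_conv_radius_mult]) (use Suc G X in auto)
qed

lemma norm_less_conv_radius: "fps_conv_radius f \<ge> 1 \<Longrightarrow> norm z < 1 \<Longrightarrow> ereal (norm z) < fps_conv_radius f"
  by (metis ereal_less(3) less_le_trans)

lemma eval_bounded_overpart_fps:
  assumes z: "norm z < 1"
  shows "eval_fps (bounded_overpart_fps k) z = (\<Prod>i=1..k. (1 + z ^ i) / (1 - z ^ i))"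
proof (induction k)
  case 0
  have "bounded_overpart_fps 0 = 1"
    by (rule fps_ext) (auto simp: bounded_overpart_fps_def bounded_overpart_0)
  then show ?case by simp
next
  case (Suc k)
  note R = norm_less_conv_radius[OF fps_conv_radius_bounded_overpart_fps z]
  have R1: "ereal (norm z) < fps_conv_radius (1 - fps_X ^ Suc k :: complex fps)"
    by (rule less_le_trans[OF _ fps_conv_radius_diff]) (simp del: power_Suc)
  have R2: "ereal (norm z) < fps_conv_radius (1 + fps_X ^ Suc k :: complex fps)"
    by (rule less_le_trans[OF _ fps_conv_radius_add]) (simp del: power_Suc)
  have e1: "eval_fps (1 - fps_X ^ Suc k) z = 1 - z ^ Suc k"
    by (subst eval_fps_diff) (simp_all del: power_Suc)
  have e2: "eval_fps (1 + fps_X ^ Suc k) z = 1 + z ^ Suc k"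
    by (subst eval_fps_add) (simp_all del: power_Suc)
  have "eval_fps (bounded_overpart_fps (Suc k)) z * (1 - z ^ Suc k) =
        eval_fps (bounded_overpart_fps k) z * (1 + z ^ Suc k)"
    using arg_cong[OF bounded_overpart_fps_Suc[of k], of "\<lambda>f. eval_fps f z"]
    by (simp only: eval_fps_mult R R1 R2 e1 e2)
  then have "eval_fps (bounded_overpart_fps (Suc k)) z =
        eval_fps (bounded_overpart_fps k) z * ((1 + z ^ Suc k) / (1 - z ^ Suc k))"
    using one_minus_power_nonzero[OF z, of "Suc k"] by (simp add: field_simps del: power_Suc)
  then show ?case using Suc by (simp del: power_Suc)
qed

lemma sums_bounded_overpart_real:
  fixes r :: real assumes r: "0 \<le> r" "r < 1"
  shows "(\<lambda>n. bounded_overpart k n * r ^ n) sums (\<Prod>i=1..k. (1 + r ^ i) / (1 - r ^ i))"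
proof -
  have "(\<lambda>n. of_real (bounded_overpart k n * r ^ n)) sums
          (complex_of_real (\<Prod>i=1..k. (1 + r ^ i) / (1 - r ^ i)))"
    using sums_eval_fps[OF norm_less_conv_radius[OF fps_conv_radius_bounded_overpart_fps], of "of_real r" k]
      eval_bounded_overpart_fps[of "of_real r" k] r
    by (simp add: bounded_overpart_fps_def)
  then show ?thesis by (simp only: sums_of_real_iff)
qed

text \<open>The first \<open>N\<close> coefficients are those of the \<open>N\<close>-th finite
  product, so the partial sum is at most that product. The estimate
  \<open>(1 + r^i) / (1 - r^i) \<le> exp (2 r^i / (1 - r))\<close> bounds it uniformly in
  \<open>N\<close>.\<close>

lemma summable_overpart:
  fixes r :: real assumes r: "0 \<le> r" "r < 1"
  shows "summable (\<lambda>n. overpart n * r ^ n)"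
proof (rule summableI_nonneg_bounded[where x = "exp (2 * r / (1 - r)\<^sup>2)"])
  show "0 \<le> overpart n * r ^ n" for n using r by simp
next
  fix N
  have "(\<Sum>n<N. overpart n * r ^ n) = (\<Sum>n<N. bounded_overpart N n * r ^ n)"
    by (intro sum.cong) (auto simp: bounded_overpart_eq)
  also have "\<dots> \<le> (\<Prod>i=1..N. (1 + r ^ i) / (1 - r ^ i))"
    using sum_le_suminf[OF sums_summable[OF sums_bounded_overpart_real[OF r, of N]], of "{..<N}"]
      sums_unique[OF sums_bounded_overpart_real[OF r, of N]] r by simp
  also have "\<dots> \<le> (\<Prod>i=1..N. exp (2 * r ^ i / (1 - r)))"
  proof (rule prod_mono, safe)
    fix i assume i: "i \<in> {1..N}"
    have ri: "r ^ i \<le> r" "r ^ i < 1" using r i power_decreasing[of 1 i r] by auto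
    then show "0 \<le> (1 + r ^ i) / (1 - r ^ i)" using r by simp
    have "(1 + r ^ i) / (1 - r ^ i) = 1 + 2 * r ^ i / (1 - r ^ i)"
      using ri by (simp add: field_simps)
    also have "\<dots> \<le> 1 + 2 * r ^ i / (1 - r)"
      using ri r by (intro add_left_mono divide_left_mono mult_pos_pos) auto
    also have "\<dots> \<le> exp (2 * r ^ i / (1 - r))" by (rule exp_ge_add_one_self)
    finally show "(1 + r ^ i) / (1 - r ^ i) \<le> exp (2 * r ^ i / (1 - r))" .
  qed
  also have "\<dots> = exp (2 / (1 - r) * (\<Sum>i=1..N. r ^ i))"
    by (simp add: exp_sum sum_distrib_left)
  also have "\<dots> \<le> exp (2 / (1 - r) * (r / (1 - r)))"
  proof -
    have "(\<Sum>i=1..N. r ^ i) = r * (\<Sum>i<N. r ^ i)"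
      by (simp add: sum_distrib_left sum.atLeast1_atMost_eq)
    also have "(\<Sum>i<N. r ^ i) \<le> 1 / (1 - r)"
      using sum_le_suminf[OF summable_geometric[of r], of "{..<N}"] suminf_geometric[of r] r by simp
    finally have "(\<Sum>i=1..N. r ^ i) \<le> r / (1 - r)" using r by (simp add: mult_left_mono)
    then show ?thesis using r unfolding exp_le_cancel_iff by (intro mult_left_mono) auto
  qed
  also have "\<dots> = exp (2 * r / (1 - r)\<^sup>2)" by (simp add: power2_eq_square)
  finally show "(\<Sum>n<N. overpart n * r ^ n) \<le> exp (2 * r / (1 - r)\<^sup>2)" by simp
qed

lemma fps_conv_radius_overpart_fps: "fps_conv_radius overpart_fps \<ge> 1"
  by (rule fps_conv_radius_ge_1I) (use summable_overpart in \<open>auto simp: overpart_fps_def\<close>)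

text \<open>Each coefficient of the finite products is eventually constant in \<open>k\<close>, and
  \<open>overpart n * norm z ^ n\<close> is a summable majorant, so Tannery's theorem exchanges the
  limit with the sum.\<close>

lemma overpart_fps_limit:
  assumes z: "norm z < 1"
  shows "(\<lambda>k. \<Prod>i=1..k. (1 + z ^ i) / (1 - z ^ i)) \<longlonglongrightarrow> eval_fps overpart_fps z"
proof -
  have "(\<lambda>k. eval_fps (bounded_overpart_fps k) z) \<longlonglongrightarrow> eval_fps overpart_fps z"
    unfolding eval_fps_def
  proof (rule tannerys_theorem[THEN conjunct2, THEN conjunct2])
    show "((\<lambda>k. fps_nth (bounded_overpart_fps k) n * z ^ n) \<longlongrightarrow> fps_nth overpart_fps n * z ^ n) sequentially" for n
    proof (rule tendsto_eventually)
      show "\<forall>\<^sub>F k in sequentially. fps_nth (bounded_overpart_fps k) n * z ^ n = fps_nth overpart_fps n * z ^ n"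
        using eventually_ge_at_top[of n]
        by eventually_elim (simp add: bounded_overpart_fps_def overpart_fps_def bounded_overpart_eq)
    qed
    show "\<forall>\<^sub>F (n, k) in at_top \<times>\<^sub>F sequentially.
        norm (fps_nth (bounded_overpart_fps k) n * z ^ n) \<le> overpart n * norm z ^ n"
      by (intro always_eventually)
         (auto simp: bounded_overpart_fps_def norm_mult norm_power bounded_overpart_le intro!: mult_right_mono)
    show "summable (\<lambda>n. overpart n * norm z ^ n)" using summable_overpart[of "norm z"] z by simp
  qed auto
  then show ?thesis using eval_bounded_overpart_fps[OF z] by simp
qed

section \<open>Gauss's theta series\<close>

context
  fixes x :: real
  assumes x: "0 < x" "x < 1"
begin

private definition P :: "nat \<Rightarrow> real" where "P n = (\<Prod>i=1..n. (1 - x ^ i) / (1 + x ^ i))"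

private lemma P_Suc: "P (Suc n) = P n * ((1 - x ^ Suc n) / (1 + x ^ Suc n))"
  by (simp add: P_def)

private lemma P_pos: "P n > 0"
  unfolding P_def using x
  by (intro prod_pos ballI divide_pos_pos) (auto simp: power_less_one_iff add_pos_pos)

private lemma P_antimono: "s \<le> n \<Longrightarrow> P n \<le> P s"
proof (rule lift_Suc_antimono_le[of P])
  show "P (Suc n) \<le> P n" for n
  proof -
    have "(1 - x ^ Suc n) / (1 + x ^ Suc n) \<le> 1" using x by (simp add: divide_le_eq_1 add_pos_pos)
    then show ?thesis unfolding P_Suc by (rule mult_left_le) (rule less_imp_le[OF P_pos])
  qed
qed

text \<open>The summand of Shanks' identity. At \<open>s = 0\<close> it is \<open>P n\<close>,
  because \<open>2 / (1 + x ^ 0) = 1\<close>; for \<open>s \<ge> 1\<close> the exponent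
  \<open>s * Suc n\<close> makes it vanish as \<open>n\<close> grows.\<close>

private definition T :: "nat \<Rightarrow> nat \<Rightarrow> real" where
  "T n s = (-1) ^ s * (2 / (1 + x ^ s)) * (P n / P s) * x ^ (s * Suc n)"

text \<open>The induction step of \<open>T_telescope\<close> with \<open>a\<close>, \<open>b\<close>
  for \<open>P n\<close>, \<open>P m\<close>, with \<open>X = x ^ Suc n\<close>,
  \<open>y = x ^ Suc m\<close>, \<open>Z = x ^ (Suc m * Suc n)\<close> and the sign
  \<open>e\<close>. Once the powers have names it is an identity of rational functions.\<close>

private lemma telescope_step:
  fixes a b e X y Z :: real
  assumes "a \<noteq> 0" "b \<noteq> 0" "1 + X \<noteq> 0" "1 + y \<noteq> 0" "1 - y \<noteq> 0"
  shows "- (e * (2 / (1 + X)) * (a / b) * Z)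
    + ((-e) * (2 / (1 + y)) * (a * ((1 - X) / (1 + X)) / (b * ((1 - y) / (1 + y)))) * (Z * y)
      - (-e) * (2 / (1 + y)) * (a / (b * ((1 - y) / (1 + y)))) * Z)
    = e * (2 / (1 + X)) * (a / (b * ((1 - y) / (1 + y)))) * (Z * X)"
  using assms by (simp add: divide_simps) algebra

text \<open>Raising \<open>n\<close> changes the partial sum by a closed form. At
  \<open>m = n\<close> this form merges with the new summand \<open>T (Suc n) (Suc n)\<close> into
  exactly one new term of the theta series.\<close>

private lemma T_telescope:
  "(\<Sum>s\<le>m. T (Suc n) s - T n s) =
    - ((-1) ^ m * (2 / (1 + x ^ Suc n)) * (P n / P m) * x ^ (Suc m * Suc n))"
proof (induction m)
  case 0
  have "1 + x ^ Suc n \<noteq> 0" using x by (simp add: add_pos_pos less_imp_neq[symmetric] del: power_Suc)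
  then show ?case
    by (simp add: T_def P_Suc P_def[of 0] del: power_Suc) (simp add: divide_simps del: power_Suc, algebra)
next
  case (Suc m)
  define X where "X = x ^ Suc n"
  define y where "y = x ^ Suc m"
  define Z where "Z = x ^ (Suc m * Suc n)"
  have ne: "P n \<noteq> 0" "P m \<noteq> 0" "1 + X \<noteq> 0" "1 + y \<noteq> 0" "1 - y \<noteq> 0"
  proof -
    have "0 < X" "0 < y" "y < 1" using x by (simp_all add: X_def y_def power_less_one_iff del: power_Suc)
    then show "P n \<noteq> 0" "P m \<noteq> 0" "1 + X \<noteq> 0" "1 + y \<noteq> 0" "1 - y \<noteq> 0" using P_pos[of n] P_pos[of m] by auto
  qed
  have e: "x ^ (Suc m * Suc (Suc n)) = Z * y" "x ^ (Suc (Suc m) * Suc n) = Z * X"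
    unfolding Z_def y_def X_def power_add[symmetric]
    by (rule arg_cong[of _ _ "(^) x"], simp)+
  have IH: "(\<Sum>s\<le>m. T (Suc n) s - T n s) = - ((-1) ^ m * (2 / (1 + X)) * (P n / P m) * Z)"
    by (simp only: Suc X_def Z_def)
  have t1: "T (Suc n) (Suc m) = (- ((-1) ^ m)) * (2 / (1 + y)) *
      (P n * ((1 - X) / (1 + X)) / (P m * ((1 - y) / (1 + y)))) * (Z * y)"
    unfolding T_def P_Suc e X_def[symmetric] y_def[symmetric] by simp
  have t2: "T n (Suc m) = (- ((-1) ^ m)) * (2 / (1 + y)) * (P n / (P m * ((1 - y) / (1 + y)))) * Z"
    unfolding T_def P_Suc Z_def[symmetric] y_def[symmetric] by simp
  have t3: "- ((-1) ^ Suc m * (2 / (1 + X)) * (P n / P (Suc m)) * (Z * X)) =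
      (-1) ^ m * (2 / (1 + X)) * (P n / (P m * ((1 - y) / (1 + y)))) * (Z * X)"
    unfolding P_Suc y_def[symmetric] by simp
  show ?case
    unfolding sum.atMost_Suc IH t1 t2 e X_def[symmetric] t3 by (rule telescope_step[OF ne])
qed

text \<open>Shanks' finite form of Gauss's identity: the term \<open>s = 0\<close> on the right is the product \<open>P n\<close>, and the
  other terms vanish as \<open>n\<close> grows.\<close>

private lemma shanks: "1 + 2 * (\<Sum>s=1..n. (-1) ^ s * x ^ (s\<^sup>2)) = (\<Sum>s\<le>n. T n s)"
proof (induction n)
  case 0
  then show ?case by (simp add: T_def P_def)
next
  case (Suc n)
  have p: "0 < 1 + x ^ Suc n" using x by (simp add: add_pos_pos del: power_Suc)
  define X where "X = x ^ Suc n"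
  define W where "W = x ^ (Suc n * Suc n)"
  have "(\<Sum>s\<le>Suc n. T (Suc n) s) = (\<Sum>s\<le>n. T n s) + ((\<Sum>s\<le>n. T (Suc n) s - T n s) + T (Suc n) (Suc n))"
    by (simp add: sum_subtractf)
  also have "(\<Sum>s\<le>n. T (Suc n) s - T n s) + T (Suc n) (Suc n) = 2 * ((-1) ^ Suc n * x ^ ((Suc n)\<^sup>2))"
  proof -
    have S: "(\<Sum>s\<le>n. T (Suc n) s - T n s) = - ((-1) ^ n * (2 / (1 + X)) * W)"
      using P_pos[of n] by (simp only: T_telescope W_def X_def) simp
    have "x ^ (Suc n * Suc (Suc n)) = W * X"
      unfolding W_def X_def power_add[symmetric] by (rule arg_cong[of _ _ "(^) x"]) simp
    then have T: "T (Suc n) (Suc n) = - ((-1) ^ n * (2 / (1 + X)) * (W * X))"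
      using P_pos[of "Suc n"] by (simp add: T_def X_def)
    have W: "x ^ ((Suc n)\<^sup>2) = W" by (simp only: W_def power2_eq_square)
    define c where "c = 2 / (1 + X)"
    have "0 < 1 + X" using p by (simp only: X_def)
    then have c: "c * (1 + X) = 2" by (simp add: c_def divide_simps)
    have "- (e * c * W) + - (e * c * (W * X)) = 2 * (- 1 * e * W)" for e
    proof -
      have "- (e * c * W) + - (e * c * (W * X)) = - (e * W * (c * (1 + X)))" by (simp add: algebra_simps)
      then show ?thesis unfolding c by simp
    qed
    then show ?thesis unfolding S T W c_def[symmetric] power_Suc .
  qed
  finally show ?case using Suc by (simp add: algebra_simps del: power_Suc)
qed

private lemma T_bound: assumes "1 \<le> s" "s \<le> n" shows "\<bar>T n s\<bar> \<le> 2 * x ^ n"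
proof -
  have "\<bar>T n s\<bar> = (2 / (1 + x ^ s)) * (P n / P s) * x ^ (s * Suc n)"
    using x P_pos[of n] P_pos[of s] by (simp add: T_def abs_mult power_abs abs_of_pos add_pos_pos)
  also have "\<dots> \<le> 2 * 1 * x ^ n"
  proof (intro mult_mono)
    show "2 / (1 + x ^ s) \<le> 2" using x by (simp add: divide_le_eq add_pos_pos)
    show "P n / P s \<le> 1" using P_pos[of s] P_antimono[of s n] assms by simp
    have "n \<le> s * Suc n" using assms by (metis Suc_n_not_le_n le_trans linear mult_le_mono1 nat_mult_1)
    then show "x ^ (s * Suc n) \<le> x ^ n" using x by (intro power_decreasing) auto
  qed (use x P_pos[of n] P_pos[of s] in \<open>auto intro: less_imp_le\<close>)
  finally show ?thesis by simp
qed

private lemma P_limit: "(\<lambda>n. 1 + 2 * (\<Sum>s=1..n. (-1) ^ s * x ^ (s\<^sup>2)) - P n) \<longlonglongrightarrow> 0"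
proof (rule tendsto_0_le)
  show "(\<lambda>n. real n * x ^ n) \<longlonglongrightarrow> 0" using x by (intro powser_times_n_limit_0) auto
  have "1 + 2 * (\<Sum>s=1..n. (-1) ^ s * x ^ (s\<^sup>2)) - P n = (\<Sum>s=1..n. T n s)" for n
  proof -
    have "(\<Sum>s\<le>n. T n s) = T n 0 + (\<Sum>s=1..n. T n s)"
      by (simp add: atMost_atLeast0 sum.atLeast_Suc_atMost)
    moreover have "T n 0 = P n" by (simp add: T_def P_def)
    ultimately show ?thesis using shanks[of n] by simp
  qed
  moreover have "\<bar>\<Sum>s=1..n. T n s\<bar> \<le> real n * (2 * x ^ n)" for n
    by (rule order.trans[OF sum_abs], rule order.trans[OF sum_bounded_above[of _ _ "2 * x ^ n"]])
       (auto simp: T_bound)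
  ultimately show "\<forall>\<^sub>F n in sequentially. norm (1 + 2 * (\<Sum>s=1..n. (-1) ^ s * x ^ (s\<^sup>2)) - P n) \<le>
     norm (real n * x ^ n) * 2"
    using x by (intro always_eventually) (simp add: abs_mult mult.assoc mult.left_commute mult.commute[of _ 2])
qed

lemma overpart_theta_real:
  assumes "(\<lambda>n. 1 + 2 * (\<Sum>s=1..n. (-1) ^ s * x ^ (s\<^sup>2))) \<longlonglongrightarrow> \<theta>"
  shows "eval_fps overpart_fps (of_real x) * of_real \<theta> = 1"
proof -
  have "(\<lambda>n. (1 + 2 * (\<Sum>s=1..n. (-1) ^ s * x ^ (s\<^sup>2))) -
          (1 + 2 * (\<Sum>s=1..n. (-1) ^ s * x ^ (s\<^sup>2)) - P n)) \<longlonglongrightarrow> \<theta> - 0"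
    by (intro tendsto_diff assms P_limit)
  then have "(\<lambda>n. complex_of_real (P n)) \<longlonglongrightarrow> of_real \<theta>" by (intro tendsto_of_real) simp
  moreover have "(\<lambda>n. \<Prod>i=1..n. (1 + of_real x ^ i) / (1 - of_real x ^ i)) \<longlonglongrightarrow> eval_fps overpart_fps (of_real x)"
    using x by (intro overpart_fps_limit) auto
  ultimately have "(\<lambda>n. (\<Prod>i=1..n. (1 + of_real x ^ i) / (1 - of_real x ^ i)) * complex_of_real (P n))
     \<longlonglongrightarrow> eval_fps overpart_fps (of_real x) * of_real \<theta>"
    by (intro tendsto_mult)
  moreover have "(\<Prod>i=1..n. (1 + of_real x ^ i) / (1 - of_real x ^ i)) * complex_of_real (P n) = 1" for n
  proof -
    have "(1 + complex_of_real x ^ i) / (1 - of_real x ^ i) * ((1 - of_real x ^ i) / (1 + of_real x ^ i)) = 1"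
      if "i \<in> {1..n}" for i
      using one_minus_power_nonzero[of "of_real x" i] x that by simp
    then show ?thesis unfolding P_def of_real_prod prod.distrib[symmetric]
      by (intro prod.neutral ballI) simp
  qed
  ultimately show ?thesis by (simp add: LIMSEQ_const_iff)
qed

end

text \<open>The factor 2 counts both \<open>s\<close> and \<open>-s\<close>. The sign may be written
  with \<open>n\<close> instead of \<open>s\<close>, since \<open>s\<close> and its square have the
  same parity.\<close>

definition theta_coeff :: "nat \<Rightarrow> int" where
  "theta_coeff n = (if n = 0 then 1 else if \<exists>s. n = s\<^sup>2 then 2 * (-1) ^ n else 0)"

definition theta_fps :: "complex fps" where
  "theta_fps = Abs_fps (\<lambda>n. of_int (theta_coeff n))"

lemma minus_one_power_square: "(-1) ^ (s\<^sup>2) = ((-1) ^ s :: 'a :: comm_ring_1)"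
  by (simp add: minus_one_power_iff)

lemma fps_conv_radius_theta_fps: "fps_conv_radius theta_fps \<ge> 1"
  by (rule fps_conv_radius_ge_1_bounded[of _ 2])
     (auto simp: theta_fps_def theta_coeff_def abs_mult power_abs)

lemma theta_series_limit:
  fixes x :: real assumes x: "0 < x" "x < 1"
  shows "(\<lambda>n. complex_of_real (1 + 2 * (\<Sum>s=1..n. (-1) ^ s * x ^ (s\<^sup>2)))) \<longlonglongrightarrow> eval_fps theta_fps (of_real x)"
proof -
  define f where "f n = of_int (theta_coeff n) * complex_of_real x ^ n" for n
  have "f sums eval_fps theta_fps (of_real x)"
    using sums_eval_fps[OF norm_less_conv_radius[OF fps_conv_radius_theta_fps], of "of_real x"] x
    by (simp add: theta_fps_def f_def[abs_def])
  moreover have "strict_mono (\<lambda>s::nat. s\<^sup>2)" by (auto simp: strict_mono_def intro: power_strict_mono)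
  moreover have "f n = 0" if "n \<notin> range (\<lambda>s::nat. s\<^sup>2)" for n
    using that by (auto simp: f_def theta_coeff_def)
  ultimately have "(\<lambda>s. f (s\<^sup>2)) sums eval_fps theta_fps (of_real x)"
    by (subst sums_mono_reindex) auto
  then have "(\<lambda>n. \<Sum>s\<le>n. f (s\<^sup>2)) \<longlonglongrightarrow> eval_fps theta_fps (of_real x)"
    by (simp add: sums_def_le)
  moreover have "(\<Sum>s\<le>n. f (s\<^sup>2)) = of_real (1 + 2 * (\<Sum>s=1..n. (-1) ^ s * x ^ (s\<^sup>2)))" for n
  proof -
    have "(\<Sum>s\<le>n. f (s\<^sup>2)) = f 0 + (\<Sum>s=1..n. f (s\<^sup>2))"
      by (simp add: atMost_atLeast0 sum.atLeast_Suc_atMost)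
    also have "f 0 = 1" by (simp add: f_def theta_coeff_def)
    also have "(\<Sum>s=1..n. f (s\<^sup>2)) = (\<Sum>s=1..n. of_real (2 * ((-1) ^ s * x ^ (s\<^sup>2))))"
      by (intro sum.cong) (auto simp: f_def theta_coeff_def minus_one_power_square)
    finally show ?thesis by (simp add: sum_distrib_left)
  qed
  ultimately show ?thesis by simp
qed

lemma overpart_theta_of_real:
  fixes x :: real assumes x: "0 < x" "x < 1"
  shows "eval_fps overpart_fps (of_real x) * eval_fps theta_fps (of_real x) = 1"
proof -
  have "\<exists>\<theta>. eval_fps theta_fps (of_real x) = of_real \<theta>"
    using tendsto_Re[OF theta_series_limit[OF x]] tendsto_Im[OF theta_series_limit[OF x]]
    by (intro exI[of _ "Re (eval_fps theta_fps (of_real x))"]) (simp add: complex_eq_iff LIMSEQ_const_iff)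
  then obtain \<theta> where \<theta>: "eval_fps theta_fps (of_real x) = of_real \<theta>" by blast
  have "(\<lambda>n. 1 + 2 * (\<Sum>s=1..n. (-1) ^ s * x ^ (s\<^sup>2))) \<longlonglongrightarrow> \<theta>"
    using theta_series_limit[OF x] unfolding \<theta> by (simp only: tendsto_of_real_iff)
  from overpart_theta_real[OF x this] show ?thesis by (simp add: \<theta>)
qed

text \<open>The two sides agree on the interval \<open>(0, 1)\<close>. A nonzero difference would be
  a power series whose zero at the origin is isolated, contradicting its zeros at small positive
  reals.\<close>

lemma overpart_theta_fps: "overpart_fps * theta_fps = 1"
proof (rule ccontr)
  assume "overpart_fps * theta_fps \<noteq> 1"
  then obtain m where m: "fps_nth (overpart_fps * theta_fps - 1) m \<noteq> 0"
    by (metis fps_nonzero_nth right_minus_eq)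
  let ?g = "overpart_fps * theta_fps - 1"
  have m0: "m > 0"
  proof (rule ccontr)
    assume "\<not> m > 0"
    then have "fps_nth ?g m = 0"
      by (simp add: overpart_fps_def theta_fps_def theta_coeff_def overpart_0)
    then show False using m by simp
  qed
  have R: "fps_conv_radius (overpart_fps * theta_fps) \<ge> 1"
    by (rule order.trans[OF _ fps_conv_radius_mult])
       (simp add: fps_conv_radius_overpart_fps fps_conv_radius_theta_fps)
  have Rg: "fps_conv_radius ?g \<ge> 1"
    by (rule order.trans[OF _ fps_conv_radius_diff]) (simp add: R)
  obtain s where s: "0 < s" "\<And>z. z \<in> cball 0 s - {0} \<Longrightarrow> eval_fps ?g z \<noteq> 0"
  proof (rule powser_0_nonzero[of 1 0 "fps_nth ?g" "eval_fps ?g" m])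
    show "(\<lambda>n. fps_nth ?g n * (z - 0) ^ n) sums eval_fps ?g z" if "norm (z - 0) < 1" for z
      using sums_eval_fps[OF norm_less_conv_radius[OF Rg]] that by simp
    show "eval_fps ?g 0 = 0"
      by (simp add: eval_fps_at_0 overpart_fps_def theta_fps_def theta_coeff_def overpart_0)
  qed (use m m0 in auto)
  define x where "x = min s (1/2)"
  have x: "0 < x" "x < 1" "x \<le> s" using s by (auto simp: x_def)
  have "eval_fps ?g (of_real x) = 0"
  proof -
    have "norm (complex_of_real x) < 1" using x by simp
    note * = norm_less_conv_radius[OF _ this]
    show ?thesis
      using overpart_theta_of_real[OF x(1,2)]
        *[OF fps_conv_radius_overpart_fps] *[OF fps_conv_radius_theta_fps] *[OF R]
      by (simp add: eval_fps_diff eval_fps_mult)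
  qed
  moreover have "complex_of_real x \<in> cball 0 s - {0}" using x by auto
  ultimately show False using s(2) by blast
qed

text \<open>Compare coefficients of \<open>q^n\<close> in Gauss's identity: only square indices
  contribute. The number \<open>m\<close> merely has to be large enough to reach every square up to
  \<open>n\<close>.\<close>

lemma overpart_recurrence:
  assumes "0 < n" "n < (Suc m)\<^sup>2"
  shows "int (overpart n) = (\<Sum>s=1..m. if s\<^sup>2 \<le> n then 2 * (-1) ^ Suc s * int (overpart (n - s\<^sup>2)) else 0)"
proof -
  have "0 = fps_nth (theta_fps * overpart_fps) n"
    using assms overpart_theta_fps by (simp add: mult.commute)
  also have "\<dots> = of_int (\<Sum>i\<le>n. theta_coeff i * int (overpart (n - i)))"
    by (simp add: fps_mult_nth theta_fps_def overpart_fps_def atMost_atLeast0)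
  finally have "0 = (\<Sum>i\<le>n. theta_coeff i * int (overpart (n - i)))"
    by (metis of_int_0_eq_iff)
  also have "\<dots> = (\<Sum>i\<in>(\<lambda>s. s\<^sup>2) ` {s. s\<^sup>2 \<le> n}. theta_coeff i * int (overpart (n - i)))"
    by (intro sum.mono_neutral_right) (auto simp: theta_coeff_def)
  also have "\<dots> = (\<Sum>s | s\<^sup>2 \<le> n. theta_coeff (s\<^sup>2) * int (overpart (n - s\<^sup>2)))"
    by (subst sum.reindex) (auto simp: inj_on_def)
  also have "{s. s\<^sup>2 \<le> n} = insert 0 {s \<in> {1..m}. s\<^sup>2 \<le> n}"
  proof -
    have "s \<le> m" if "s\<^sup>2 \<le> n" for s
      using that assms by (metis leD le_less_trans not_less_eq_eq power_mono zero_le)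
    then show ?thesis using assms by (auto simp: not_less_eq_eq[symmetric] gr0_conv_Suc)
  qed
  also have "(\<Sum>s\<in>insert 0 {s \<in> {1..m}. s\<^sup>2 \<le> n}. theta_coeff (s\<^sup>2) * int (overpart (n - s\<^sup>2))) =
     int (overpart n) + (\<Sum>s\<in>{s \<in> {1..m}. s\<^sup>2 \<le> n}. theta_coeff (s\<^sup>2) * int (overpart (n - s\<^sup>2)))"
    by (subst sum.insert) (auto simp: theta_coeff_def)
  also have "(\<Sum>s\<in>{s \<in> {1..m}. s\<^sup>2 \<le> n}. theta_coeff (s\<^sup>2) * int (overpart (n - s\<^sup>2))) =
      (\<Sum>s\<in>{s \<in> {1..m}. s\<^sup>2 \<le> n}. - (2 * (-1) ^ Suc s * int (overpart (n - s\<^sup>2))))"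
    by (intro sum.cong) (auto simp: theta_coeff_def minus_one_power_square)
  also have "\<dots> = - (\<Sum>s=1..m. if s\<^sup>2 \<le> n then 2 * (-1) ^ Suc s * int (overpart (n - s\<^sup>2)) else 0)"
    by (simp only: sum_negf sum.inter_filter finite_atLeastAtMost)
  finally show ?thesis by linarith
qed

section \<open>The theta transformation\<close>

lemma gaussian_cos_integral:
  fixes s b :: real
  assumes "s > 0"
  shows "has_bochner_integral lborel (\<lambda>u. exp (- s * u\<^sup>2) * cos (b * u)) (sqrt (pi / s) * exp (- b\<^sup>2 / (4 * s)))"
proof -
  \<comment> \<open>The substitution \<open>x = sqrt (2 * s) * u\<close> turns the integral into the
    characteristic function of the standard normal distribution at this \<open>t\<close>.\<close>
  define t where "t = b / sqrt (2 * s)"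
  have int: "integrable lborel (\<lambda>x. std_normal_density x * cos (t * x))"
    by (rule Bochner_Integration.integrable_bound[of _ std_normal_density])
       (auto simp: abs_mult intro!: mult_left_le)
  have i1: "integrable std_normal_distribution (\<lambda>x. iexp (t * x))"
    using prob_space.finite_measure[OF prob_space_normal_density[of 1 0]]
    by (intro finite_measure.integrable_const_bound[where B=1]) auto
  have "(LINT x|std_normal_distribution. cos (t * x)) = Re (CLINT x|std_normal_distribution. iexp (t * x))"
    using integral_Re[OF i1] by (simp add: cis_conv_exp[symmetric] Re_exp)
  also have "\<dots> = exp (- t\<^sup>2 / 2)"
    using fun_cong[OF char_std_normal_distribution, of t] unfolding char_def
    by (metis Re_complex_of_real)
  finally have "(LINT x|lborel. std_normal_density x * cos (t * x)) = exp (- t\<^sup>2 / 2)"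
    by (subst (asm) integral_density) auto
  then have 1: "has_bochner_integral lborel (\<lambda>x. std_normal_density x * cos (t * x)) (exp (- t\<^sup>2 / 2))"
    using int by (simp add: has_bochner_integral_iff)
  have "has_bochner_integral lborel (\<lambda>x. std_normal_density (0 + sqrt (2 * s) * x) * cos (t * (0 + sqrt (2 * s) * x)))
     (exp (- t\<^sup>2 / 2) /\<^sub>R \<bar>sqrt (2 * s)\<bar>)"
    using 1 assms by (subst lborel_has_bochner_integral_real_affine_iff[symmetric]) auto
  then have "has_bochner_integral lborel (\<lambda>x. sqrt (2 * pi) * (std_normal_density (0 + sqrt (2 * s) * x) * cos (t * (0 + sqrt (2 * s) * x))))
     (sqrt (2 * pi) * (exp (- t\<^sup>2 / 2) /\<^sub>R \<bar>sqrt (2 * s)\<bar>))"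
    by (rule has_bochner_integral_mult_right)
  also have "(\<lambda>x. sqrt (2 * pi) * (std_normal_density (0 + sqrt (2 * s) * x) * cos (t * (0 + sqrt (2 * s) * x)))) =
     (\<lambda>u. exp (- s * u\<^sup>2) * cos (b * u))"
    using assms by (simp add: std_normal_density_def t_def power_mult_distrib fun_eq_iff)
  also have "sqrt (2 * pi) * (exp (- t\<^sup>2 / 2) /\<^sub>R \<bar>sqrt (2 * s)\<bar>) = sqrt (pi / s) * exp (- b\<^sup>2 / (4 * s))"
    using assms by (simp add: t_def power_divide real_sqrt_mult real_sqrt_divide field_simps)
  finally show ?thesis .
qed

lemma gaussian_cos_integral_half:
  fixes s b :: real
  assumes "s > 0"
  \<comment> \<open>The limit runs over integer endpoints so that the integral can later be cut into
    unit intervals.\<close>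
  shows "(\<lambda>N. integral {0..real N} (\<lambda>u. exp (- s * u\<^sup>2) * cos (b * u)))
           \<longlonglongrightarrow> sqrt (pi / s) * exp (- b\<^sup>2 / (4 * s)) / 2"
proof -
  define f where "f u = exp (- s * u\<^sup>2) * cos (b * u)" for u
  have f: "integrable lborel f" "integral\<^sup>L lborel f = sqrt (pi / s) * exp (- b\<^sup>2 / (4 * s))"
    using gaussian_cos_integral[OF assms, of b] by (simp_all add: has_bochner_integral_iff f_def[abs_def])
  define g where "g u = indicator {0..} u *\<^sub>R f u" for u :: real
  have g: "integrable lborel g" unfolding g_def[abs_def]
    by (intro integrable_mult_indicator f) auto
  have "has_bochner_integral lborel f (2 *\<^sub>R integral\<^sup>L lborel g)"
    by (rule has_bochner_integral_even_function)
       (use g in \<open>auto simp: has_bochner_integral_iff f_def g_def[abs_def]\<close>)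
  then have J: "integral\<^sup>L lborel g = sqrt (pi / s) * exp (- b\<^sup>2 / (4 * s)) / 2"
    using f by (simp add: has_bochner_integral_iff)
  have "((\<lambda>y. \<integral> x. indicator {.. y} x *\<^sub>R g x \<partial>lborel) \<longlongrightarrow> integral\<^sup>L lborel g) at_top"
    by (rule tendsto_integral_at_top) (use g in auto)
  then have "(\<lambda>N. \<integral> x. indicator {.. real N} x *\<^sub>R g x \<partial>lborel) \<longlonglongrightarrow> integral\<^sup>L lborel g"
    by (rule filterlim_compose) (rule filterlim_real_sequentially)
  moreover have "(\<integral> x. indicator {.. real N} x *\<^sub>R g x \<partial>lborel) = integral {0..real N} f" for N
  proof -
    have "(\<integral> x. indicator {.. real N} x *\<^sub>R g x \<partial>lborel) = (LINT x : {0..real N} | lborel. f x)"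
      unfolding set_lebesgue_integral_def g_def
      by (intro Bochner_Integration.integral_cong) (auto split: split_indicator)
    also have "\<dots> = integral {0..real N} f"
      by (rule set_borel_integral_eq_integral)
         (unfold set_integrable_def, rule integrable_mult_indicator, simp, rule f)
    finally show ?thesis .
  qed
  ultimately show ?thesis unfolding J by (simp add: f_def[abs_def])
qed

section \<open>Poisson summation through cosine moments\<close>

lemma cos_add_2pi_multiple: "cos (x + real k * (2 * pi)) = cos x"
proof (induction k)
  case (Suc k)
  have "x + real (Suc k) * (2 * pi) = (x + real k * (2 * pi)) + 2 * pi" by (simp add: algebra_simps)
  then show ?case using Suc by (simp only: cos_periodic)
qed simp

text \<open>Fold \<open>[n, n + 1]\<close> about its midpoint: the points \<open>n + x\<close> and
  \<open>n + 1 - x\<close> have the same value of \<open>cos (2 * pi * m * u)\<close>, by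
  periodicity and evenness.\<close>

lemma gaussian_fold:
  fixes s :: real and m n :: nat
  shows "((\<lambda>x. (exp (- s * (real n + x)\<^sup>2) + exp (- s * (real n + 1 - x)\<^sup>2)) * cos (2 * pi * real m * x))
     has_integral integral {real n..real (Suc n)} (\<lambda>u. exp (- s * u\<^sup>2) * cos (2 * pi * real m * u))) {0..1/2}"
proof -
  define f where "f u = exp (- s * u\<^sup>2) * cos (2 * pi * real m * u)" for u
  have int: "f integrable_on {a..b}" for a b
    unfolding f_def by (intro integrable_continuous_interval continuous_intros)
  have per: "cos (2 * pi * real m * (real n + x)) = cos (2 * pi * real m * x)"
     "cos (2 * pi * real m * (real n + 1 - x)) = cos (2 * pi * real m * x)" for x
  proof -
    have "2 * pi * real m * (real n + x) = 2 * pi * real m * x + real (m * n) * (2 * pi)"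
      "2 * pi * real m * (real n + 1 - x) = - (2 * pi * real m * x) + real (m * (n + 1)) * (2 * pi)"
      by (simp_all add: algebra_simps)
    then show "cos (2 * pi * real m * (real n + x)) = cos (2 * pi * real m * x)"
     "cos (2 * pi * real m * (real n + 1 - x)) = cos (2 * pi * real m * x)"
      by (simp_all only: cos_minus cos_add_2pi_multiple)
  qed
  have 1: "((\<lambda>x. f (x + real n)) has_integral integral {real n..real n + 1/2} f) {0..1/2}"
    using has_integral_shift_real_ivl[of f "integral {real n..real n + 1/2} f" "real n" "real n + 1/2" "real n"]
      integrable_integral[OF int] by simp
  have "((\<lambda>x. f (- x)) has_integral integral {real n + 1/2..real n + 1} f) {-(real n + 1)..-(real n + 1/2)}"
    unfolding has_integral_reflect_real by (rule integrable_integral[OF int])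
  from has_integral_shift_real_ivl[OF this, of "- (real n + 1)"]
  have 2: "((\<lambda>x. f (real n + 1 - x)) has_integral integral {real n + 1/2..real n + 1} f) {0..1/2}"
    by (simp add: algebra_simps)
  have 3: "integral {real n..real n + 1/2} f + integral {real n + 1/2..real n + 1} f = integral {real n..real n + 1} f"
    by (rule Henstock_Kurzweil_Integration.integral_combine) (auto intro: int)
  show ?thesis
    using has_integral_add[OF 1 2] unfolding 3 add.commute[of _ "real n"]
    unfolding f_def[abs_def] per by (simp add: distrib_right add.commute)
qed

text \<open>Completeness of the cosines on half a period, without convergence of Fourier series.
  Vanishing moments make \<open>h\<close> orthogonal to every polynomial in
  \<open>cos (2 * pi * x)\<close>. Such polynomials approximate \<open>h\<close> uniformly, so the
  integral of \<open>h * h\<close> is below every positive number.\<close>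

lemma cos_moments_zero:
  fixes h :: "real \<Rightarrow> real"
  assumes h: "continuous_on {0..1/2} h"
    and moments: "\<And>m::nat. integral {0..1/2} (\<lambda>x. h x * cos (2 * pi * real m * x)) = 0"
    and x: "x \<in> {0..1/2}"
  shows "h x = 0"
proof -
  have int: "(\<lambda>x. h x * g x) integrable_on {0..1/2}" if "continuous_on {0..1/2} g" for g
    by (intro integrable_continuous_interval continuous_intros h that)
  have pow: "integral {0..1/2} (\<lambda>x. h x * (cos (2 * pi * x) ^ j * cos (2 * pi * real m * x))) = 0" for j m
  proof (induction j arbitrary: m)
    case 0
    then show ?case using moments by simp
  next
    case (Suc j)
    show ?case
    proof (cases m)
      case 0
      \<comment> \<open>For frequency 0 the product formula would need frequency -1; here the
        additional cosine factor is itself the one of frequency 1.\<close>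
      then show ?thesis using Suc[of 1] by (simp add: mult.commute)
    next
      case (Suc k)
      have "h y * (cos (2 * pi * y) ^ Suc j * cos (2 * pi * real m * y)) =
          h y * (cos (2 * pi * y) ^ j * cos (2 * pi * real (Suc m) * y)) / 2 +
          h y * (cos (2 * pi * y) ^ j * cos (2 * pi * real k * y)) / 2" for y
      proof -
        have *: "cos (2 * pi * y) * cos (2 * pi * real m * y) =
            (cos (2 * pi * real (Suc m) * y) + cos (2 * pi * real k * y)) / 2"
          using cos_times_cos[of "2 * pi * real m * y" "2 * pi * y"] by (simp add: Suc algebra_simps)
        have "h y * (cos (2 * pi * y) ^ Suc j * cos (2 * pi * real m * y)) =
          h y * (cos (2 * pi * y) ^ j * (cos (2 * pi * y) * cos (2 * pi * real m * y)))" by simp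
        then show ?thesis unfolding * by (simp only: distrib_left add_divide_distrib times_divide_eq_right)
      qed
      then have "integral {0..1/2} (\<lambda>y. h y * (cos (2 * pi * y) ^ Suc j * cos (2 * pi * real m * y))) =
        integral {0..1/2} (\<lambda>y. h y * (cos (2 * pi * y) ^ j * cos (2 * pi * real (Suc m) * y)) / 2 +
          h y * (cos (2 * pi * y) ^ j * cos (2 * pi * real k * y)) / 2)"
        by (simp only:)
      also have "\<dots> = 0"
        by (subst Henstock_Kurzweil_Integration.integral_add)
           (use Suc.IH[of "Suc m"] Suc.IH[of k] in \<open>auto intro!: integrable_on_divide int continuous_intros\<close>)
      finally show ?thesis .
    qed
  qed
  have poly: "integral {0..1/2} (\<lambda>x. h x * p (cos (2 * pi * x))) = 0" if "real_polynomial_function p" for p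
  proof -
    obtain a n where p: "p = (\<lambda>x. \<Sum>i\<le>n. a i * x ^ i)"
      using \<open>real_polynomial_function p\<close> by (auto simp: real_polynomial_function_iff_sum)
    have "integral {0..1/2} (\<lambda>x. h x * p (cos (2 * pi * x))) =
        integral {0..1/2} (\<lambda>x. \<Sum>i\<le>n. a i * (h x * (cos (2 * pi * x) ^ i * cos (2 * pi * real 0 * x))))"
      by (simp add: p sum_distrib_left mult.left_commute)
    also have "\<dots> = (\<Sum>i\<le>n. integral {0..1/2} (\<lambda>x. a i * (h x * (cos (2 * pi * x) ^ i * cos (2 * pi * real 0 * x)))))"
      by (intro Henstock_Kurzweil_Integration.integral_sum integrable_continuous_interval continuous_intros h) auto
    also have "\<dots> = 0"
      by (intro sum.neutral ballI) (simp only: Henstock_Kurzweil_Integration.integral_mult_right pow mult_zero_right)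
    finally show ?thesis .
  qed
  \<comment> \<open>The map \<open>x \<mapsto> cos (2 * pi * x)\<close> is a bijection from the half
    period onto \<open>[-1, 1]\<close>, so \<open>h\<close> becomes a continuous function of the
    cosine, to which the Weierstrass theorem applies.\<close>
  define k where "k y = h (arccos y / (2 * pi))" for y
  have k: "h x = k (cos (2 * pi * x))" if "x \<in> {0..1/2}" for x
    using that by (simp add: k_def arccos_cos)
  have contk: "continuous_on {-1..1} k"
    unfolding k_def
  proof (rule continuous_on_compose2[OF h, of _ "\<lambda>y. arccos y / (2 * pi)"])
    show "continuous_on {-1..1} (\<lambda>y. arccos y / (2 * pi))" by (intro continuous_intros) auto
    show "(\<lambda>y. arccos y / (2 * pi)) ` {-1..1} \<subseteq> {0..1/2}"
      using arccos_lbound arccos_ubound by (auto simp: divide_le_eq)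
  qed
  define C where "C = integral {0..1/2} (\<lambda>x. \<bar>h x\<bar>)"
  have C: "C \<ge> 0" unfolding C_def by (rule Henstock_Kurzweil_Integration.integral_nonneg)
     (auto intro!: integrable_continuous_interval continuous_intros h)
  have hh: "integral {0..1/2} (\<lambda>x. h x * h x) \<le> e * C" if e: "e > 0" for e
  proof -
    obtain p where p: "real_polynomial_function p" "\<And>y. y \<in> {-1..1} \<Longrightarrow> \<bar>k y - p y\<bar> < e"
      using Stone_Weierstrass_real_polynomial_function[OF _ contk e] by auto
    have contp: "continuous_on {0..1/2} (\<lambda>x. p (cos (2 * pi * x)))"
    proof -
      have "continuous_on UNIV p"
        by (rule continuous_on_polymonial_function) (use p(1) in \<open>simp add: real_polynomial_function_eq\<close>)
      then show ?thesis
        by (rule continuous_on_compose2[of UNIV p _ "\<lambda>x. cos (2 * pi * x)"]) (auto intro!: continuous_intros)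
    qed
    have "integral {0..1/2} (\<lambda>x. h x * h x) =
        integral {0..1/2} (\<lambda>x. h x * h x) - integral {0..1/2} (\<lambda>x. h x * p (cos (2 * pi * x)))"
      using poly[OF p(1)] by simp
    also have "\<dots> = integral {0..1/2} (\<lambda>x. h x * h x - h x * p (cos (2 * pi * x)))"
      by (rule Henstock_Kurzweil_Integration.integral_diff[symmetric]) (intro int h contp)+
    also have "\<dots> \<le> integral {0..1/2} (\<lambda>x. e * \<bar>h x\<bar>)"
    proof (rule integral_le)
      fix x :: real assume x: "x \<in> {0..1/2}"
      have "\<bar>h x - p (cos (2 * pi * x))\<bar> \<le> e"
        using p(2)[of "cos (2 * pi * x)"] k[OF x] by simp
      then have "\<bar>h x\<bar> * \<bar>h x - p (cos (2 * pi * x))\<bar> \<le> \<bar>h x\<bar> * e" by (rule mult_left_mono) simp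
      then show "h x * h x - h x * p (cos (2 * pi * x)) \<le> e * \<bar>h x\<bar>"
        by (simp add: abs_mult[symmetric] right_diff_distrib mult.commute)
    qed (auto intro!: integrable_continuous_interval continuous_intros h contp)
    also have "\<dots> = e * C" by (simp add: C_def)
    finally show ?thesis .
  qed
  have "integral {0..1/2} (\<lambda>x. h x * h x) \<le> 0"
  proof (rule field_le_epsilon)
    fix e :: real assume e: "e > 0"
    have "integral {0..1/2} (\<lambda>x. h x * h x) \<le> e / (C + 1) * C"
      using e C by (intro hh divide_pos_pos) auto
    also have "\<dots> \<le> e" using e C by (simp add: field_simps)
    finally show "integral {0..1/2} (\<lambda>x. h x * h x) \<le> 0 + e" by simp
  qed
  moreover have "integral {0..1/2} (\<lambda>x. h x * h x) \<ge> 0"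
    by (rule Henstock_Kurzweil_Integration.integral_nonneg) (auto intro: int h)
  ultimately have "integral {0..1/2} (\<lambda>x. h x * h x) = 0" by simp
  then have "\<forall>x\<in>{0..1/2}. h x * h x = 0"
    by (subst (asm) integral_eq_0_iff) (auto intro!: continuous_intros h)
  then show ?thesis using x by auto
qed

lemma integral_suminf:
  fixes f :: "nat \<Rightarrow> real \<Rightarrow> real"
  assumes cont: "\<And>n. continuous_on {a..b} (f n)"
    and bound: "\<And>n x. x \<in> {a..b} \<Longrightarrow> \<bar>f n x\<bar> \<le> M n" and M: "summable M"
  shows "(\<lambda>n. integral {a..b} (f n)) sums integral {a..b} (\<lambda>x. \<Sum>n. f n x)" (is ?thesis1)
    and "continuous_on {a..b} (\<lambda>x. \<Sum>n. f n x)" (is ?thesis2)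
proof -
  have ul: "uniform_limit {a..b} (\<lambda>N x. \<Sum>n<N. f n x) (\<lambda>x. \<Sum>n. f n x) sequentially"
    by (rule Weierstrass_m_test) (use bound M in auto)
  have contN: "continuous_on {a..b} (\<lambda>x. \<Sum>n<N. f n x)" for N
    by (intro continuous_intros cont)
  show ?thesis2
    by (rule uniform_limit_theorem[OF _ ul]) (auto intro: always_eventually contN)
  obtain I J where IJ: "\<And>N. ((\<lambda>x. \<Sum>n<N. f n x) has_integral I N) {a..b}"
    "((\<lambda>x. \<Sum>n. f n x) has_integral J) {a..b}" "I \<longlonglongrightarrow> J"
    using uniform_limit_integral[OF ul contN] by auto
  have "I N = (\<Sum>n<N. integral {a..b} (f n))" for N
    using integral_unique[OF IJ(1)[of N]]
    by (subst (asm) Henstock_Kurzweil_Integration.integral_sum)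
       (auto intro: integrable_continuous_interval cont)
  then have "I = (\<lambda>N. \<Sum>n<N. integral {a..b} (f n))" by (rule ext)
  then show ?thesis1 using IJ(2,3) by (simp add: sums_def integral_unique)
qed

lemma cos_integral_half_period:
  fixes k :: int
  shows "((\<lambda>x. cos (2 * pi * of_int k * x)) has_integral (if k = 0 then 1/2 else 0)) {0..1/2}"
proof (cases "k = 0")
  case True
  then show ?thesis using has_integral_const_real[of "1::real" 0 "1/2"] by simp
next
  case False
  have "((\<lambda>x. cos (2 * pi * of_int k * x)) has_integral
     (sin (2 * pi * of_int k * (1/2)) / (2 * pi * of_int k) - sin (2 * pi * of_int k * 0) / (2 * pi * of_int k))) {0..1/2}"
    by (rule fundamental_theorem_of_calculus)
       (use False in \<open>auto intro!: derivative_eq_intros simp: has_real_derivative_iff_has_vector_derivative[symmetric]\<close>)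
  moreover have "sin (pi * of_int k) = 0" by (simp add: sin_zero_iff_int2)
  ultimately show ?thesis using False by simp
qed

lemma cos_cos_integral:
  fixes j m :: nat
  shows "((\<lambda>x. cos (2 * pi * real (Suc j) * x) * cos (2 * pi * real m * x)) has_integral
     (if m = Suc j then 1/4 else 0)) {0..1/2}"
proof -
  have "((\<lambda>x. (cos (2 * pi * of_int (int m - int (Suc j)) * x) + cos (2 * pi * of_int (int (Suc j) + int m) * x)) / 2)
     has_integral (((if int m - int (Suc j) = 0 then 1/2 else 0) + (if int (Suc j) + int m = 0 then 1/2 else 0)) / 2)) {0..1/2}"
    by (intro has_integral_divide has_integral_add cos_integral_half_period)
  also have "(\<lambda>x. (cos (2 * pi * of_int (int m - int (Suc j)) * x) + cos (2 * pi * of_int (int (Suc j) + int m) * x)) / 2) =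
     (\<lambda>x. cos (2 * pi * real (Suc j) * x) * cos (2 * pi * real m * x))"
    by (simp add: cos_times_cos algebra_simps)
  also have "((if int m - int (Suc j) = 0 then 1/2 else 0) + (if int (Suc j) + int m = 0 then 1/2 else 0)) / 2 =
     (if m = Suc j then 1/4 else (0::real))" by auto
  finally show ?thesis .
qed

lemma integral_telescope:
  fixes f :: "real \<Rightarrow> real"
  assumes "continuous_on UNIV f"
  shows "(\<Sum>n<N. integral {real n..real (Suc n)} f) = integral {0..real N} f"
proof (induction N)
  case (Suc N)
  have "integral {0..real N} f + integral {real N..real (Suc N)} f = integral {0..real (Suc N)} f"
    by (rule Henstock_Kurzweil_Integration.integral_combine)
       (auto intro!: integrable_continuous_interval continuous_on_subset[OF assms])
  then show ?case using Suc by simp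
qed simp

text \<open>The left side is the sum of \<open>exp (- s * (k + x)^2)\<close> over all integers
  \<open>k\<close>, with \<open>n\<close> and \<open>-(n + 1)\<close> paired. It is even and
  1-periodic in \<open>x\<close>, so half a period suffices. Both sides are continuous with equal
  cosine moments: on the left the folded pieces reassemble the half-line Gaussian integral, on the
  right orthogonality isolates one term.\<close>

lemma theta_poisson_summation:
  fixes s x :: real
  assumes s: "s > 0" and x: "x \<in> {0..1/2}"
  shows "(\<Sum>n. exp (- s * (real n + x)\<^sup>2) + exp (- s * (real n + 1 - x)\<^sup>2)) =
     sqrt (pi / s) * (1 + 2 * (\<Sum>j. exp (- pi\<^sup>2 * (real (Suc j))\<^sup>2 / s) * cos (2 * pi * real (Suc j) * x)))"
proof -
  define f where "f n x = exp (- s * (real n + x)\<^sup>2) + exp (- s * (real n + 1 - x)\<^sup>2)" for n :: nat and x :: real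
  define c where "c j = exp (- pi\<^sup>2 * (real (Suc j))\<^sup>2 / s)" for j :: nat
  define g where "g j x = c j * cos (2 * pi * real (Suc j) * x)" for j :: nat and x :: real
  define F where "F x = (\<Sum>n. f n x)" for x
  define G where "G x = (\<Sum>j. g j x)" for x
  define M where "M n = 2 * exp (- s) ^ n" for n :: nat
  define L where "L n = exp (- pi\<^sup>2 / s) ^ n" for n :: nat
  have M: "summable M" unfolding M_def using s by (intro summable_mult summable_geometric) auto
  have L: "summable L" unfolding L_def using s by (intro summable_geometric) auto
  have fb: "\<bar>f n x\<bar> \<le> M n" if "x \<in> {0..1/2}" for n x
  proof -
    have e: "exp (- s * y\<^sup>2) \<le> exp (- s) ^ n" if "real n \<le> y" for y
    proof -
      have "real n \<le> (real n)\<^sup>2" by (cases n) (auto simp: power2_eq_square)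
      also have "\<dots> \<le> y\<^sup>2" using that by (intro power_mono) auto
      finally show ?thesis using s by (simp add: exp_of_nat_mult[symmetric])
    qed
    have "\<bar>f n x\<bar> = exp (- s * (real n + x)\<^sup>2) + exp (- s * (real n + 1 - x)\<^sup>2)"
      unfolding f_def by (intro abs_of_nonneg add_nonneg_nonneg) auto
    also have "\<dots> \<le> exp (- s) ^ n + exp (- s) ^ n" by (intro add_mono e) (use that in auto)
    finally show ?thesis by (simp add: M_def)
  qed
  have cb: "\<bar>c j\<bar> \<le> L j" for j
  proof -
    have "real j \<le> (real (Suc j))\<^sup>2" by (simp add: power2_eq_square algebra_simps)
    then show ?thesis using s unfolding c_def L_def exp_of_nat_mult[symmetric]
      by (simp add: divide_right_mono mult_right_mono)
  qed
  have gb: "\<bar>g j x\<bar> \<le> L j" for j x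
    using mult_mono[OF cb[of j] abs_cos_le_one[of "2 * pi * real (Suc j) * x"]] cb[of j]
    by (simp add: g_def abs_mult)
  have mul_le: "\<bar>u * cos v\<bar> \<le> B" if "\<bar>u\<bar> \<le> B" for u v B :: real
    using mult_mono[OF that abs_cos_le_one[of v]] that by (simp add: abs_mult)
  have contf: "continuous_on A (f n)" and contg: "continuous_on A (g n)" for A n
    unfolding f_def g_def by (intro continuous_intros)+
  have contF: "continuous_on {0..1/2} F" unfolding F_def
    by (rule integral_suminf(2)[OF contf fb M])
  have contG: "continuous_on {0..1/2} G" unfolding G_def
    by (rule integral_suminf(2)[OF contg gb L])
  have intF: "integral {0..1/2} (\<lambda>x. F x * cos (2 * pi * real m * x)) =
      sqrt (pi / s) * exp (- pi\<^sup>2 * (real m)\<^sup>2 / s) / 2" for m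
  proof -
    define q where "q u = exp (- s * u\<^sup>2) * cos (2 * pi * real m * u)" for u
    have "(\<lambda>n. integral {0..1/2} (\<lambda>x. f n x * cos (2 * pi * real m * x))) sums
       integral {0..1/2} (\<lambda>x. \<Sum>n. f n x * cos (2 * pi * real m * x))"
      by (rule integral_suminf(1)[OF _ _ M]) (auto intro!: continuous_intros contf mul_le fb)
    also have "(\<lambda>n. integral {0..1/2} (\<lambda>x. f n x * cos (2 * pi * real m * x))) =
       (\<lambda>n. integral {real n..real (Suc n)} q)"
      using integral_unique[OF gaussian_fold[of s _ m]] by (simp add: f_def q_def[abs_def])
    also have "integral {0..1/2} (\<lambda>x. \<Sum>n. f n x * cos (2 * pi * real m * x)) =
      integral {0..1/2} (\<lambda>x. F x * cos (2 * pi * real m * x))"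
    proof (rule Henstock_Kurzweil_Integration.integral_cong)
      fix x :: real assume "x \<in> {0..1/2}"
      then have "summable (\<lambda>n. f n x)" by (intro summable_comparison_test'[OF M]) (auto intro: fb)
      then show "(\<Sum>n. f n x * cos (2 * pi * real m * x)) = F x * cos (2 * pi * real m * x)"
        by (simp add: F_def suminf_mult2)
    qed
    finally have "(\<lambda>N. integral {0..real N} q) \<longlonglongrightarrow> integral {0..1/2} (\<lambda>x. F x * cos (2 * pi * real m * x))"
      unfolding sums_def by (subst (asm) integral_telescope) (auto simp: q_def intro!: continuous_intros)
    moreover have "(\<lambda>N. integral {0..real N} q) \<longlonglongrightarrow> sqrt (pi / s) * exp (- (2 * pi * real m)\<^sup>2 / (4 * s)) / 2"
      using gaussian_cos_integral_half[OF s, of "2 * pi * real m"] unfolding q_def[abs_def] .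
    ultimately have "integral {0..1/2} (\<lambda>x. F x * cos (2 * pi * real m * x)) =
      sqrt (pi / s) * exp (- (2 * pi * real m)\<^sup>2 / (4 * s)) / 2"
      by (rule LIMSEQ_unique)
    then show ?thesis by (simp add: power_mult_distrib)
  qed
  have intG: "integral {0..1/2} (\<lambda>x. G x * cos (2 * pi * real m * x)) =
      (if m = 0 then 0 else exp (- pi\<^sup>2 * (real m)\<^sup>2 / s) / 4)" for m
  proof -
    have "(\<lambda>j. integral {0..1/2} (\<lambda>x. g j x * cos (2 * pi * real m * x))) sums
       integral {0..1/2} (\<lambda>x. \<Sum>j. g j x * cos (2 * pi * real m * x))"
      by (rule integral_suminf(1)[OF _ _ L]) (auto intro!: continuous_intros contg mul_le gb)
    \<comment> \<open>The index \<open>j\<close> stands for frequency \<open>j + 1\<close>. For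
      \<open>m = 0\<close> the natural number \<open>m - 1\<close> is 0, so the inner conditional
      has to annihilate that term.\<close>
    also have "(\<lambda>j. integral {0..1/2} (\<lambda>x. g j x * cos (2 * pi * real m * x))) =
       (\<lambda>j. if j = m - 1 then (if m = 0 then 0 else c j / 4) else 0)"
      using integral_unique[OF cos_cos_integral[of _ m]]
      by (auto simp: g_def mult.assoc simp del: of_nat_Suc)
    also have "integral {0..1/2} (\<lambda>x. \<Sum>j. g j x * cos (2 * pi * real m * x)) =
      integral {0..1/2} (\<lambda>x. G x * cos (2 * pi * real m * x))"
    proof (rule Henstock_Kurzweil_Integration.integral_cong)
      fix x :: real assume "x \<in> {0..1/2}"
      have "summable (\<lambda>n. g n x)" by (intro summable_comparison_test'[OF L]) (auto intro: gb)
      then show "(\<Sum>n. g n x * cos (2 * pi * real m * x)) = G x * cos (2 * pi * real m * x)"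
        by (simp add: G_def suminf_mult2)
    qed
    finally have "(if m = 0 then 0 else c (m - 1) / 4) = integral {0..1/2} (\<lambda>x. G x * cos (2 * pi * real m * x))"
      using sums_unique2 sums_single[of "m - 1" "\<lambda>j. if m = 0 then 0 else c j / 4"] by blast
    then show ?thesis by (cases m) (auto simp: c_def)
  qed
  have "F x - sqrt (pi / s) * (1 + 2 * G x) = 0"
  proof (rule cos_moments_zero[OF _ _ x])
    show "continuous_on {0..1/2} (\<lambda>x. F x - sqrt (pi / s) * (1 + 2 * G x))"
      by (intro continuous_intros contF contG)
    fix m :: nat
    have i: "(\<lambda>x. F x * cos (2 * pi * real m * x)) integrable_on {0..1/2}"
      "(\<lambda>x. cos (2 * pi * real m * x)) integrable_on {0..1/2}"
      "(\<lambda>x. G x * cos (2 * pi * real m * x)) integrable_on {0..1/2}"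
      by (intro integrable_continuous_interval continuous_intros contF contG)+
    have "((\<lambda>x. F x * cos (2 * pi * real m * x) - sqrt (pi / s) * (cos (2 * pi * real m * x) +
        2 * (G x * cos (2 * pi * real m * x)))) has_integral
      integral {0..1/2} (\<lambda>x. F x * cos (2 * pi * real m * x)) - sqrt (pi / s) *
       (integral {0..1/2} (\<lambda>x. cos (2 * pi * real m * x)) +
         2 * integral {0..1/2} (\<lambda>x. G x * cos (2 * pi * real m * x)))) {0..1/2}"
      by (intro has_integral_diff has_integral_mult_right has_integral_add integrable_integral i)
    moreover have "integral {0..1/2} (\<lambda>x. cos (2 * pi * real m * x)) = (if m = 0 then 1/2 else 0)"
      using integral_unique[OF cos_integral_half_period[of "int m"]] by simp
    ultimately have "((\<lambda>x. F x * cos (2 * pi * real m * x) - sqrt (pi / s) * (cos (2 * pi * real m * x) +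
        2 * (G x * cos (2 * pi * real m * x)))) has_integral 0) {0..1/2}"
      unfolding intF intG by (cases "m = 0") auto
    then show "integral {0..1/2} (\<lambda>x. (F x - sqrt (pi / s) * (1 + 2 * G x)) * cos (2 * pi * real m * x)) = 0"
      by (intro integral_unique) (simp add: algebra_simps)
  qed
  then show ?thesis by (simp add: F_def G_def f_def g_def c_def)
qed

text \<open>This is Jacobi's theta_2 divided by \<open>2 q^(1/4)\<close>. With that factor removed
  the constant term is 1, so the series is close to 1 for small \<open>q\<close>, and the removed
  power becomes the factor \<open>exp (pi^2 / (4 t))\<close> of the transformation formula.\<close>

definition theta2_fps :: "complex fps" where
  "theta2_fps = Abs_fps (\<lambda>n. if \<exists>k. n = k * Suc k then 1 else 0)"

lemma fps_conv_radius_theta2_fps: "fps_conv_radius theta2_fps \<ge> 1"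
  by (rule fps_conv_radius_ge_1_bounded[of _ 1]) (auto simp: theta2_fps_def)

lemma theta2_sums:
  assumes "norm z < 1"
  shows "(\<lambda>n. z ^ (n * Suc n)) sums eval_fps theta2_fps z"
proof -
  define f where "f n = fps_nth theta2_fps n * z ^ n" for n
  have "f sums eval_fps theta2_fps z"
    using sums_eval_fps[OF norm_less_conv_radius[OF fps_conv_radius_theta2_fps assms]]
    by (simp add: f_def[abs_def])
  moreover have "strict_mono (\<lambda>k::nat. k * Suc k)"
    by (rule strict_monoI_Suc) simp
  moreover have "f n = 0" if "n \<notin> range (\<lambda>k::nat. k * Suc k)" for n
    using that by (auto simp: f_def theta2_fps_def)
  ultimately have "(\<lambda>k. f (k * Suc k)) sums eval_fps theta2_fps z"
    by (subst sums_mono_reindex) auto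
  moreover have "f (k * Suc k) = z ^ (k * Suc k)" for k
    by (auto simp: f_def theta2_fps_def)
  ultimately show ?thesis by simp
qed

lemma theta_real_limit:
  fixes x :: real assumes x: "0 < x" "x < 1"
  obtains \<theta> where "eval_fps theta_fps (of_real x) = of_real \<theta>"
    "(\<lambda>j. (-1) ^ Suc j * x ^ ((Suc j)\<^sup>2)) sums ((\<theta> - 1) / 2)"
proof
  define \<theta> where "\<theta> = Re (eval_fps theta_fps (of_real x))"
  show 1: "eval_fps theta_fps (of_real x) = of_real \<theta>"
    using tendsto_Im[OF theta_series_limit[OF x]]
    by (simp add: \<theta>_def complex_eq_iff LIMSEQ_const_iff)
  have "(\<lambda>n. 1 + 2 * (\<Sum>s=1..n. (-1) ^ s * x ^ (s\<^sup>2))) \<longlonglongrightarrow> \<theta>"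
    using theta_series_limit[OF x] unfolding 1 by (simp only: tendsto_of_real_iff)
  then have "(\<lambda>n. ((1 + 2 * (\<Sum>s=1..n. (-1) ^ s * x ^ (s\<^sup>2))) - 1) / 2) \<longlonglongrightarrow> (\<theta> - 1) / 2"
    by (intro tendsto_intros) auto
  then show "(\<lambda>j. (-1) ^ Suc j * x ^ ((Suc j)\<^sup>2)) sums ((\<theta> - 1) / 2)"
    by (simp add: sums_def sum.atLeast1_atMost_eq)
qed

text \<open>Poisson summation at \<open>x = 1/2\<close> with \<open>s = pi^2 / t\<close>. The
  Gaussians centred at half-integers give \<open>exp (- s / 4)\<close> times the theta_2 series,
  because \<open>(n + 1/2)^2 = n (n + 1) + 1/4\<close>. The cosines become alternating signs and
  give Gauss's series, the reciprocal of the generating function.\<close>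

lemma overpart_transformation_real:
  fixes t :: real assumes t: "t > 0"
  shows "eval_fps overpart_fps (of_real (exp (- t))) * eval_fps theta2_fps (of_real (exp (- pi\<^sup>2 / t))) =
    of_real (sqrt t / (2 * sqrt pi) * exp (pi\<^sup>2 / (4 * t)))"
proof -
  define s where "s = pi\<^sup>2 / t"
  define x where "x = exp (- t)"
  define y where "y = exp (- s)"
  have s: "s > 0" using t by (simp add: s_def)
  have x: "0 < x" "x < 1" using t by (simp_all add: x_def)
  have y: "0 < y" "y < 1" using s by (simp_all add: y_def)
  obtain \<theta> where \<theta>: "eval_fps theta_fps (of_real x) = of_real \<theta>"
    "(\<lambda>j. (-1) ^ Suc j * x ^ ((Suc j)\<^sup>2)) sums ((\<theta> - 1) / 2)"
    by (rule theta_real_limit[OF x])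
  define b where "b = (\<Sum>n. y ^ (n * Suc n))"
  have sum_y: "summable (\<lambda>n. y ^ (n * Suc n))"
    using sums_summable[OF theta2_sums[of "of_real y"]] y
    by (simp only: of_real_power[symmetric] summable_of_real_iff) auto
  have B: "eval_fps theta2_fps (of_real y) = of_real b"
    using sums_unique[OF theta2_sums[of "of_real y"]] y suminf_of_real[OF sum_y, where 'a=complex]
    by (simp add: b_def)
  have "exp (- s * (real n + 1/2)\<^sup>2) + exp (- s * (real n + 1 - 1/2)\<^sup>2) = 2 * exp (- s / 4) * y ^ (n * Suc n)" for n
  proof -
    have "- s * (real n + 1/2)\<^sup>2 = - s / 4 + real (n * Suc n) * (- s)"
      by (simp add: power2_eq_square algebra_simps)
    then have "exp (- s * (real n + 1/2)\<^sup>2) = exp (- s / 4) * y ^ (n * Suc n)"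
      unfolding y_def exp_of_nat_mult[symmetric] by (simp only: exp_add)
    moreover have "real n + 1 - 1/2 = real n + 1/2" by simp
    ultimately show ?thesis by (simp only: mult_2 distrib_right)
  qed
  then have L: "(\<Sum>n. exp (- s * (real n + 1/2)\<^sup>2) + exp (- s * (real n + 1 - 1/2)\<^sup>2)) = 2 * exp (- s / 4) * b"
    by (simp only: b_def suminf_mult[OF sum_y])
  have "exp (- pi\<^sup>2 * (real (Suc j))\<^sup>2 / s) * cos (2 * pi * real (Suc j) * (1/2)) = (-1) ^ Suc j * x ^ ((Suc j)\<^sup>2)" for j
  proof -
    have "- pi\<^sup>2 * (real (Suc j))\<^sup>2 / s = real ((Suc j)\<^sup>2) * (- t)"
      using t by (simp add: s_def field_simps)
    then have 1: "exp (- pi\<^sup>2 * (real (Suc j))\<^sup>2 / s) = x ^ ((Suc j)\<^sup>2)"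
      unfolding x_def exp_of_nat_mult[symmetric] by simp
    have "2 * pi * real (Suc j) * (1/2) = pi * real (Suc j)" by simp
    then have "cos (2 * pi * real (Suc j) * (1/2)) = (-1) ^ Suc j" by (simp only: cos_npi2)
    then show ?thesis unfolding 1 by (simp only: mult.commute)
  qed
  then have R: "(\<Sum>j. exp (- pi\<^sup>2 * (real (Suc j))\<^sup>2 / s) * cos (2 * pi * real (Suc j) * (1/2))) = (\<theta> - 1) / 2"
    using sums_unique[OF \<theta>(2)] by simp
  have main: "2 * exp (- s / 4) * b = sqrt (pi / s) * \<theta>"
    using theta_poisson_summation[OF s, of "1/2"] unfolding L R by (simp add: diff_divide_distrib)
  have "sqrt (pi / s) = sqrt t / sqrt pi"
    using t by (simp add: s_def power2_eq_square real_sqrt_divide[symmetric])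
  with main have "b = \<theta> * (sqrt t / (2 * sqrt pi) * exp (s / 4))"
    by (simp add: exp_minus field_simps)
  moreover have "eval_fps overpart_fps (of_real x) * of_real \<theta> = 1"
    using overpart_theta_of_real[OF x] \<theta>(1) by simp
  ultimately have "eval_fps overpart_fps (of_real x) * of_real b = of_real (sqrt t / (2 * sqrt pi) * exp (s / 4))"
    by (simp add: mult.assoc[symmetric])
  then show ?thesis by (simp add: B[symmetric] x_def y_def s_def)
qed

lemma norm_exp_less_1:
  assumes "Re t > 0"
  shows "norm (exp (- t)) < 1" "norm (exp (- of_real (pi\<^sup>2) / t)) < 1"
proof -
  show "norm (exp (- t)) < 1" using assms by simp
  have "Re (of_real (pi\<^sup>2) / t) = pi\<^sup>2 * (Re t / (cmod t)\<^sup>2)"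
    by (simp add: Re_divide cmod_power2)
  moreover have "\<dots> > 0" using assms by (intro mult_pos_pos divide_pos_pos) auto
  ultimately show "norm (exp (- of_real (pi\<^sup>2) / t)) < 1" by simp
qed

text \<open>Analytic continuation from the positive reals. The product form keeps both sides
  holomorphic on the whole half-plane, with no division by a theta series.\<close>

lemma overpart_transformation:
  fixes t :: complex assumes t: "Re t > 0"
  shows "eval_fps overpart_fps (exp (- t)) * eval_fps theta2_fps (exp (- of_real (pi\<^sup>2) / t)) =
    csqrt t / (2 * of_real (sqrt pi)) * exp (of_real (pi\<^sup>2) / (4 * t))"
proof -
  define H where "H t = eval_fps overpart_fps (exp (- t)) * eval_fps theta2_fps (exp (- of_real (pi\<^sup>2) / t)) -
    csqrt t / (2 * of_real (sqrt pi)) * exp (of_real (pi\<^sup>2) / (4 * t))" for t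
  let ?S = "{t. Re t > 0}"
  have "H t = 0"
  proof (rule analytic_continuation[of H ?S "of_real ` {0<..}" 1])
    have hol1: "eval_fps overpart_fps holomorphic_on ball 0 1"
      by (rule holomorphic_on_eval_fps) (use norm_less_conv_radius[OF fps_conv_radius_overpart_fps] in auto)
    have hol2: "eval_fps theta2_fps holomorphic_on ball 0 1"
      by (rule holomorphic_on_eval_fps) (use norm_less_conv_radius[OF fps_conv_radius_theta2_fps] in auto)
    have h1: "(\<lambda>t. eval_fps overpart_fps (exp (- t))) holomorphic_on ?S"
      by (rule holomorphic_on_compose_gen[OF _ hol1, of "\<lambda>t. exp (- t)", unfolded o_def])
         (auto intro!: holomorphic_intros)
    have h2: "(\<lambda>t. eval_fps theta2_fps (exp (- of_real (pi\<^sup>2) / t))) holomorphic_on ?S"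
      by (rule holomorphic_on_compose_gen[OF _ hol2, of "\<lambda>t. exp (- of_real (pi\<^sup>2) / t)", unfolded o_def])
         (use norm_exp_less_1(2) in \<open>auto intro!: holomorphic_intros simp del: norm_exp_eq_Re\<close>)
    have h3: "csqrt holomorphic_on ?S"
      by (rule holomorphic_on_subset[OF holomorphic_on_csqrt]) (auto simp: complex_nonpos_Reals_iff)
    show "H holomorphic_on ?S"
      unfolding H_def by (intro holomorphic_intros h1 h2 h3) auto
    show "open ?S" by (rule open_halfspace_Re_gt)
    show "connected ?S" by (intro convex_connected convex_halfspace_Re_gt)
    show "of_real ` {0<..} \<subseteq> ?S" by auto
    show "(1::complex) islimpt of_real ` {0<..}"
      unfolding islimpt_approachable
    proof safe
      fix e :: real assume "e > 0"
      then show "\<exists>x'\<in>complex_of_real ` {0<..}. x' \<noteq> 1 \<and> dist x' 1 < e"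
        using dist_of_real[of "1 + e / 2" 1, where 'a=complex]
        by (intro bexI[of _ "of_real (1 + e / 2)"] imageI) (auto simp: dist_real_def)
    qed
    show "H z = 0" if z: "z \<in> of_real ` {0<..}" for z
    proof -
      obtain r where r: "z = of_real r" "r > 0" using z by (elim imageE) simp
      have 1: "csqrt z = of_real (sqrt r)" unfolding r(1) by (rule of_real_sqrt[symmetric]) (use r in simp)
      have 2: "exp (- z) = of_real (exp (- r))" "exp (- of_real (pi\<^sup>2) / z) = of_real (exp (- pi\<^sup>2 / r))"
        "exp (of_real (pi\<^sup>2) / (4 * z)) = of_real (exp (pi\<^sup>2 / (4 * r)))"
        unfolding exp_of_real[symmetric] by (simp_all add: r)
      show ?thesis
        using overpart_transformation_real[OF r(2)] unfolding H_def 1 2 by simp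
    qed
  qed (use t in auto)
  then show ?thesis by (simp add: H_def)
qed

lemma theta2_bound:
  assumes y: "norm y \<le> 1 / 2"
  shows "norm (eval_fps theta2_fps y - 1) \<le> 2 * norm y ^ 2"
proof -
  have y1: "norm y < 1" using y by simp
  have s: "(\<lambda>n. y ^ (Suc n * Suc (Suc n))) sums (eval_fps theta2_fps y - 1)"
    using theta2_sums[OF y1] unfolding sums_Suc_iff[of "\<lambda>n. y ^ (n * Suc n)"] by simp
  have b: "norm (y ^ (Suc n * Suc (Suc n))) \<le> norm y ^ 2 * norm y ^ n" for n
  proof -
    have "norm y ^ (Suc n * Suc (Suc n)) \<le> norm y ^ (2 + n)"
      using y by (intro power_decreasing) auto
    then show ?thesis by (simp only: norm_power power_add)
  qed
  have g: "(\<lambda>n. norm y ^ 2 * norm y ^ n) sums (norm y ^ 2 * (1 / (1 - norm y)))"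
    by (intro sums_mult geometric_sums) (use y1 in auto)
  have "norm (eval_fps theta2_fps y - 1) \<le> norm y ^ 2 * (1 / (1 - norm y))"
    using norm_sums_le[OF s g b] .
  also have "\<dots> \<le> norm y ^ 2 * 2"
    using y by (intro mult_left_mono) (auto simp: field_simps)
  finally show ?thesis by simp
qed

text \<open>At a real point the theta_2 series has nonnegative terms and first term 1, so omitting
  it from the transformation formula leaves an upper bound without an error term.\<close>

lemma overpart_real_bound:
  fixes \<sigma> :: real assumes "\<sigma> > 0"
  shows "norm (eval_fps overpart_fps (of_real (exp (- \<sigma>)))) \<le> sqrt \<sigma> / (2 * sqrt pi) * exp (pi\<^sup>2 / (4 * \<sigma>))"
proof -
  define y where "y = exp (- pi\<^sup>2 / \<sigma>)"
  have y: "0 < y" "y < 1" using assms by (simp_all add: y_def)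
  have s: "(\<lambda>n. of_real y ^ (n * Suc n)) sums eval_fps theta2_fps (of_real y)"
    by (rule theta2_sums) (use y in auto)
  have sR: "(\<lambda>n. y ^ (n * Suc n)) sums Re (eval_fps theta2_fps (of_real y))"
    using sums_Re[OF s] by (simp flip: of_real_power del: mult_Suc_right)
  have "1 \<le> Re (eval_fps theta2_fps (of_real y))"
    using sum_le_suminf[OF sums_summable[OF sR], of "{0}"] sums_unique[OF sR] y by simp
  also have "\<dots> \<le> norm (eval_fps theta2_fps (of_real y))" by (rule complex_Re_le_cmod)
  finally have B: "1 \<le> norm (eval_fps theta2_fps (of_real y))" .
  have "norm (eval_fps overpart_fps (of_real (exp (- \<sigma>)))) * 1 \<le>
      norm (eval_fps overpart_fps (of_real (exp (- \<sigma>)))) * norm (eval_fps theta2_fps (of_real y))"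
    using B by (intro mult_left_mono) auto
  also have "\<dots> = sqrt \<sigma> / (2 * sqrt pi) * exp (pi\<^sup>2 / (4 * \<sigma>))"
    using arg_cong[OF overpart_transformation_real[OF assms], of norm] assms
    by (simp only: norm_mult norm_of_real y_def) simp
  finally show ?thesis by simp
qed

section \<open>Bounds away from the real axis\<close>

text \<open>\<open>ln ((1 + w) / (1 - w))\<close> is twice the sum of \<open>w^n / n\<close> over
  odd \<open>n\<close>. In every term but the first, \<open>Re (w^n)\<close> is replaced by
  \<open>norm w ^ n\<close>. The linear term is kept exactly, and it supplies the exponential
  saving.\<close>

lemma norm_factor_bound:
  assumes w: "norm w < 1"
  shows "norm ((1 + w) / (1 - w)) \<le> norm ((1 + complex_of_real (norm w)) / (1 - of_real (norm w))) * exp (- 2 * (norm w - Re w))"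
proof -
  define D where "D w = ln (1 + w) - ln (1 - w)" for w :: complex
  define \<rho> where "\<rho> = norm w"
  have \<rho>: "0 \<le> \<rho>" "\<rho> < 1" using w by (simp_all add: \<rho>_def)
  have D: "(\<lambda>n. (z ^ n - (- z) ^ n) / of_nat n) sums D z" if "norm z < 1" for z
    using sums_diff[OF Ln_series'[of z] Ln_series'[of "- z"]] that
    by (simp add: D_def diff_divide_distrib)
  have nz: "1 + z \<noteq> 0" "1 - z \<noteq> 0" if "norm z < 1" for z :: complex
    using one_minus_power_nonzero[OF that, of 1] by simp_all
  have eD: "norm ((1 + z) / (1 - z)) = exp (Re (D z))" if "norm z < 1" for z
  proof -
    have "exp (D z) = (1 + z) / (1 - z)" using nz[OF that] by (simp add: D_def exp_diff)
    then show ?thesis by (metis norm_exp_eq_Re)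
  qed
  have E: "(\<lambda>n. Re ((z ^ n - (- z) ^ n) / of_nat n - (if n = 1 then 2 * z else 0))) sums Re (D z - 2 * z)"
    if "norm z < 1" for z
    using sums_Re[OF sums_diff[OF D[OF that] sums_single[of 1 "\<lambda>_. 2 * z"]]] by simp
  have "Re (D w - 2 * w) \<le> Re (D (of_real \<rho>) - 2 * of_real \<rho>)"
  proof (rule sums_le[OF _ E E])
    fix n
    show "Re ((w ^ n - (- w) ^ n) / of_nat n - (if n = 1 then 2 * w else 0)) \<le>
      Re ((of_real \<rho> ^ n - (- of_real \<rho>) ^ n) / of_nat n - (if n = 1 then 2 * of_real \<rho> else 0))"
    proof (cases "n = 1")
      case False
      have *: "Re (w ^ n) \<le> \<rho> ^ n" using complex_Re_le_cmod[of "w ^ n"] by (simp add: \<rho>_def norm_power)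
      show ?thesis
      proof (cases "even n")
        case False
        then show ?thesis using * \<open>n \<noteq> 1\<close> by (simp add: divide_right_mono flip: of_real_power)
      qed (use \<open>n \<noteq> 1\<close> in simp)
    qed simp
  qed (use w \<rho> in auto)
  then have "exp (Re (D w)) \<le> exp (Re (D (of_real \<rho>)) + - 2 * (\<rho> - Re w))" by simp
  also have "\<dots> = norm ((1 + complex_of_real \<rho>) / (1 - of_real \<rho>)) * exp (- 2 * (\<rho> - Re w))"
    using eD[of "of_real \<rho>"] \<rho> by (simp add: exp_add)
  finally show ?thesis using eD[OF w] by (simp add: \<rho>_def)
qed

text \<open>Apply the factor bound at \<open>w = z^i\<close> for all \<open>i\<close>: the savings
  add up to a difference of two geometric series, which have closed forms.\<close>

lemma overpart_off_axis_bound: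
  assumes z: "norm z < 1"
  shows "norm (eval_fps overpart_fps z) \<le> norm (eval_fps overpart_fps (of_real (norm z))) *
     exp (- 2 * (norm z / (1 - norm z) - Re (z / (1 - z))))"
proof (rule tendsto_le[OF sequentially_bot])
  let ?r = "norm z"
  show "(\<lambda>k. norm (\<Prod>i=1..k. (1 + z ^ i) / (1 - z ^ i))) \<longlonglongrightarrow> norm (eval_fps overpart_fps z)"
    by (intro tendsto_norm overpart_fps_limit z)
  have geo: "(\<lambda>k. \<Sum>i=1..k. a ^ i) \<longlonglongrightarrow> a / (1 - a)" if "norm a < 1" for a :: complex
    using sums_mult[OF geometric_sums[OF that], of a]
    by (simp add: sums_def sum.atLeast1_atMost_eq)
  have "(\<lambda>k. Re (\<Sum>i=1..k. of_real ?r ^ i) - Re (\<Sum>i=1..k. z ^ i)) \<longlonglongrightarrow> Re (of_real ?r / (1 - of_real ?r)) - Re (z / (1 - z))"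
    by (intro tendsto_intros geo) (use z in auto)
  then have lim: "(\<lambda>k. (\<Sum>i=1..k. ?r ^ i - Re (z ^ i))) \<longlonglongrightarrow> ?r / (1 - ?r) - Re (z / (1 - z))"
  proof -
    have "Re (of_real ?r / (1 - of_real ?r)) = ?r / (1 - ?r)"
      by (metis Re_complex_of_real of_real_1 of_real_diff of_real_divide)
    then show ?thesis using \<open>_ \<longlonglongrightarrow> Re (of_real ?r / (1 - of_real ?r)) - Re (z / (1 - z))\<close>
      by (simp add: sum_subtractf Re_power_real)
  qed
  show "(\<lambda>k. norm (\<Prod>i=1..k. (1 + complex_of_real ?r ^ i) / (1 - of_real ?r ^ i)) * exp (- 2 * (\<Sum>i=1..k. ?r ^ i - Re (z ^ i))))
     \<longlonglongrightarrow> norm (eval_fps overpart_fps (of_real ?r)) * exp (- 2 * (?r / (1 - ?r) - Re (z / (1 - z))))"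
    by (intro tendsto_intros overpart_fps_limit lim) (use z in auto)
  show "\<forall>\<^sub>F k in sequentially. norm (\<Prod>i=1..k. (1 + z ^ i) / (1 - z ^ i)) \<le>
      norm (\<Prod>i=1..k. (1 + complex_of_real ?r ^ i) / (1 - of_real ?r ^ i)) * exp (- 2 * (\<Sum>i=1..k. ?r ^ i - Re (z ^ i)))"
  proof (intro always_eventually allI)
    fix k
    have "norm (\<Prod>i=1..k. (1 + z ^ i) / (1 - z ^ i)) = (\<Prod>i=1..k. norm ((1 + z ^ i) / (1 - z ^ i)))"
      by (simp add: prod_norm)
    also have "\<dots> \<le> (\<Prod>i=1..k. norm ((1 + complex_of_real ?r ^ i) / (1 - of_real ?r ^ i)) * exp (- 2 * (?r ^ i - Re (z ^ i))))"
    proof (intro prod_mono conjI)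
      fix i assume "i \<in> {1..k}"
      then have "norm (z ^ i) < 1" using z by (simp add: norm_power power_less_one_iff)
      from norm_factor_bound[OF this]
      show "norm ((1 + z ^ i) / (1 - z ^ i)) \<le> norm ((1 + complex_of_real ?r ^ i) / (1 - of_real ?r ^ i)) * exp (- 2 * (?r ^ i - Re (z ^ i)))"
        by (simp add: norm_power)
    qed auto
    also have "\<dots> = norm (\<Prod>i=1..k. (1 + complex_of_real ?r ^ i) / (1 - of_real ?r ^ i)) * exp (- 2 * (\<Sum>i=1..k. ?r ^ i - Re (z ^ i)))"
      by (simp only: prod.distrib prod_norm sum_distrib_left exp_sum finite_atLeastAtMost)
    finally show "norm (\<Prod>i=1..k. (1 + z ^ i) / (1 - z ^ i)) \<le> \<dots>" .
  qed
qed

section \<open>The main term\<close>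

text \<open>Beyond \<open>b\<close> the factor \<open>u / b\<close> is at least 1, and inserting it
  turns the integrand into an exact derivative.\<close>

lemma gaussian_tail:
  fixes \<mu> b :: real assumes \<mu>: "\<mu> > 0" and b: "b > 0"
  shows "\<bar>sqrt (2 * pi / \<mu>) / 2 - integral {0..b} (\<lambda>u. exp (- (\<mu> / 2) * u\<^sup>2))\<bar> \<le> exp (- (\<mu> / 2) * b\<^sup>2) / (\<mu> * b)"
proof -
  define f where "f u = exp (- (\<mu> / 2) * u\<^sup>2)" for u :: real
  have int: "f integrable_on {x..y}" for x y
    unfolding f_def by (intro integrable_continuous_interval continuous_intros)
  have lim: "(\<lambda>N. integral {0..real N} f) \<longlonglongrightarrow> sqrt (2 * pi / \<mu>) / 2"
    using gaussian_cos_integral_half[of "\<mu> / 2" 0] \<mu> by (simp add: f_def[abs_def] mult.commute)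
  have "norm (sqrt (2 * pi / \<mu>) / 2 - integral {0..b} f) \<le> f b / (\<mu> * b)"
  proof (rule Lim_norm_ubound)
    show "(\<lambda>N. integral {0..real N} f - integral {0..b} f) \<longlonglongrightarrow> sqrt (2 * pi / \<mu>) / 2 - integral {0..b} f"
      by (intro tendsto_diff lim tendsto_const)
    show "\<forall>\<^sub>F N in sequentially. norm (integral {0..real N} f - integral {0..b} f) \<le> f b / (\<mu> * b)"
      using eventually_ge_at_top[of "nat \<lceil>b\<rceil>"]
    proof eventually_elim
      case (elim N)
      then have N: "b \<le> real N" by linarith
      have 1: "integral {0..b} f + integral {b..real N} f = integral {0..real N} f"
        by (rule Henstock_Kurzweil_Integration.integral_combine) (use b N int in auto)
      have 2: "((\<lambda>u. u / b * f u) has_integral (- f (real N) / (\<mu> * b)) - (- f b / (\<mu> * b))) {b..real N}"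
      proof (rule fundamental_theorem_of_calculus[OF N])
        fix x :: real
        have "((\<lambda>u. - f u / (\<mu> * b)) has_real_derivative x / b * f x) (at x within {b..real N})"
          unfolding f_def using \<mu> b by (auto intro!: derivative_eq_intros)
        then show "((\<lambda>u. - f u / (\<mu> * b)) has_vector_derivative x / b * f x) (at x within {b..real N})"
          by (simp add: has_real_derivative_iff_has_vector_derivative)
      qed
      have "integral {b..real N} f \<le> (- f (real N) / (\<mu> * b)) - (- f b / (\<mu> * b))"
      proof (rule has_integral_le[OF integrable_integral[OF int] 2])
        fix x assume "x \<in> {b..real N}"
        then have "1 \<le> x / b" using b by simp
        then show "f x \<le> x / b * f x" using mult_right_mono[of 1 "x / b" "f x"] by (simp add: f_def)
      qed
      also have "\<dots> \<le> f b / (\<mu> * b)" using \<mu> b by (simp add: f_def)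
      finally have 3: "integral {b..real N} f \<le> f b / (\<mu> * b)" .
      have "0 \<le> integral {b..real N} f"
        by (rule Henstock_Kurzweil_Integration.integral_nonneg[OF int]) (simp add: f_def)
      then show ?case using 1 3 by simp
    qed
  qed simp
  then show ?thesis by (simp add: f_def[abs_def])
qed

text \<open>An entire primitive turns each path integral of the Gaussian into a difference of
  endpoint values, so contours may be moved freely.\<close>

locale gaussian_primitive =
  fixes \<mu> :: real and \<Phi> :: "complex \<Rightarrow> complex"
  assumes \<mu>: "\<mu> \<ge> 1"
    and deriv: "\<And>z. (\<Phi> has_field_derivative exp (of_real (\<mu> / 2) * z\<^sup>2)) (at z)"
begin

lemma segment_bound:
  assumes "\<And>z. z \<in> closed_segment x y \<Longrightarrow> Re (z\<^sup>2) \<le> c"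
  shows "norm (\<Phi> x - \<Phi> y) \<le> exp (\<mu> / 2 * c) * norm (x - y)"
proof (rule field_differentiable_bound[of "closed_segment x y"])
  show "(\<Phi> has_field_derivative exp (of_real (\<mu> / 2) * z\<^sup>2)) (at z within closed_segment x y)" for z
    using deriv by (rule has_field_derivative_at_within)
  show "norm (exp (of_real (\<mu> / 2) * z\<^sup>2)) \<le> exp (\<mu> / 2 * c)" if "z \<in> closed_segment x y" for z
    using mult_left_mono[OF assms[OF that], of "\<mu> / 2"] \<mu> by simp
qed auto

lemma imaginary_axis:
  assumes b: "b > 0"
  shows "\<Phi> (\<i> * of_real b) - \<Phi> (- \<i> * of_real b) =
    2 * \<i> * of_real (integral {0..b} (\<lambda>u. exp (- (\<mu> / 2) * u\<^sup>2)))"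
proof -
  define f where "f u = exp (- (\<mu> / 2) * u\<^sup>2)" for u :: real
  have sq: "exp (of_real (\<mu> / 2) * (s * \<i> * of_real y)\<^sup>2) = of_real (f y)" if "s = 1 \<or> s = -1" for s :: complex and y :: real
    using that unfolding f_def exp_of_real[symmetric] by (auto simp: power_mult_distrib)
  have "((\<lambda>y. s * \<i> * of_real (f y)) has_integral \<Phi> (s * \<i> * of_real b) - \<Phi> (s * \<i> * of_real 0)) {0..b}"
    if s: "s = 1 \<or> s = -1" for s :: complex
  proof (rule fundamental_theorem_of_calculus)
    fix y :: real
    have "((\<lambda>z. \<Phi> (s * \<i> * z)) has_field_derivative exp (of_real (\<mu> / 2) * (s * \<i> * of_real y)\<^sup>2) * (s * \<i>)) (at (of_real y))"
      by (rule DERIV_chain'[OF _ deriv]) (auto intro!: derivative_eq_intros)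
    from has_vector_derivative_real_field[OF this]
    show "((\<lambda>y. \<Phi> (s * \<i> * of_real y)) has_vector_derivative s * \<i> * of_real (f y)) (at y within {0..b})"
      unfolding sq[OF s] by (simp only: mult.commute)
  qed (use b in auto)
  from this[of 1] this[of "-1"]
  have 1: "((\<lambda>y. \<i> * of_real (f y)) has_integral \<Phi> (\<i> * of_real b) - \<Phi> 0) {0..b}"
    and 2: "((\<lambda>y. - (\<i> * of_real (f y))) has_integral \<Phi> (- \<i> * of_real b) - \<Phi> 0) {0..b}" by auto
  have 3: "((\<lambda>y. \<i> * of_real (f y)) has_integral \<i> * of_real (integral {0..b} f)) {0..b}"
    by (intro has_integral_mult_right has_integral_of_real integrable_integral integrable_continuous_interval)
       (auto simp: f_def intro!: continuous_intros)
  have "\<Phi> (\<i> * of_real b) - \<Phi> 0 = \<i> * of_real (integral {0..b} f)"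
    using has_integral_unique[OF 1 3] .
  moreover have "\<Phi> (- \<i> * of_real b) - \<Phi> 0 = - (\<i> * of_real (integral {0..b} f))"
    using has_integral_unique[OF 2 has_integral_neg[OF 3]] .
  ultimately show ?thesis unfolding f_def[abs_def, symmetric] by (simp add: algebra_simps)
qed

text \<open>Go from \<open>cnj w\<close> horizontally to the imaginary axis, up along the axis, and
  back horizontally to \<open>w\<close>. On the horizontal pieces
  \<open>Re (z^2) \<le> - 4/5\<close>, and on the axis the integrand is a real Gaussian with a small
  tail. The constant is \<open>2 + 2 + 2 * 5/4\<close>. The value \<open>- 4/5\<close> is the one
  that occurs at the ends of the major arc.\<close>

lemma vertical_estimate:
  assumes w: "Im w \<ge> 4/5" "norm w \<le> 2" "Re (w\<^sup>2) = - 4/5"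
  shows "norm (\<Phi> w - \<Phi> (cnj w) - \<i> * of_real (sqrt (2 * pi / \<mu>))) \<le> 13/2 * exp (- (2/5) * \<mu>)"
proof -
  define p q where "p = Re w" and "q = Im w"
  have q: "q \<ge> 4/5" using w by (simp add: q_def)
  have pq: "p\<^sup>2 - q\<^sup>2 = -4/5" using w by (simp add: p_def q_def Re_power2)
  have pn: "\<bar>p\<bar> \<le> 2" using abs_Re_le_cmod[of w] w by (simp add: p_def)
  have w_eq: "w = of_real p + \<i> * of_real q" "cnj w = of_real p + - \<i> * of_real q"
    by (simp_all add: complex_eq_iff p_def q_def)
  have seg: "norm (\<Phi> (of_real p + \<i> * of_real q') - \<Phi> (\<i> * of_real q')) \<le> 2 * exp (- (2/5) * \<mu>)" if q': "\<bar>q'\<bar> = q" for q'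
  proof -
    have "norm (\<Phi> (of_real p + \<i> * of_real q') - \<Phi> (\<i> * of_real q')) \<le> exp (\<mu> / 2 * (-4/5)) * norm (of_real p + \<i> * of_real q' - \<i> * of_real q')"
    proof (rule segment_bound)
      fix z assume "z \<in> closed_segment (of_real p + \<i> * of_real q') (\<i> * of_real q')"
      then have "Im z = q'" "Re z \<in> closed_segment p 0"
        by (auto simp: closed_segment_same_Im)
      then have "\<bar>Re z\<bar> \<le> \<bar>p\<bar>" by (auto simp: closed_segment_eq_real_ivl split: if_splits)
      then have "(Re z)\<^sup>2 \<le> p\<^sup>2" by (simp add: abs_le_square_iff)
      moreover have "(Im z)\<^sup>2 = q\<^sup>2" using \<open>Im z = q'\<close> q' by (metis power2_abs)
      ultimately show "Re (z\<^sup>2) \<le> -4/5" using pq by (simp add: Re_power2)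
    qed
    also have "\<dots> = exp (- (2/5) * \<mu>) * \<bar>p\<bar>" by (simp add: mult.commute)
    also have "\<dots> \<le> exp (- (2/5) * \<mu>) * 2" using pn by (intro mult_left_mono) auto
    finally show ?thesis by (simp add: mult.commute)
  qed
  define J where "J = integral {0..q} (\<lambda>u. exp (- (\<mu> / 2) * u\<^sup>2))"
  have "\<bar>sqrt (2 * pi / \<mu>) / 2 - J\<bar> \<le> exp (- (\<mu> / 2) * q\<^sup>2) / (\<mu> * q)"
    unfolding J_def by (rule gaussian_tail) (use \<mu> q in auto)
  also have "\<dots> \<le> exp (- (2/5) * \<mu>) / (4/5)"
  proof (rule frac_le)
    have "q\<^sup>2 \<ge> 4/5" using pq zero_le_power2[of p] by linarith
    then show "exp (- (\<mu> / 2) * q\<^sup>2) \<le> exp (- (2/5) * \<mu>)"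
      using \<mu> mult_left_mono[of "4/5" "q\<^sup>2" "\<mu> / 2"] by simp
    show "4/5 \<le> \<mu> * q" using \<mu> q mult_mono[of 1 \<mu> "4/5" q] by simp
  qed auto
  finally have J: "\<bar>sqrt (2 * pi / \<mu>) / 2 - J\<bar> \<le> 5/4 * exp (- (2/5) * \<mu>)" by simp
  have "\<Phi> w - \<Phi> (cnj w) - \<i> * of_real (sqrt (2 * pi / \<mu>)) =
     (\<Phi> (of_real p + \<i> * of_real q) - \<Phi> (\<i> * of_real q)) -
     (\<Phi> (of_real p + \<i> * of_real (- q)) - \<Phi> (\<i> * of_real (- q))) -
     2 * \<i> * of_real (sqrt (2 * pi / \<mu>) / 2 - J)"
    using imaginary_axis[of q] q unfolding J_def[symmetric] w_eq by (simp add: algebra_simps)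
  also have "norm \<dots> \<le> 2 * exp (- (2/5) * \<mu>) + 2 * exp (- (2/5) * \<mu>) + 2 * (5/4 * exp (- (2/5) * \<mu>))"
    by (intro order.trans[OF norm_triangle_ineq4] add_mono seg)
       (use q J in \<open>auto simp: norm_mult simp flip: of_real_diff\<close>)
  finally show ?thesis by simp
qed

end

lemma gaussian_primitive_exists:
  assumes "\<mu> \<ge> 1" obtains \<Phi> where "gaussian_primitive \<mu> \<Phi>"
proof -
  obtain \<Phi> :: "complex \<Rightarrow> complex"
    where "\<And>z. z \<in> UNIV \<Longrightarrow> (\<Phi> has_field_derivative exp (of_real (\<mu> / 2) * z\<^sup>2)) (at z within UNIV)"
  proof (rule holomorphic_convex_primitive'[of UNIV "\<lambda>z. exp (of_real (\<mu> / 2) * z\<^sup>2)"])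
    show "(\<lambda>z. exp (of_real (\<mu> / 2) * z\<^sup>2)) holomorphic_on UNIV" by (intro holomorphic_intros)
  qed auto
  then show thesis using assms by (intro that[of \<Phi>]) (simp add: gaussian_primitive_def)
qed

text \<open>With \<open>z = t / \<sigma>\<close>, \<open>w = sqrt z - 1 / sqrt z\<close> and \<open>v = sqrt z + 1 / sqrt z\<close> the form
  \<open>sqrt z * exp (\<mu> / 2 * (z + 1 / z)) dz\<close> splits into \<open>exp \<mu> * (w^2 + 1) * exp (\<mu> / 2 * w^2) dw\<close>, which
  gives the main term, and the negligible \<open>exp (- \<mu>) * (v^2 - 1) * exp (\<mu> / 2 * v^2) dv\<close>.\<close>

lemma (in gaussian_primitive) bessel_integral:
  fixes \<sigma> :: real
  assumes \<sigma>: "\<sigma> > 0"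
  defines "p \<equiv> linepath (Complex \<sigma> (- 2 * \<sigma>)) (Complex \<sigma> (2 * \<sigma>))"
  shows "norm (contour_integral p (\<lambda>t. csqrt t * exp (of_real (\<mu> / 2) * (t / of_real \<sigma> + of_real \<sigma> / t)))
      - \<i> * of_real (\<sigma> * sqrt \<sigma> * exp \<mu> * (1 - 1 / \<mu>) * sqrt (2 * pi / \<mu>)))
    \<le> \<sigma> * sqrt \<sigma> * (30 * exp (3/5 * \<mu>))"
proof -
  define m where "m = complex_of_real \<mu>"
  define S where "S = {t. Re t > 0}"
  have m: "m \<noteq> 0" using \<mu> by (auto simp: m_def)
  define e where "e z = exp (m / 2 * z\<^sup>2)" for z
  have \<Phi>: "(\<Phi> has_field_derivative e z) (at z)" for z
    using deriv[of z] by (simp add: e_def m_def)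
  \<comment> \<open>Integration by parts of \<open>z * (z * e z)\<close> expresses the primitives of
    \<open>(1 + z^2) * e z\<close> and \<open>(z^2 - 1) * e z\<close> through \<open>\<Phi>\<close>;
    this produces the factors \<open>1 - 1 / m\<close> and \<open>1 + 1 / m\<close>.\<close>
  define G where "G z = (1 - 1 / m) * \<Phi> z + z * e z / m" for z
  define H where "H z = - (1 + 1 / m) * \<Phi> z + z * e z / m" for z
  have de: "(e has_field_derivative m * z * e z) (at z)" for z
    unfolding e_def by (auto intro!: derivative_eq_intros)
  have G': "(G has_field_derivative (1 + z\<^sup>2) * e z) (at z)" for z
    unfolding G_def using m by (auto intro!: derivative_eq_intros \<Phi> de simp: field_simps power2_eq_square)
  have H': "(H has_field_derivative (z\<^sup>2 - 1) * e z) (at z)" for z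
    unfolding H_def using m by (auto intro!: derivative_eq_intros \<Phi> de simp: field_simps power2_eq_square)
  define a where "a t = csqrt t / of_real (sqrt \<sigma>)" for t
  have a0: "a t \<noteq> 0" and a2: "(a t)\<^sup>2 = t / of_real \<sigma>" and tn: "t \<noteq> 0" if "t \<in> S" for t
    using that \<sigma> by (auto simp: a_def S_def power_divide simp flip: of_real_power)
  have a': "(a has_field_derivative 1 / (2 * of_real \<sigma> * a t)) (at t)" if "t \<in> S" for t
  proof -
    have "t \<notin> \<real>\<^sub>\<le>\<^sub>0" using that by (auto simp: S_def complex_nonpos_Reals_iff)
    then have "(a has_field_derivative inverse (2 * csqrt t) / of_real (sqrt \<sigma>)) (at t)"
      unfolding a_def by (intro DERIV_cdivide has_field_derivative_csqrt)
    also have "inverse (2 * csqrt t) / of_real (sqrt \<sigma>) = 1 / (2 * of_real \<sigma> * a t)"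
    proof -
      have "complex_of_real \<sigma> = of_real (sqrt \<sigma>) * of_real (sqrt \<sigma>)"
        using \<sigma> by (simp flip: of_real_mult)
      then show ?thesis using \<sigma> by (simp add: a_def field_simps)
    qed
    finally show ?thesis .
  qed
  define w where "w t = a t - 1 / a t" for t
  define v where "v t = a t + 1 / a t" for t
  have w': "(w has_field_derivative 1 / (2 * of_real \<sigma> * a t) * (1 + 1 / (a t)\<^sup>2)) (at t)"
   and v': "(v has_field_derivative 1 / (2 * of_real \<sigma> * a t) * (1 - 1 / (a t)\<^sup>2)) (at t)" if "t \<in> S" for t
    unfolding w_def v_def using a0[OF that] \<sigma>
    by (auto intro!: derivative_eq_intros a'[OF that] simp: field_simps power2_eq_square)
  define X where "X t = exp (m / 2 * (t / of_real \<sigma> + of_real \<sigma> / t))" for t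
  define \<Psi> where "\<Psi> t = exp m * G (w t) + exp (- m) * H (v t)" for t
  have Xw: "exp m * e (w t) = X t" and Xv: "exp (- m) * e (v t) = X t" if "t \<in> S" for t
  proof -
    have "(w t)\<^sup>2 = t / of_real \<sigma> + of_real \<sigma> / t - 2"
      using a0[OF that] unfolding w_def power2_diff a2[OF that] power_one_over[symmetric]
      by (simp add: power_one_over a2[OF that])
    then have "m + m / 2 * (w t)\<^sup>2 = m / 2 * (t / of_real \<sigma> + of_real \<sigma> / t)"
      by (simp only: right_diff_distrib) simp
    then show "exp m * e (w t) = X t" unfolding e_def X_def exp_add[symmetric] by (simp only:)
    have "(v t)\<^sup>2 = t / of_real \<sigma> + of_real \<sigma> / t + 2"
      using a0[OF that] unfolding v_def power2_sum a2[OF that] power_one_over[symmetric]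
      by (simp add: power_one_over a2[OF that])
    then have "- m + m / 2 * (v t)\<^sup>2 = m / 2 * (t / of_real \<sigma> + of_real \<sigma> / t)"
      by (simp only: distrib_left) simp
    then show "exp (- m) * e (v t) = X t" unfolding e_def X_def exp_add[symmetric] by (simp only:)
  qed
  have \<Psi>': "(\<Psi> has_field_derivative csqrt t * X t / of_real (\<sigma> * sqrt \<sigma>)) (at t)" if t: "t \<in> S" for t
  proof -
    let ?d = "1 / (2 * of_real \<sigma> * a t)"
    have "(\<Psi> has_field_derivative exp m * ((1 + (w t)\<^sup>2) * e (w t) * (?d * (1 + 1 / (a t)\<^sup>2))) +
       exp (- m) * (((v t)\<^sup>2 - 1) * e (v t) * (?d * (1 - 1 / (a t)\<^sup>2)))) (at t)"
      unfolding \<Psi>_def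
      by (intro DERIV_add DERIV_cmult DERIV_chain2[OF G'] DERIV_chain2[OF H'] w' v' t)
    also have "exp m * ((1 + (w t)\<^sup>2) * e (w t) * (?d * (1 + 1 / (a t)\<^sup>2))) +
       exp (- m) * (((v t)\<^sup>2 - 1) * e (v t) * (?d * (1 - 1 / (a t)\<^sup>2))) =
       (exp m * e (w t)) * (1 + (w t)\<^sup>2) * (?d * (1 + 1 / (a t)\<^sup>2)) +
       (exp (- m) * e (v t)) * ((v t)\<^sup>2 - 1) * (?d * (1 - 1 / (a t)\<^sup>2))"
      by (simp only: mult_ac)
    also have "\<dots> = X t * ?d * ((1 + (w t)\<^sup>2) * (1 + 1 / (a t)\<^sup>2) + ((v t)\<^sup>2 - 1) * (1 - 1 / (a t)\<^sup>2))"
    proof -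
      have "x * (1 + p) * (d * q) + x * (r - 1) * (d * s) = x * d * ((1 + p) * q + (r - 1) * s)"
        for x p d q r s :: complex by (simp add: algebra_simps)
      then show ?thesis unfolding Xw[OF t] Xv[OF t] .
    qed
    \<comment> \<open>With \<open>a\<close> for \<open>a t\<close>, the two products are
      \<open>a^2 + 1 / a^4\<close> and \<open>a^2 - 1 / a^4\<close>; the form in \<open>v\<close> is
      there to cancel the unwanted power.\<close>
    also have "(1 + (w t)\<^sup>2) * (1 + 1 / (a t)\<^sup>2) + ((v t)\<^sup>2 - 1) * (1 - 1 / (a t)\<^sup>2) = 2 * (a t)\<^sup>2"
      unfolding w_def v_def using a0[OF t] by (simp add: divide_simps power2_eq_square) algebra
    also have "X t * ?d * (2 * (a t)\<^sup>2) = csqrt t * X t / of_real (\<sigma> * sqrt \<sigma>)"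
      using a0[OF t] \<sigma> by (simp add: power2_eq_square) (simp add: a_def mult_ac)
    finally show ?thesis .
  qed
  \<comment> \<open>In the variable \<open>z = t / \<sigma>\<close> the endpoints are
    \<open>1 + 2 i\<close> and its conjugate, independently of \<open>\<sigma>\<close>. Since
    \<open>z + 1 / z = 6/5 + 8/5 i\<close>, subtracting or adding 2 gives the squares of
    \<open>W\<close> and \<open>V\<close>.\<close>
  define t1 t0 where "t1 = Complex \<sigma> (2 * \<sigma>)" and "t0 = Complex \<sigma> (- 2 * \<sigma>)"
  have t0: "t0 = cnj t1" by (simp add: t0_def t1_def complex_eq_iff)
  have t1S: "t1 \<in> S" "t0 \<in> S" using \<sigma> by (auto simp: S_def t1_def t0_def)
  have "((\<lambda>t. csqrt t * X t / of_real (\<sigma> * sqrt \<sigma>)) has_contour_integral \<Psi> (pathfinish p) - \<Psi> (pathstart p)) p"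
  proof (rule contour_integral_primitive[of S])
    show "(\<Psi> has_field_derivative csqrt t * X t / of_real (\<sigma> * sqrt \<sigma>)) (at t within S)" if "t \<in> S" for t
      using \<Psi>'[OF that] by (rule has_field_derivative_at_within)
    show "path_image p \<subseteq> S" using \<sigma> by (auto simp: p_def S_def closed_segment_same_Re)
  qed (simp add: p_def)
  then have "((\<lambda>t. of_real (\<sigma> * sqrt \<sigma>) * (csqrt t * X t / of_real (\<sigma> * sqrt \<sigma>))) has_contour_integral
      of_real (\<sigma> * sqrt \<sigma>) * (\<Psi> t1 - \<Psi> t0)) p"
    unfolding p_def t1_def t0_def by (intro has_contour_integral_lmul) simp
  moreover have "of_real (\<sigma> * sqrt \<sigma>) * (csqrt t * X t / of_real (\<sigma> * sqrt \<sigma>)) = csqrt t * X t" for t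
    using \<sigma> by simp
  ultimately have I: "contour_integral p (\<lambda>t. csqrt t * X t) = of_real (\<sigma> * sqrt \<sigma>) * (\<Psi> t1 - \<Psi> t0)"
    by (simp only: contour_integral_unique)
  define A where "A = a t1"
  have acnj: "a t0 = cnj A"
    using t1S by (simp add: t0 A_def a_def cnj_csqrt complex_nonpos_Reals_iff S_def)
  define W V where "W = w t1" and "V = v t1"
  have WV: "w t1 = W" "v t1 = V" "w t0 = cnj W" "v t0 = cnj V"
    by (simp_all add: W_def V_def w_def v_def acnj A_def[symmetric])
  have A2: "A\<^sup>2 = Complex 1 2"
    using a2[OF t1S(1)] \<sigma> by (simp add: A_def t1_def complex_eq_iff)
  have A0: "A \<noteq> 0" using a0[OF t1S(1)] by (simp add: A_def)
  have W2: "W\<^sup>2 = Complex (-4/5) (8/5)" and V2: "V\<^sup>2 = Complex (16/5) (8/5)"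
  proof -
    have i: "1 / Complex 1 2 = Complex (1/5) (-2/5)"
      by (simp add: complex_eq_iff Re_divide Im_divide power2_eq_square)
    have "W\<^sup>2 = A\<^sup>2 + 1 / A\<^sup>2 - 2" "V\<^sup>2 = A\<^sup>2 + 1 / A\<^sup>2 + 2"
      unfolding W_def V_def w_def v_def A_def[symmetric] using A0
      by (simp_all add: power2_diff power2_sum power_one_over)
    then show "W\<^sup>2 = Complex (-4/5) (8/5)" "V\<^sup>2 = Complex (16/5) (8/5)"
      unfolding A2 i by (simp_all add: complex_eq_iff)
  qed
  have nW: "norm W \<le> 2" and nV: "norm V \<le> 2"
  proof -
    have n: "norm W ^ 2 \<le> 2 ^ 2" "norm V ^ 2 \<le> 2 ^ 2"
      unfolding norm_power[symmetric] W2 V2 complex_norm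
      by (rule real_le_lsqrt; simp add: power2_eq_square)+
    show "norm W \<le> 2" by (rule power2_le_imp_le[OF n(1)]) simp
    show "norm V \<le> 2" by (rule power2_le_imp_le[OF n(2)]) simp
  qed
  \<comment> \<open>The square of \<open>Im W\<close> exceeds that of \<open>Re W\<close> by
    \<open>4/5\<close>, which is more than \<open>16/25\<close>; the sign follows from
    \<open>Re A \<ge> 0\<close> and \<open>Re A * Im A = 1\<close>.\<close>
  have ImW: "Im W \<ge> 4/5"
  proof -
    have ReA: "Re A \<ge> 0" using Re_csqrt[of t1] \<sigma> by (simp add: A_def a_def)
    have "2 * Re A * Im A = 2" using arg_cong[OF A2, of Im] by (simp add: Im_power2)
    then have "Im A > 0" using mult_nonneg_nonpos[OF ReA, of "Im A"] by (cases "Im A > 0") auto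
    moreover have "Im W = Im A + Im A / (norm A)\<^sup>2"
      by (simp add: W_def w_def A_def[symmetric] Im_divide cmod_power2)
    ultimately have pos: "Im W > 0" using A0 by (simp add: add_pos_nonneg)
    have "(Re W)\<^sup>2 - (Im W)\<^sup>2 = -4/5" using arg_cong[OF W2, of Re] by (simp add: Re_power2)
    moreover have "(4/5)\<^sup>2 = (16/25 :: real)" by (simp add: power2_eq_square)
    ultimately have "(4/5)\<^sup>2 \<le> (Im W)\<^sup>2" using zero_le_power2[of "Re W"] by linarith
    then show ?thesis using pos by (intro power2_le_imp_le[of "4/5"]) auto
  qed
  have eW: "norm (e z) = exp (- (2/5) * \<mu>)" if "Re (z\<^sup>2) = -4/5" for z
    using that by (simp add: e_def m_def)
  have eV: "norm (e z) = exp (8/5 * \<mu>)" if "Re (z\<^sup>2) = 16/5" for z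
    using that by (simp add: e_def m_def)
  have re: "Re (W\<^sup>2) = -4/5" "Re ((cnj W)\<^sup>2) = -4/5" "Re (V\<^sup>2) = 16/5" "Re ((cnj V)\<^sup>2) = 16/5"
    unfolding complex_cnj_power[symmetric] by (simp_all add: W2 V2)
  have VB: "norm (\<Phi> z - \<Phi> 0) \<le> exp (8/5 * \<mu>) * 2" if z: "Re (z\<^sup>2) = 16/5" "norm z \<le> 2" for z
  proof -
    have "norm (\<Phi> z - \<Phi> 0) \<le> exp (\<mu> / 2 * (16/5)) * norm (z - 0)"
    proof (rule segment_bound)
      fix y assume "y \<in> closed_segment z 0"
      then obtain u where u: "0 \<le> u" "u \<le> 1" "y = of_real u * z"
        by (auto simp: closed_segment_commute[of z] in_segment scaleR_conv_of_real)
      have "Re (y\<^sup>2) = u\<^sup>2 * (16/5)" using z(1) by (simp add: u(3) power_mult_distrib flip: of_real_power)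
      also have "u\<^sup>2 \<le> 1" using u by (simp add: power_le_one)
      finally show "Re (y\<^sup>2) \<le> 16/5" by simp
    qed
    also have "\<dots> \<le> exp (8/5 * \<mu>) * 2"
      using z(2) by (intro mult_mono) auto
    finally show ?thesis .
  qed
  define R where "R = \<Phi> W - \<Phi> (cnj W) - \<i> * of_real (sqrt (2 * pi / \<mu>))"
  have R: "norm R \<le> 13/2 * exp (- (2/5) * \<mu>)"
    unfolding R_def by (rule vertical_estimate) (use ImW nW re in auto)
  define s where "s = complex_of_real (sqrt (2 * pi / \<mu>))"
  have m1: "norm (1 - 1 / m) \<le> 1" "norm (1 + 1 / m) \<le> 2" "norm m \<ge> 1"
  proof -
    have "1 - 1 / m = of_real (1 - 1 / \<mu>)" "1 + 1 / m = of_real (1 + 1 / \<mu>)" by (simp_all add: m_def)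
    moreover have "1 / \<mu> \<le> 1" "1 / \<mu> \<ge> 0" using \<mu> by auto
    ultimately show "norm (1 - 1 / m) \<le> 1" "norm (1 + 1 / m) \<le> 2" by (simp_all only: norm_of_real)
    show "norm m \<ge> 1" using \<mu> by (simp add: m_def)
  qed
  have zb: "norm (z * e z / m) \<le> 2 * B" if "norm z \<le> 2" "norm (e z) = B" for z B
  proof -
    have "norm (z * e z / m) \<le> norm z * norm (e z) / 1"
      unfolding norm_mult norm_divide using m1(3) by (intro divide_left_mono) auto
    also have "\<dots> \<le> 2 * B" using that by (simp add: mult_right_mono) (metis mult_right_mono norm_ge_zero)
    finally show ?thesis .
  qed
  have "norm (G W - G (cnj W) - (1 - 1 / m) * (\<i> * s)) \<le> 13/2 * exp (- (2/5) * \<mu>) + (2 * exp (- (2/5) * \<mu>) + 2 * exp (- (2/5) * \<mu>))"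
  proof -
    have "G W - G (cnj W) - (1 - 1 / m) * (\<i> * s) = (1 - 1 / m) * R + (W * e W / m - cnj W * e (cnj W) / m)"
      by (simp add: G_def R_def s_def algebra_simps)
    also have "norm \<dots> \<le> norm ((1 - 1 / m) * R) + (norm (W * e W / m) + norm (cnj W * e (cnj W) / m))"
      by (intro norm_triangle_le add_mono norm_triangle_ineq4 order_refl)
    also have "\<dots> \<le> 13/2 * exp (- (2/5) * \<mu>) + (2 * exp (- (2/5) * \<mu>) + 2 * exp (- (2/5) * \<mu>))"
    proof (intro add_mono zb)
      show "norm ((1 - 1 / m) * R) \<le> 13/2 * exp (- (2/5) * \<mu>)"
        using mult_mono[OF m1(1) R] by (simp add: norm_mult)
    qed (use nW eW re in auto)
    finally show ?thesis .
  qed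
  then have GB: "norm (G W - G (cnj W) - (1 - 1 / m) * (\<i> * s)) \<le> 21/2 * exp (- (2/5) * \<mu>)" by simp
  have HB: "norm (H V - H (cnj V)) \<le> 12 * exp (8/5 * \<mu>)"
  proof -
    have "H V - H (cnj V) = (- (1 + 1 / m)) * ((\<Phi> V - \<Phi> 0) - (\<Phi> (cnj V) - \<Phi> 0)) + (V * e V / m - cnj V * e (cnj V) / m)"
      by (simp add: H_def algebra_simps)
    also have "norm \<dots> \<le> norm ((- (1 + 1 / m)) * ((\<Phi> V - \<Phi> 0) - (\<Phi> (cnj V) - \<Phi> 0))) + (norm (V * e V / m) + norm (cnj V * e (cnj V) / m))"
      by (intro norm_triangle_le add_mono norm_triangle_ineq4 order_refl)
    also have "\<dots> \<le> 2 * (exp (8/5 * \<mu>) * 2 + exp (8/5 * \<mu>) * 2) + (2 * exp (8/5 * \<mu>) + 2 * exp (8/5 * \<mu>))"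
    proof (intro add_mono zb)
      have "norm ((\<Phi> V - \<Phi> 0) - (\<Phi> (cnj V) - \<Phi> 0)) \<le> exp (8/5 * \<mu>) * 2 + exp (8/5 * \<mu>) * 2"
        by (rule order.trans[OF norm_triangle_ineq4], intro add_mono VB) (use nV re in auto)
      then show "norm ((- (1 + 1 / m)) * ((\<Phi> V - \<Phi> 0) - (\<Phi> (cnj V) - \<Phi> 0))) \<le> 2 * (exp (8/5 * \<mu>) * 2 + exp (8/5 * \<mu>) * 2)"
        unfolding norm_mult norm_minus_cancel by (intro mult_mono m1) auto
    qed (use nV eV re in auto)
    finally show ?thesis by simp
  qed
  have "norm (\<Psi> t1 - \<Psi> t0 - exp m * (1 - 1 / m) * (\<i> * s)) \<le> exp \<mu> * (21/2 * exp (- (2/5) * \<mu>)) + exp (- \<mu>) * (12 * exp (8/5 * \<mu>))"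
  proof -
    have "\<Psi> t1 - \<Psi> t0 - exp m * (1 - 1 / m) * (\<i> * s) =
       exp m * (G W - G (cnj W) - (1 - 1 / m) * (\<i> * s)) + exp (- m) * (H V - H (cnj V))"
      by (simp add: \<Psi>_def WV algebra_simps)
    also have "norm \<dots> \<le> norm (exp m) * norm (G W - G (cnj W) - (1 - 1 / m) * (\<i> * s)) + norm (exp (- m)) * norm (H V - H (cnj V))"
      unfolding norm_mult[symmetric] by (rule norm_triangle_ineq)
    also have "\<dots> \<le> exp \<mu> * (21/2 * exp (- (2/5) * \<mu>)) + exp (- \<mu>) * (12 * exp (8/5 * \<mu>))"
      by (intro add_mono mult_mono GB HB) (auto simp: m_def)
    finally show ?thesis .
  qed
  \<comment> \<open>The two errors have the same exponent,
    \<open>1 - 2/5 = - 1 + 8/5 = 3/5\<close>.\<close>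
  also have "\<dots> = 45/2 * exp (3/5 * \<mu>)"
    by (simp add: mult.left_commute[of "exp _"] flip: exp_add)
  also have "\<dots> \<le> 30 * exp (3/5 * \<mu>)" by simp
  finally have fin: "norm (\<Psi> t1 - \<Psi> t0 - exp m * (1 - 1 / m) * (\<i> * s)) \<le> 30 * exp (3/5 * \<mu>)" .
  have "contour_integral p (\<lambda>t. csqrt t * X t) - \<i> * of_real (\<sigma> * sqrt \<sigma> * exp \<mu> * (1 - 1 / \<mu>) * sqrt (2 * pi / \<mu>)) =
     of_real (\<sigma> * sqrt \<sigma>) * (\<Psi> t1 - \<Psi> t0 - exp m * (1 - 1 / m) * (\<i> * s))"
    unfolding I by (simp add: s_def m_def algebra_simps exp_of_real)
  also have "norm \<dots> \<le> \<sigma> * sqrt \<sigma> * (30 * exp (3/5 * \<mu>))"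
    unfolding norm_mult using \<sigma> fin by (intro mult_mono) (auto simp: norm_mult)
  finally show ?thesis unfolding X_def m_def by simp
qed

section \<open>The coefficient integral\<close>

lemma contour_integral_exp_period:
  fixes k :: int and \<sigma> :: real
  shows "((\<lambda>t. exp (of_int k * t)) has_contour_integral (if k = 0 then 2 * pi * \<i> else 0))
     (linepath (Complex \<sigma> (- pi)) (Complex \<sigma> pi))"
proof (cases "k = 0")
  case True
  have *: "Complex \<sigma> pi - Complex \<sigma> (- pi) = 2 * pi * \<i>" by (simp add: complex_eq_iff)
  show ?thesis
    using has_contour_integral_const_linepath[of 1 "Complex \<sigma> pi" "Complex \<sigma> (- pi)"]
    by (simp only: True of_int_0 mult_zero_left exp_zero simp_thms if_True mult_1 *)
next
  case False
  let ?p = "linepath (Complex \<sigma> (- pi)) (Complex \<sigma> pi)"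
  have "((\<lambda>t. exp (of_int k * t)) has_contour_integral
      exp (of_int k * pathfinish ?p) / of_int k - exp (of_int k * pathstart ?p) / of_int k) ?p"
    by (rule contour_integral_primitive[of UNIV "\<lambda>t. exp (of_int k * t) / of_int k"])
       (use False in \<open>auto intro!: derivative_eq_intros\<close>)
  moreover have "exp (of_int k * Complex \<sigma> pi) = exp (of_int k * Complex \<sigma> (- pi))"
    unfolding exp_eq by (intro exI[of _ k]) (simp add: complex_eq_iff)
  ultimately show ?thesis using False by simp
qed

definition overpart_integrand :: "nat \<Rightarrow> complex \<Rightarrow> complex" where
  "overpart_integrand n t = eval_fps overpart_fps (exp (- t)) * exp (of_nat n * t)"

lemma continuous_on_overpart_integrand:
  assumes "\<And>t. t \<in> S \<Longrightarrow> Re t > 0"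
  shows "continuous_on S (overpart_integrand n)"
proof -
  have "continuous_on (ball 0 1) (eval_fps overpart_fps)"
    by (rule continuous_on_eval_fps') (use norm_less_conv_radius[OF fps_conv_radius_overpart_fps] in \<open>auto intro: continuous_intros\<close>)
  then have "continuous_on S (\<lambda>t. eval_fps overpart_fps (exp (- t)))"
    by (rule continuous_on_compose2[of _ _ _ "\<lambda>t. exp (- t)"]) (use assms in \<open>auto intro!: continuous_intros\<close>)
  then show ?thesis unfolding overpart_integrand_def
    by (rule continuous_on_mult) (intro continuous_intros)
qed

text \<open>Cauchy's coefficient formula in the variable \<open>q = exp (- t)\<close>: the circle
  becomes a vertical segment of one period, and uniform convergence allows termwise
  integration.\<close>

lemma overpart_contour_integral:
  fixes \<sigma> :: real assumes \<sigma>: "\<sigma> > 0"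
  shows "contour_integral (linepath (Complex \<sigma> (- pi)) (Complex \<sigma> pi)) (overpart_integrand n) = 2 * pi * \<i> * of_nat (overpart n)"
proof -
  define f where "f k t = of_nat (overpart k) * exp (of_int (int n - int k) * t)" for k and t :: complex
  let ?S = "closed_segment (Complex \<sigma> (- pi)) (Complex \<sigma> pi)"
  have Re: "Re t = \<sigma>" if "t \<in> ?S" for t using that by (auto simp: closed_segment_same_Re)
  define M where "M k = exp (real n * \<sigma>) * (overpart k * exp (- \<sigma>) ^ k)" for k
  have M: "summable M" unfolding M_def by (intro summable_mult summable_overpart) (use \<sigma> in auto)
  have f_eq: "f k t = exp (of_nat n * t) * (of_nat (overpart k) * exp (- t) ^ k)" for k t
    by (simp add: f_def exp_of_nat_mult[symmetric] exp_add[symmetric] algebra_simps)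
  have lim: "(\<Sum>k. f k t) = overpart_integrand n t" if "t \<in> ?S" for t
  proof -
    have "norm (exp (- t)) < 1" using Re[OF that] \<sigma> by simp
    from sums_eval_fps[OF norm_less_conv_radius[OF fps_conv_radius_overpart_fps this]]
    have "(\<lambda>k. exp (of_nat n * t) * (of_nat (overpart k) * exp (- t) ^ k)) sums
        (exp (of_nat n * t) * eval_fps overpart_fps (exp (- t)))"
      by (intro sums_mult) (simp add: overpart_fps_def)
    then show ?thesis by (simp add: f_eq overpart_integrand_def sums_iff mult.commute)
  qed
  have "uniform_limit ?S (\<lambda>N t. \<Sum>k<N. f k t) (\<lambda>t. \<Sum>k. f k t) sequentially"
    by (rule Weierstrass_m_test[OF _ M])
       (auto simp: f_eq M_def norm_mult norm_power Re)
  then have ul: "uniform_limit ?S (\<lambda>N t. \<Sum>k<N. f k t) (overpart_integrand n) sequentially"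
    by (rule uniform_limit_cong'[THEN iffD1, rotated 2]) (auto simp: lim)
  obtain J where J: "(overpart_integrand n has_contour_integral J) (linepath (Complex \<sigma> (- pi)) (Complex \<sigma> pi))"
    "(\<lambda>k. contour_integral (linepath (Complex \<sigma> (- pi)) (Complex \<sigma> pi)) (f k)) sums J"
  proof (rule contour_integral_sums_linepath[OF ul])
    show "continuous_on ?S (f k)" for k unfolding f_def[abs_def] by (intro continuous_intros)
  qed blast
  have "contour_integral (linepath (Complex \<sigma> (- pi)) (Complex \<sigma> pi)) (f k) = (if k = n then 2 * pi * \<i> * of_nat (overpart n) else 0)" for k
    using contour_integral_unique[OF has_contour_integral_lmul[OF contour_integral_exp_period[of "int n - int k" \<sigma>], of "of_nat (overpart k)"]]
    by (auto simp: f_def[abs_def])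
  then have "J = 2 * pi * \<i> * of_nat (overpart n)"
    using J(2) sums_unique2 sums_single[of n "\<lambda>_. 2 * pi * \<i> * of_nat (overpart n)"] by simp
  then show ?thesis using contour_integral_unique[OF J(1)] by simp
qed

section \<open>Minor and major arcs\<close>

lemma inverse_le_half_coth:
  fixes x :: real assumes "x > 0"
  shows "1 / x \<le> 1 / (1 - exp (- x)) - 1 / 2"
proof -
  \<comment> \<open>The right side of the claim is \<open>coth (x / 2) / 2\<close>; \<open>g\<close>
    is the difference of the two sides after clearing denominators.\<close>
  define g where "g x = x * (1 + exp (- x)) - 2 * (1 - exp (- x))" for x :: real
  have "g 0 \<le> g x"
  proof (rule DERIV_nonneg_imp_nondecreasing[of 0 x])
    fix y :: real assume "0 \<le> y" "y \<le> x"
    have "(g has_real_derivative 1 - (1 + y) * exp (- y)) (at y)"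
      unfolding g_def by (auto intro!: derivative_eq_intros simp: algebra_simps)
    moreover have "(1 + y) * exp (- y) \<le> 1"
      using exp_ge_add_one_self[of y] by (simp add: exp_minus field_simps)
    ultimately show "\<exists>z. (g has_real_derivative z) (at y) \<and> 0 \<le> z" by auto
  qed (use assms in auto)
  then have "0 \<le> g x" by (simp add: g_def)
  moreover have "exp (- x) < 1" using assms by simp
  ultimately show ?thesis using assms by (simp add: g_def field_simps)
qed

text \<open>With \<open>d = 1 - r\<close> and \<open>e = r (1 - cos y)\<close> one has
  \<open>norm (1 - z) ^ 2 = d^2 + 2 e\<close>, and the gain factors exactly as
  \<open>2 e / (d^2 + 2 e) * (1 / d - 1 / 2)\<close>. The second factor is at least
  \<open>1 / \<sigma>\<close>. For \<open>\<bar>y\<bar> \<ge> 2 \<sigma>\<close> the quotient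
  \<open>2 e / d^2\<close> is at least nearly 4, so the first factor is at least nearly
  \<open>4/5\<close>, above \<open>pi / 4\<close>.\<close>

lemma off_axis_gain:
  fixes \<sigma> y :: real
  assumes \<sigma>: "0 < \<sigma>" "\<sigma> \<le> 1/16" and y: "2 * \<sigma> \<le> \<bar>y\<bar>" "\<bar>y\<bar> \<le> pi"
  defines "z \<equiv> exp (- Complex \<sigma> y)"
  shows "pi / (4 * \<sigma>) \<le> norm z / (1 - norm z) - Re (z / (1 - z))"
proof -
  define r where "r = exp (- \<sigma>)"
  have r: "0 < r" "r < 1" using \<sigma> by (simp_all add: r_def)
  have r15: "r \<ge> 15/16" using exp_ge_add_one_self[of "- \<sigma>"] \<sigma> by (simp add: r_def)
  define c where "c = cos y"
  define d e where "d = 1 - r" and "e = r * (1 - c)"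
  have d: "0 < d" "d \<le> \<sigma>" using r exp_ge_add_one_self[of "- \<sigma>"] by (simp_all add: d_def r_def)
  have nz: "norm z = r" by (simp add: z_def r_def)
  have Rez: "Re z = r * c" and Imz: "Im z = - r * sin y" by (simp_all add: z_def Re_exp Im_exp r_def c_def)
  have z1: "1 - z \<noteq> 0" using nz r by auto
  have cs: "(sin y)\<^sup>2 = 1 - c\<^sup>2" by (simp add: c_def sin_squared_eq)
  have D: "(1 - r * c)\<^sup>2 + (r * sin y)\<^sup>2 = d\<^sup>2 + 2 * e"
    unfolding power_mult_distrib cs by (simp add: d_def e_def power2_eq_square algebra_simps)
  have "Re (1 / (1 - z)) = (1 - r * c) / (d\<^sup>2 + 2 * e)"
    using D by (simp add: Re_divide Rez Imz power2_eq_square)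
  moreover have "z / (1 - z) = 1 / (1 - z) - 1" using z1 by (simp add: field_simps)
  then have "Re (z / (1 - z)) = Re (1 / (1 - z)) - 1" by (simp only: minus_complex.sel one_complex.sel)
  moreover have "1 - r * c = d + e" by (simp add: d_def e_def algebra_simps)
  ultimately have Re: "Re (z / (1 - z)) = (d + e) / (d\<^sup>2 + 2 * e) - 1" by simp
  have L: "norm z / (1 - norm z) = 1 / d - 1" using r by (simp add: nz d_def field_simps)
  have sin: "99/100 * \<sigma> \<le> sin \<sigma>"
  proof -
    have "(\<Sum>m<3. sin_coeff m * \<sigma> ^ m) = \<sigma>"
      by (simp add: sin_coeff_def eval_nat_numeral)
    then have "\<bar>sin \<sigma> - \<sigma>\<bar> \<le> \<sigma> ^ 3 / 6"
      using Maclaurin_sin_bound[of \<sigma> 3] \<sigma> by (simp add: fact_numeral field_simps)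
    moreover have "\<sigma> ^ 3 \<le> \<sigma> * (1/256)"
      using power_mono[OF \<sigma>(2), of 2] \<sigma> by (simp add: eval_nat_numeral)
    ultimately show ?thesis using \<sigma> by linarith
  qed
  have "c \<le> cos (2 * \<sigma>)"
  proof -
    have "cos \<bar>y\<bar> \<le> cos (2 * \<sigma>)" using y \<sigma> by (intro cos_monotone_0_pi_le) auto
    then show ?thesis by (simp add: c_def)
  qed
  also have "\<dots> = 1 - 2 * (sin \<sigma>)\<^sup>2" by (simp add: cos_double_sin)
  finally have c: "2 * (sin \<sigma>)\<^sup>2 \<le> 1 - c" by simp
  \<comment> \<open>The ideal constant is 4; the bounds for \<open>r\<close> and for the sine reduce
    it to about \<open>3.675\<close>, which still exceeds the required \<open>pi / (4 - pi)\<close>,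
    about \<open>3.66\<close>.\<close>
  have "367/100 * d\<^sup>2 \<le> 2 * e"
  proof -
    have "367/100 * d\<^sup>2 \<le> 367/100 * \<sigma>\<^sup>2" using d by (simp add: power_mono)
    also have "\<dots> \<le> 2 * (15/16 * (2 * (99/100 * \<sigma>)\<^sup>2))" by (simp add: power_mult_distrib power2_eq_square)
    also have "\<dots> \<le> 2 * (r * (2 * (sin \<sigma>)\<^sup>2))"
      using r15 sin \<sigma> by (intro mult_left_mono mult_mono power_mono) auto
    also have "\<dots> \<le> 2 * e" unfolding e_def using c r by simp
    finally show ?thesis .
  qed
  then have q: "pi / 4 \<le> 2 * e / (d\<^sup>2 + 2 * e)"
  proof -
    assume *: "367/100 * d\<^sup>2 \<le> 2 * e"
    have d2: "d\<^sup>2 > 0" using d by simp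
    have "pi * d\<^sup>2 \<le> (4 - pi) * (367/100 * d\<^sup>2)"
      using pi_approx d2 by (simp add: algebra_simps)
    also have "\<dots> \<le> (4 - pi) * (2 * e)" using * pi_less_4 by (intro mult_left_mono) auto
    finally have "pi / 4 * (d\<^sup>2 + 2 * e) \<le> 2 * e" by (simp add: algebra_simps)
    moreover have "0 < d\<^sup>2 + 2 * e" using d2 * by linarith
    ultimately show ?thesis by (simp add: pos_le_divide_eq)
  qed
  have e0: "e \<ge> 0" using r by (simp add: e_def c_def)
  have "pi / (4 * \<sigma>) = pi / 4 * (1 / \<sigma>)" by simp
  also have "\<dots> \<le> (2 * e / (d\<^sup>2 + 2 * e)) * (1 / d - 1 / 2)"
    using q inverse_le_half_coth[OF \<sigma>(1)] \<sigma> e0 by (intro mult_mono) (auto simp: d_def r_def)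
  also have "\<dots> = 1 / d - (d + e) / (d\<^sup>2 + 2 * e)"
  proof -
    have "d\<^sup>2 + 2 * e > 0" using d e0 by (simp add: add_pos_nonneg)
    then show ?thesis using d by (simp add: divide_simps power2_eq_square) (simp add: algebra_simps)
  qed
  also have "\<dots> = norm z / (1 - norm z) - Re (z / (1 - z))" unfolding L Re by simp
  finally show ?thesis .
qed

text \<open>From \<open>P * B = M\<close> follows \<open>P - M = P * (1 - B)\<close> with
  \<open>norm P \<le> 2 * norm M\<close>. The theta_2 series has no linear term, so
  \<open>1 - B\<close> is of order \<open>norm Y ^ 2 = exp (- 2 pi^2 \<rho>)\<close>, which
  outweighs the growth \<open>exp (pi^2 \<rho> / 4)\<close> of \<open>M\<close>.\<close>

lemma overpart_major_arc:
  fixes \<sigma> y :: real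
  assumes \<sigma>: "0 < \<sigma>" "\<sigma> \<le> 1/16" and y: "\<bar>y\<bar> \<le> 2 * \<sigma>"
  defines "t \<equiv> Complex \<sigma> y"
  shows "norm (eval_fps overpart_fps (exp (- t)) - csqrt t / (2 * of_real (sqrt pi)) * exp (of_real (pi\<^sup>2) / (4 * t))) \<le> 1"
proof -
  define Y where "Y = exp (- of_real (pi\<^sup>2) / t)"
  define M where "M = csqrt t / (2 * of_real (sqrt pi)) * exp (of_real (pi\<^sup>2) / (4 * t))"
  define P where "P = eval_fps overpart_fps (exp (- t))"
  define B where "B = eval_fps theta2_fps Y"
  define \<rho> where "\<rho> = \<sigma> / (\<sigma>\<^sup>2 + y\<^sup>2)"
  have y2: "y\<^sup>2 \<le> 4 * \<sigma>\<^sup>2" using power_mono[OF y, of 2] by (simp add: power_mult_distrib)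
  \<comment> \<open>Here \<open>\<rho> = Re (1 / t)\<close>, and on the arc it is at least
    \<open>1 / (5 * \<sigma>) \<ge> 16/5\<close>.\<close>
  have "3 \<le> \<rho>"
  proof -
    have "3 * (\<sigma>\<^sup>2 + y\<^sup>2) \<le> 3 * (5 * \<sigma>\<^sup>2)" using y2 by simp
    also have "\<dots> \<le> \<sigma>" using \<sigma> by (simp add: power2_eq_square)
    finally show ?thesis using \<sigma> by (simp add: \<rho>_def pos_le_divide_eq add_pos_nonneg)
  qed
  have pi2: "pi\<^sup>2 \<ge> 9" using power_mono[of 3 pi 2] pi_gt3 by simp
  have Re: "Re (of_real (pi\<^sup>2) / t) = pi\<^sup>2 * \<rho>"
    by (simp add: t_def Re_divide \<rho>_def)
  have big: "27 \<le> pi\<^sup>2 * \<rho>" using mult_mono[OF pi2 \<open>3 \<le> \<rho>\<close>] by simp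
  have nY: "norm Y = exp (- (pi\<^sup>2 * \<rho>))" using Re by (simp add: Y_def)
  have "exp (- (pi\<^sup>2 * \<rho>)) \<le> 1 / 2"
  proof -
    have "2 \<le> exp (pi\<^sup>2 * \<rho>)" using exp_ge_add_one_self[of "pi\<^sup>2 * \<rho>"] big by linarith
    then show ?thesis by (simp add: exp_minus field_simps)
  qed
  then have Y12: "norm Y \<le> 1 / 2" by (simp add: nY)
  have B1: "norm (B - 1) \<le> 2 * norm Y ^ 2" unfolding B_def by (rule theta2_bound[OF Y12])
  also have "\<dots> \<le> 2 * (1/2)\<^sup>2" using Y12 by (intro mult_left_mono power_mono) auto
  finally have "norm (B - 1) \<le> 1 / 2" by (simp add: power2_eq_square)
  then have B2: "norm B \<ge> 1 / 2" using norm_triangle_ineq2[of 1 "1 - B"] by (simp add: norm_minus_commute)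
  have PB: "P * B = M"
    unfolding P_def B_def M_def Y_def by (rule overpart_transformation) (simp add: t_def \<sigma>)
  have nM: "norm M \<le> 1/4 * exp (pi\<^sup>2 * \<rho> / 4)"
  proof -
    have "norm t \<le> \<bar>\<sigma>\<bar> + \<bar>y\<bar>" unfolding t_def by (rule order.trans[OF cmod_le]) simp
    then have "norm t \<le> 1/4" using \<sigma> y by simp
    then have "sqrt (norm t) \<le> 1/2" by (intro real_le_lsqrt) (auto simp: power2_eq_square)
    moreover have "1 \<le> sqrt pi" using pi_gt3 by simp
    ultimately have "sqrt (norm t) / (2 * sqrt pi) \<le> (1/2) / 2" by (intro frac_le) auto
    then have "sqrt (norm t) / (2 * sqrt pi) * exp (pi\<^sup>2 * \<rho> / 4) \<le> 1/4 * exp (pi\<^sup>2 * \<rho> / 4)"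
      by (intro mult_right_mono) auto
    moreover have "Re (of_real (pi\<^sup>2) / (4 * t)) = pi\<^sup>2 * \<rho> / 4"
    proof -
      have "of_real (pi\<^sup>2) / (4 * t) = (of_real (pi\<^sup>2) / t) / of_real 4" by simp
      then show ?thesis by (simp only: Re_divide_of_real Re)
    qed
    then have "norm M = sqrt (norm t) / (2 * sqrt pi) * exp (pi\<^sup>2 * \<rho> / 4)"
      unfolding M_def norm_mult norm_divide norm_exp_eq_Re norm_csqrt by (simp only:) simp
    ultimately show ?thesis by (simp only:)
  qed
  have "P - M = P * (1 - B)" using PB by (simp add: algebra_simps)
  then have "norm (P - M) = norm P * norm (B - 1)" by (simp add: norm_mult norm_minus_commute)
  also have "norm P \<le> 2 * norm M"
    using B2 mult_left_mono[OF B2, of "norm P"] unfolding PB[symmetric] norm_mult by simp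
  then have "norm P * norm (B - 1) \<le> (2 * norm M) * (2 * norm Y ^ 2)" using B1 by (intro mult_mono) auto
  also have "\<dots> \<le> (2 * (1/4 * exp (pi\<^sup>2 * \<rho> / 4))) * (2 * norm Y ^ 2)" using nM by (intro mult_mono) auto
  also have "\<dots> = exp (pi\<^sup>2 * \<rho> / 4) * norm Y ^ 2" by simp
  also have "\<dots> = exp (pi\<^sup>2 * \<rho> / 4 + 2 * (- (pi\<^sup>2 * \<rho>)))"
    unfolding nY by (simp only: exp_add exp_double)
  also have "\<dots> \<le> exp 0" using big unfolding exp_le_cancel_iff by linarith
  finally show ?thesis by (simp add: P_def M_def)
qed

lemma overpart_estimate:
  fixes n :: nat assumes n: "n \<ge> 729"
  defines "\<mu> \<equiv> pi * sqrt (real n)"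
  shows "\<bar>8 * real n * exp (- \<mu>) * overpart n - (1 - 1 / \<mu>)\<bar> \<le> 2 * real n * exp (- sqrt (real n))"
proof -
  define s where "s = sqrt (real n)"
  have s: "s \<ge> 27" using n real_le_rsqrt[of 27 "real n"] by (simp add: s_def)
  have ns: "real n = s\<^sup>2" by (simp add: s_def)
  have \<mu>s: "\<mu> = pi * s" by (simp add: \<mu>_def s_def)
  have \<mu>: "\<mu> \<ge> 1" unfolding \<mu>s using mult_mono[of 1 pi 1 s] s pi_gt3 by simp
  \<comment> \<open>The saddle point: it balances \<open>n * \<sigma>\<close> and
    \<open>pi^2 / (4 * \<sigma>)\<close>, both equal to \<open>\<mu> / 2\<close>. With this choice
    the gain \<open>pi / (4 * \<sigma>)\<close> is \<open>s / 2\<close>, hence a saving of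
    \<open>exp (- s)\<close>.\<close>
  define \<sigma> where "\<sigma> = pi / (2 * s)"
  have \<sigma>0: "\<sigma> > 0" using s by (simp add: \<sigma>_def)
  have \<sigma>1: "\<sigma> \<le> 1/16" using s pi_approx by (simp add: \<sigma>_def divide_simps)
  have n\<sigma>: "real n * \<sigma> = \<mu> / 2" using s by (simp add: ns \<mu>s \<sigma>_def power2_eq_square)
  have p\<sigma>: "pi\<^sup>2 / (4 * \<sigma>) = \<mu> / 2" using s by (simp add: \<mu>s \<sigma>_def power2_eq_square)
  define K where "K = 1 / (2 * sqrt pi)"
  have K: "0 < K" "K \<le> 2/7"
  proof -
    have "7/4 \<le> sqrt pi" using pi_approx by (intro real_le_rsqrt) (simp add: power2_eq_square)
    then show "0 < K" "K \<le> 2/7" by (simp_all add: K_def field_simps)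
  qed
  have sq\<sigma>: "0 < sqrt \<sigma>" "sqrt \<sigma> \<le> 1/4"
  proof -
    show "0 < sqrt \<sigma>" using \<sigma>0 by simp
    show "sqrt \<sigma> \<le> 1/4" by (rule real_le_lsqrt) (use \<sigma>1 in \<open>simp_all add: power2_eq_square\<close>)
  qed
  define F where "F = overpart_integrand n"
  define H where "H t = csqrt t * exp (of_real (\<mu> / 2) * (t / of_real \<sigma> + of_real \<sigma> / t))" for t
  define a b c d where "a = Complex \<sigma> (- pi)" and "b = Complex \<sigma> (- 2 * \<sigma>)"
    and "c = Complex \<sigma> (2 * \<sigma>)" and "d = Complex \<sigma> pi"
  have s2pi: "2 * \<sigma> \<le> pi" using \<sigma>1 pi_gt3 by simp
  have seg: "closed_segment (Complex \<sigma> u) (Complex \<sigma> v) = {z. Re z = \<sigma> \<and> Im z \<in> {u..v}}" if "u \<le> v" for u v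
    using that by (simp add: closed_segment_same_Re closed_segment_eq_real_ivl)
  have contF: "continuous_on S F" if "\<And>t. t \<in> S \<Longrightarrow> Re t = \<sigma>" for S
    unfolding F_def by (rule continuous_on_overpart_integrand) (use that \<sigma>0 in simp)
  have segs: "closed_segment a d = {z. Re z = \<sigma> \<and> Im z \<in> {- pi..pi}}"
    "closed_segment a b = {z. Re z = \<sigma> \<and> Im z \<in> {- pi..- 2 * \<sigma>}}"
    "closed_segment b c = {z. Re z = \<sigma> \<and> Im z \<in> {- 2 * \<sigma>..2 * \<sigma>}}"
    "closed_segment b d = {z. Re z = \<sigma> \<and> Im z \<in> {- 2 * \<sigma>..pi}}"
    "closed_segment c d = {z. Re z = \<sigma> \<and> Im z \<in> {2 * \<sigma>..pi}}"
    unfolding a_def b_def c_def d_def using s2pi \<sigma>0 by (simp_all add: seg)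
  define I1 I2 I3 where "I1 = contour_integral (linepath a b) F"
    and "I2 = contour_integral (linepath b c) F" and "I3 = contour_integral (linepath c d) F"
  have total: "2 * pi * \<i> * of_nat (overpart n) = I1 + I2 + I3"
  proof -
    have "b \<in> closed_segment a d" "c \<in> closed_segment b d"
      using s2pi \<sigma>0 unfolding segs by (auto simp: b_def c_def)
    then have "contour_integral (linepath a d) F = I1 + (I2 + I3)"
      unfolding I1_def I2_def I3_def
      by (subst contour_integral_split_linepath[of a d F b], (auto simp: segs intro: contF)[2],
          subst contour_integral_split_linepath[of b d F c]) (auto simp: segs intro: contF)
    then show ?thesis using overpart_contour_integral[OF \<sigma>0, of n] by (simp add: a_def d_def F_def)
  qed
  \<comment> \<open>One factor \<open>exp (\<mu> / 2)\<close> comes from the generating function at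
    \<open>exp (- \<sigma>)\<close>, the other from \<open>exp (n * t)\<close>;
    \<open>exp (- s)\<close> is the gain away from the axis.\<close>
  define E where "E = K * sqrt \<sigma> * exp \<mu> * exp (- s)"
  have E0: "E \<ge> 0" using K sq\<sigma> by (simp add: E_def)
  have minor: "norm (F t) \<le> E" if t: "Re t = \<sigma>" "2 * \<sigma> \<le> \<bar>Im t\<bar>" "\<bar>Im t\<bar> \<le> pi" for t
  proof -
    have t_eq: "t = Complex \<sigma> (Im t)" using t(1) by (simp add: complex_eq_iff)
    define z where "z = exp (- t)"
    have nz: "norm z = exp (- \<sigma>)" using t by (simp add: z_def)
    then have z1: "norm z < 1" using \<sigma>0 by simp
    have "pi / (4 * \<sigma>) \<le> norm z / (1 - norm z) - Re (z / (1 - z))"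
      using off_axis_gain[OF \<sigma>0 \<sigma>1 t(2,3)] by (simp only: z_def t_eq[symmetric])
    moreover have "- 2 * X \<le> - s" if "pi / (4 * \<sigma>) \<le> X" for X
      using s that by (simp add: \<sigma>_def)
    ultimately have "- 2 * (norm z / (1 - norm z) - Re (z / (1 - z))) \<le> - s" by blast
    then have g: "exp (- 2 * (norm z / (1 - norm z) - Re (z / (1 - z)))) \<le> exp (- s)" by (simp only: exp_le_cancel_iff)
    have "norm (eval_fps overpart_fps z) \<le> norm (eval_fps overpart_fps (of_real (norm z))) *
       exp (- 2 * (norm z / (1 - norm z) - Re (z / (1 - z))))"
      by (rule overpart_off_axis_bound[OF z1])
    also have "\<dots> \<le> (sqrt \<sigma> / (2 * sqrt pi) * exp (pi\<^sup>2 / (4 * \<sigma>))) * exp (- s)"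
      using overpart_real_bound[OF \<sigma>0] g \<sigma>0 unfolding nz by (intro mult_mono) auto
    also have "\<dots> = K * sqrt \<sigma> * exp (\<mu> / 2) * exp (- s)" by (simp add: p\<sigma> K_def)
    finally have "norm (eval_fps overpart_fps z) \<le> K * sqrt \<sigma> * exp (\<mu> / 2) * exp (- s)" .
    then have "norm (F t) \<le> K * sqrt \<sigma> * exp (\<mu> / 2) * exp (- s) * exp (\<mu> / 2)"
      unfolding F_def overpart_integrand_def norm_mult z_def[symmetric]
    proof (rule mult_mono)
      show "norm (exp (of_nat n * t)) \<le> exp (\<mu> / 2)" using t n\<sigma> by simp
      show "0 \<le> K * sqrt \<sigma> * exp (\<mu> / 2) * exp (- s)" using K sq\<sigma> by simp
    qed auto
    also have "\<dots> = K * sqrt \<sigma> * (exp (\<mu> / 2) * exp (\<mu> / 2)) * exp (- s)" by (simp only: mult_ac)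
    also have "exp (\<mu> / 2) * exp (\<mu> / 2) = exp \<mu>" unfolding exp_add[symmetric] by simp
    finally show ?thesis by (simp add: E_def)
  qed
  have len: "norm (b - a) \<le> pi" "norm (d - c) \<le> pi" "norm (c - b) = 4 * \<sigma>"
  proof -
    have "b - a = \<i> * of_real (pi - 2 * \<sigma>)" "d - c = \<i> * of_real (pi - 2 * \<sigma>)" "c - b = \<i> * of_real (4 * \<sigma>)"
      by (simp_all add: a_def b_def c_def d_def complex_eq_iff)
    then show "norm (b - a) \<le> pi" "norm (d - c) \<le> pi" "norm (c - b) = 4 * \<sigma>"
      using s2pi \<sigma>0 by (simp_all only: norm_mult norm_ii norm_of_real) simp_all
  qed
  have I1: "norm I1 \<le> E * pi"
  proof -
    have "norm I1 \<le> E * norm (b - a)" unfolding I1_def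
      by (rule contour_integral_bound_linepath)
         (use \<sigma>0 E0 in \<open>auto simp: segs intro!: contour_integrable_continuous_linepath contF minor\<close>)
    also have "\<dots> \<le> E * pi" using E0 len by (intro mult_left_mono) auto
    finally show ?thesis .
  qed
  have I3: "norm I3 \<le> E * pi"
  proof -
    have "norm I3 \<le> E * norm (d - c)" unfolding I3_def
      by (rule contour_integral_bound_linepath)
         (use \<sigma>0 E0 in \<open>auto simp: segs intro!: contour_integrable_continuous_linepath contF minor\<close>)
    also have "\<dots> \<le> E * pi" using E0 len by (intro mult_left_mono) auto
    finally show ?thesis .
  qed
  have contH: "continuous_on (closed_segment b c) H"
  proof -
    have "t \<noteq> 0" "t \<notin> \<real>\<^sub>\<le>\<^sub>0" if "t \<in> closed_segment b c" for t
      using that \<sigma>0 by (auto simp: segs complex_nonpos_Reals_iff)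
    moreover from this(2) have "continuous_on (closed_segment b c) csqrt"
      by (intro holomorphic_on_imp_continuous_on holomorphic_on_subset[OF holomorphic_on_csqrt]) auto
    ultimately show ?thesis unfolding H_def
      using \<sigma>0 by (intro continuous_intros) auto
  qed
  have H_eq: "of_real K * H t = csqrt t / (2 * of_real (sqrt pi)) * exp (of_real (pi\<^sup>2) / (4 * t)) * exp (of_nat n * t)"
    if "t \<in> closed_segment b c" for t
  proof -
    have t0: "t \<noteq> 0" using that \<sigma>0 by (auto simp: segs)
    have 1: "of_real (\<mu> / 2) * (t / of_real \<sigma>) = of_nat n * t"
    proof -
      have "of_real (\<mu> / 2) = of_nat n * complex_of_real \<sigma>" unfolding n\<sigma>[symmetric] by simp
      then show ?thesis using \<sigma>0 by simp
    qed
    have 2: "of_real (\<mu> / 2) * (of_real \<sigma> / t) = of_real (pi\<^sup>2) / (4 * t)"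
    proof -
      have "of_real (\<mu> / 2) * of_real \<sigma> = (of_real (pi\<^sup>2 / 4) :: complex)"
        unfolding p\<sigma>[symmetric] of_real_mult[symmetric] using \<sigma>0 by simp
      then show ?thesis using t0 by (simp add: field_simps)
    qed
    show ?thesis unfolding H_def distrib_left 1 2 exp_add by (simp add: K_def)
  qed
  have I2: "norm (I2 - of_real K * contour_integral (linepath b c) H) \<le> exp (\<mu> / 2) * (4 * \<sigma>)"
  proof -
    have iF: "F contour_integrable_on linepath b c"
      by (intro contour_integrable_continuous_linepath contF) (auto simp: segs)
    have iH: "(\<lambda>t. of_real K * H t) contour_integrable_on linepath b c"
      by (intro contour_integrable_continuous_linepath continuous_intros contH)
    have "I2 - of_real K * contour_integral (linepath b c) H = contour_integral (linepath b c) (\<lambda>t. F t - of_real K * H t)"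
      unfolding I2_def using iF iH contour_integrable_continuous_linepath[OF contH]
      by (simp add: contour_integral_diff contour_integral_lmul)
    also have "norm \<dots> \<le> exp (\<mu> / 2) * norm (c - b)"
    proof (rule contour_integral_bound_linepath)
      show "(\<lambda>t. F t - of_real K * H t) contour_integrable_on linepath b c"
        by (intro contour_integrable_diff iF iH)
      fix t assume t: "t \<in> closed_segment b c"
      then have t': "Re t = \<sigma>" "\<bar>Im t\<bar> \<le> 2 * \<sigma>" "t = Complex \<sigma> (Im t)" by (auto simp: segs complex_eq_iff)
      have "F t - of_real K * H t = (eval_fps overpart_fps (exp (- t)) - csqrt t / (2 * of_real (sqrt pi)) * exp (of_real (pi\<^sup>2) / (4 * t))) * exp (of_nat n * t)"
        unfolding H_eq[OF t] F_def overpart_integrand_def by (simp only: left_diff_distrib)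
      also have "norm \<dots> \<le> 1 * exp (\<mu> / 2)"
        unfolding norm_mult using overpart_major_arc[OF \<sigma>0 \<sigma>1 t'(2)] t'(1) n\<sigma>
        by (intro mult_mono) (auto simp only: t'(3)[symmetric] norm_exp_eq_Re, auto)
      finally show "norm (F t - of_real K * H t) \<le> exp (\<mu> / 2)" by simp
    qed auto
    finally show ?thesis by (simp add: len)
  qed
  obtain \<Phi> where "gaussian_primitive \<mu> \<Phi>" using gaussian_primitive_exists[OF \<mu>] .
  then interpret gaussian_primitive \<mu> \<Phi> .
  define Z where "Z = \<sigma> * sqrt \<sigma> * exp \<mu> * (1 - 1 / \<mu>) * sqrt (2 * pi / \<mu>)"
  have C: "norm (contour_integral (linepath b c) H - \<i> * of_real Z) \<le> \<sigma> * sqrt \<sigma> * (30 * exp (3/5 * \<mu>))"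
    using bessel_integral[OF \<sigma>0] unfolding b_def c_def H_def Z_def .
  \<comment> \<open>Dividing this by \<open>2 * pi\<close> gives the main term
    \<open>exp \<mu> / (8 * n) * (1 - 1 / \<mu>)\<close> of \<open>overpart n\<close>.\<close>
  have KZ: "K * Z = pi / (4 * real n) * exp \<mu> * (1 - 1 / \<mu>)"
  proof -
    have "sqrt \<sigma> * sqrt (2 * pi / \<mu>) = sqrt pi / s"
    proof -
      have "\<sigma> * (2 * pi / \<mu>) = pi / s\<^sup>2" using s by (simp add: \<sigma>_def \<mu>s power2_eq_square)
      then show ?thesis using s by (simp only: real_sqrt_mult[symmetric]) (simp add: real_sqrt_divide)
    qed
    then have "K * \<sigma> * (sqrt \<sigma> * sqrt (2 * pi / \<mu>)) = pi / (4 * real n)"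
      using s by (simp add: K_def \<sigma>_def ns power2_eq_square)
    moreover have "K * Z = (K * \<sigma> * (sqrt \<sigma> * sqrt (2 * pi / \<mu>))) * exp \<mu> * (1 - 1 / \<mu>)"
      by (simp only: Z_def mult_ac)
    ultimately show ?thesis by (simp only:)
  qed
  have "norm (2 * pi * \<i> * of_nat (overpart n) - \<i> * of_real (K * Z)) \<le>
     E * pi + E * pi + exp (\<mu> / 2) * (4 * \<sigma>) + K * (\<sigma> * sqrt \<sigma> * (30 * exp (3/5 * \<mu>)))"
  proof -
    have "2 * pi * \<i> * of_nat (overpart n) - \<i> * of_real (K * Z) = I1 + I3 + (I2 - of_real K * contour_integral (linepath b c) H)
      + of_real K * (contour_integral (linepath b c) H - \<i> * of_real Z)"
      unfolding total by (simp add: algebra_simps)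
    also have "norm \<dots> \<le> E * pi + E * pi + exp (\<mu> / 2) * (4 * \<sigma>) + K * (\<sigma> * sqrt \<sigma> * (30 * exp (3/5 * \<mu>)))"
    proof (intro norm_triangle_le add_mono I1 I2 I3)
      show "norm (of_real K * (contour_integral (linepath b c) H - \<i> * of_real Z)) \<le> K * (\<sigma> * sqrt \<sigma> * (30 * exp (3/5 * \<mu>)))"
        unfolding norm_mult using K C by (intro mult_mono) auto
    qed
    finally show ?thesis .
  qed
  also have "2 * pi * \<i> * of_nat (overpart n) - \<i> * of_real (K * Z) = \<i> * of_real (2 * pi * overpart n - K * Z)"
    by (simp add: algebra_simps)
  also have "norm \<dots> = \<bar>2 * pi * overpart n - K * Z\<bar>" by (simp only: norm_mult norm_ii norm_of_real mult_1)
  finally have "\<bar>2 * pi * overpart n - K * Z\<bar> \<le> E * pi + E * pi + exp (\<mu> / 2) * (4 * \<sigma>) + K * (\<sigma> * sqrt \<sigma> * (30 * exp (3/5 * \<mu>)))" .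
  \<comment> \<open>Since \<open>pi \<ge> 5/2\<close>, both \<open>\<mu> / 2\<close> and
    \<open>3/5 * \<mu>\<close> are at most \<open>\<mu> - s\<close>. The shares are
    \<open>1/2\<close> for the two minor arcs, \<open>1/4\<close> for the major arc error and less
    than \<open>1/7\<close> for the Bessel error.\<close>
  also have "\<dots> \<le> exp \<mu> * exp (- s) * 1"
  proof -
    have e1: "exp (\<mu> / 2) \<le> exp \<mu> * exp (- s)" "exp (3/5 * \<mu>) \<le> exp \<mu> * exp (- s)"
      unfolding exp_add[symmetric] \<mu>s using s pi_gt3 mult_right_mono[of 3 pi s] by simp_all
    have "E * pi + E * pi = 2 * pi * K * sqrt \<sigma> * (exp \<mu> * exp (- s))" by (simp add: E_def)
    also have "\<dots> \<le> 2 * pi * (2/7) * (1/4) * (exp \<mu> * exp (- s))"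
      using K sq\<sigma> by (intro mult_right_mono mult_mono) auto
    also have "\<dots> \<le> 1/2 * (exp \<mu> * exp (- s))" using pi_approx by (intro mult_right_mono) auto
    finally have 1: "E * pi + E * pi \<le> 1/2 * (exp \<mu> * exp (- s))" .
    have 2: "exp (\<mu> / 2) * (4 * \<sigma>) \<le> (exp \<mu> * exp (- s)) * (4 * (1/16))"
      using e1 \<sigma>0 \<sigma>1 by (intro mult_mono) auto
    have 3: "K * (\<sigma> * sqrt \<sigma> * (30 * exp (3/5 * \<mu>))) \<le> (2/7) * ((1/16) * (1/4) * (30 * (exp \<mu> * exp (- s))))"
      using K sq\<sigma> \<sigma>0 \<sigma>1 e1 by (intro mult_mono) auto
    have "0 < exp \<mu> * exp (- s)" by simp
    then show ?thesis using 1 2 3 by linarith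
  qed
  finally have fin: "\<bar>2 * pi * overpart n - K * Z\<bar> \<le> exp \<mu> * exp (- s)" by simp
  have "8 * real n * exp (- \<mu>) * overpart n - (1 - 1 / \<mu>) = (4 * real n / pi * exp (- \<mu>)) * (2 * pi * overpart n - K * Z)"
    unfolding KZ using n by (simp add: right_diff_distrib exp_minus)
  then have "\<bar>8 * real n * exp (- \<mu>) * overpart n - (1 - 1 / \<mu>)\<bar> = (4 * real n / pi * exp (- \<mu>)) * \<bar>2 * pi * overpart n - K * Z\<bar>"
    by (simp add: abs_mult)
  also have "\<dots> \<le> (4 * real n / pi * exp (- \<mu>)) * (exp \<mu> * exp (- s))"
    using fin by (intro mult_left_mono) auto
  also have "\<dots> = 4 / pi * (real n * exp (- s))" by (simp add: exp_minus)
  also have "\<dots> \<le> 2 * (real n * exp (- s))" using pi_gt3 by (intro mult_right_mono) (auto simp: field_simps)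
  finally show ?thesis by (simp add: s_def)
qed

section \<open>The inequality for large n\<close>

text \<open>The mean value theorem, applied first to the forward difference of \<open>f\<close> and
  then to \<open>f'\<close>.\<close>

lemma second_difference:
  fixes f f' f'' :: "real \<Rightarrow> real"
  assumes 1: "\<And>x. a \<le> x \<Longrightarrow> x \<le> a + 2 \<Longrightarrow> (f has_real_derivative f' x) (at x)"
    and 2: "\<And>x. a \<le> x \<Longrightarrow> x \<le> a + 2 \<Longrightarrow> (f' has_real_derivative f'' x) (at x)"
  obtains x where "a < x" "x < a + 2" "f (a + 2) - 2 * f (a + 1) + f a = f'' x"
proof -
  have "((\<lambda>x. f (x + 1) - f x) has_real_derivative f' (x + 1) - f' x) (at x)" if "a \<le> x" "x \<le> a + 1" for x
    by (intro DERIV_diff DERIV_shift[THEN iffD1] 1) (use that in auto)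
  then obtain y where y: "a < y" "y < a + 1"
    "(f (a + 1 + 1) - f (a + 1)) - (f (a + 1) - f a) = (a + 1 - a) * (f' (y + 1) - f' y)"
    using MVT2[of a "a + 1" "\<lambda>x. f (x + 1) - f x" "\<lambda>x. f' (x + 1) - f' x"] by auto
  obtain x where x: "y < x" "x < y + 1" "f' (y + 1) - f' y = (y + 1 - y) * f'' x"
    using MVT2[of y "y + 1" f' f''] 2 y by auto
  show thesis by (rule that[of x]) (use x y in \<open>auto simp: add.assoc\<close>)
qed

lemma third_difference:
  fixes f f' f'' f''' :: "real \<Rightarrow> real"
  assumes 1: "\<And>x. a \<le> x \<Longrightarrow> x \<le> a + 3 \<Longrightarrow> (f has_real_derivative f' x) (at x)"
    and 2: "\<And>x. a \<le> x \<Longrightarrow> x \<le> a + 3 \<Longrightarrow> (f' has_real_derivative f'' x) (at x)"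
    and 3: "\<And>x. a \<le> x \<Longrightarrow> x \<le> a + 3 \<Longrightarrow> (f'' has_real_derivative f''' x) (at x)"
  obtains x where "a < x" "x < a + 3" "f (a + 3) - 3 * f (a + 2) + 3 * f (a + 1) - f a = f''' x"
proof -
  obtain y where y: "a < y" "y < a + 2"
    "(f (a + 2 + 1) - f (a + 2)) - 2 * (f (a + 1 + 1) - f (a + 1)) + (f (a + 1) - f a) = f'' (y + 1) - f'' y"
  proof (rule second_difference[of a "\<lambda>x. f (x + 1) - f x" "\<lambda>x. f' (x + 1) - f' x" "\<lambda>x. f'' (x + 1) - f'' x"])
    fix x assume x: "a \<le> x" "x \<le> a + 2"
    show "((\<lambda>x. f (x + 1) - f x) has_real_derivative f' (x + 1) - f' x) (at x)"
      by (intro DERIV_diff DERIV_shift[THEN iffD1] 1) (use x in auto)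
    show "((\<lambda>x. f' (x + 1) - f' x) has_real_derivative f'' (x + 1) - f'' x) (at x)"
      by (intro DERIV_diff DERIV_shift[THEN iffD1] 2) (use x in auto)
  qed blast
  obtain x where x: "y < x" "x < y + 1" "f'' (y + 1) - f'' y = (y + 1 - y) * f''' x"
    using MVT2[of y "y + 1" f'' f'''] 3 y by auto
  show thesis by (rule that[of x]) (use x y in \<open>auto simp: add.assoc\<close>)
qed

section \<open>Derivatives of the logarithm of the main term\<close>

definition log_main :: "real \<Rightarrow> real" where
  "log_main x = pi * sqrt x - ln x"

text \<open>Kept apart from \<open>log_main\<close> because its second derivative already has order
  \<open>x^(-5/2)\<close>, that of the third derivative of \<open>log_main\<close>. Two derivatives
  therefore suffice for this part.\<close>

definition log_corr :: "real \<Rightarrow> real" where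
  "log_corr x = ln (1 - 1 / (pi * sqrt x))"

lemma DERIV_const_divide:
  fixes h :: "real \<Rightarrow> real"
  assumes "(h has_real_derivative h') (at x)" "h x \<noteq> 0"
  shows "((\<lambda>x. c / h x) has_real_derivative - (c * h') / (h x)\<^sup>2) (at x)"
  using assms by (auto intro!: derivative_eq_intros simp: power2_eq_square)

lemma DERIV_times_sqrt:
  fixes x :: real assumes "x > 0"
  shows "((\<lambda>x. x * sqrt x) has_real_derivative 3/2 * sqrt x) (at x)"
proof -
  have "x * inverse (sqrt x) = sqrt x" using assms by (simp add: real_div_sqrt flip: divide_inverse)
  then show ?thesis using assms by (auto intro!: derivative_eq_intros simp: mult.commute)
qed

lemma log_main_derivs:
  assumes x: "x > 0"
  shows "(log_main has_real_derivative pi / (2 * sqrt x) - 1 / x) (at x)"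
    and "((\<lambda>x. pi / (2 * sqrt x) - 1 / x) has_real_derivative - pi / (4 * (x * sqrt x)) + 1 / x\<^sup>2) (at x)"
    and "((\<lambda>x. - pi / (4 * (x * sqrt x)) + 1 / x\<^sup>2) has_real_derivative 3 * pi / (8 * (x\<^sup>2 * sqrt x)) - 2 / x ^ 3) (at x)"
proof -
  obtain y where y: "y > 0" "x = y\<^sup>2" using x by (intro that[of "sqrt x"]) auto
  show "(log_main has_real_derivative pi / (2 * sqrt x) - 1 / x) (at x)"
  proof -
    have "((\<lambda>x. pi * sqrt x - ln x) has_real_derivative pi * (inverse (sqrt x) / 2) - inverse x) (at x)"
      by (rule DERIV_diff[OF DERIV_cmult[OF DERIV_real_sqrt[OF x]] DERIV_ln[OF x]])
    moreover have "pi * (inverse (sqrt x) / 2) - inverse x = pi / (2 * sqrt x) - 1 / x"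
      by (simp add: field_simps)
    ultimately show ?thesis unfolding log_main_def[abs_def] by (simp only:)
  qed
  have "((\<lambda>x. 2 * sqrt x) has_real_derivative inverse (sqrt x)) (at x)"
    using x by (auto intro!: derivative_eq_intros)
  from DERIV_diff[OF DERIV_const_divide[OF this, of pi] DERIV_const_divide[OF DERIV_ident, of x 1]]
  have "((\<lambda>x. pi / (2 * sqrt x) - 1 / x) has_real_derivative
      - (pi * inverse (sqrt x)) / (2 * sqrt x)\<^sup>2 - - (1 * 1) / x\<^sup>2) (at x)"
    using x by simp
  also have "- (pi * inverse (sqrt x)) / (2 * sqrt x)\<^sup>2 - - (1 * 1) / x\<^sup>2 = - pi / (4 * (x * sqrt x)) + 1 / x\<^sup>2"
    using y by (simp add: field_simps power2_eq_square)
  finally show "((\<lambda>x. pi / (2 * sqrt x) - 1 / x) has_real_derivative - pi / (4 * (x * sqrt x)) + 1 / x\<^sup>2) (at x)" .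
  have "((\<lambda>x. - pi / (4 * (x * sqrt x)) + 1 / x\<^sup>2) has_real_derivative
      - (- pi * (4 * (3/2 * sqrt x))) / (4 * (x * sqrt x))\<^sup>2 + - (1 * (2 * x)) / (x\<^sup>2)\<^sup>2) (at x)"
    using x by (intro DERIV_add DERIV_const_divide DERIV_cmult DERIV_times_sqrt) (auto intro!: derivative_eq_intros)
  also have "- (- pi * (4 * (3/2 * sqrt x))) / (4 * (x * sqrt x))\<^sup>2 + - (1 * (2 * x)) / (x\<^sup>2)\<^sup>2 =
      3 * pi / (8 * (x\<^sup>2 * sqrt x)) - 2 / x ^ 3"
    using y by (simp add: field_simps power2_eq_square power3_eq_cube)
  finally show "((\<lambda>x. - pi / (4 * (x * sqrt x)) + 1 / x\<^sup>2) has_real_derivative 3 * pi / (8 * (x\<^sup>2 * sqrt x)) - 2 / x ^ 3) (at x)" .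
qed

lemma log_corr_derivs:
  assumes x: "x \<ge> 1"
  shows "(log_corr has_real_derivative 1 / (2 * (pi * (x * sqrt x) - x))) (at x)"
    and "((\<lambda>x. 1 / (2 * (pi * (x * sqrt x) - x))) has_real_derivative
       - (3/2 * pi * sqrt x - 1) / (2 * (pi * (x * sqrt x) - x)\<^sup>2)) (at x)"
proof -
  have s: "sqrt x \<ge> 1" "x = sqrt x * sqrt x" using x by auto
  have p: "pi * sqrt x > 1" using mult_mono[of 3 pi 1 "sqrt x"] s pi_gt3 by simp
  have p': "pi * (x * sqrt x) - x > 0" using mult_strict_left_mono[OF p, of x] x by (simp add: mult_ac)
  have l: "1 - 1 / (pi * sqrt x) > 0" using p by (simp add: divide_less_eq)
  show "(log_corr has_real_derivative 1 / (2 * (pi * (x * sqrt x) - x))) (at x)"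
  proof -
    have "(log_corr has_real_derivative (pi * (inverse (sqrt x) / 2) / (pi * sqrt x)\<^sup>2) / (1 - 1 / (pi * sqrt x))) (at x)"
      unfolding log_corr_def using x l s p
      by (auto intro!: derivative_eq_intros simp: power2_eq_square field_simps)
    also have "(pi * (inverse (sqrt x) / 2) / (pi * sqrt x)\<^sup>2) / (1 - 1 / (pi * sqrt x)) = 1 / (2 * (pi * (x * sqrt x) - x))"
      using p p' s by (simp add: divide_simps power2_eq_square) (simp add: algebra_simps)
    finally show ?thesis .
  qed
  show "((\<lambda>x. 1 / (2 * (pi * (x * sqrt x) - x))) has_real_derivative
       - (3/2 * pi * sqrt x - 1) / (2 * (pi * (x * sqrt x) - x)\<^sup>2)) (at x)"
  proof -
    have "((\<lambda>x. 1 / (2 * (pi * (x * sqrt x) - x))) has_real_derivative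
       - (1 * (2 * (pi * (3/2 * sqrt x) - 1))) / (2 * (pi * (x * sqrt x) - x))\<^sup>2) (at x)"
      using x p' by (intro DERIV_const_divide DERIV_cmult DERIV_diff DERIV_times_sqrt DERIV_ident) auto
    also have "- (1 * (2 * (pi * (3/2 * sqrt x) - 1))) / (2 * (pi * (x * sqrt x) - x))\<^sup>2 =
       - (3/2 * pi * sqrt x - 1) / (2 * (pi * (x * sqrt x) - x)\<^sup>2)"
    proof -
      have "- (1 * (2 * u)) / (2 * q)\<^sup>2 = - u / (2 * q\<^sup>2)" for u q :: real by (simp add: power2_eq_square)
      moreover have "3/2 * pi * sqrt x = pi * (3/2 * sqrt x)" by simp
      ultimately show ?thesis by (simp only:)
    qed
    finally show ?thesis .
  qed
qed

text \<open>At 27 the bound comes from \<open>exp (1/4) \<ge> 1 + 1/4 + 1/32 = 41/32\<close>, raised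
  to the power \<open>4 * 27\<close>. Beyond that write \<open>s = 27 + 7 t\<close>: then
  \<open>s \<le> 27 (1 + t)\<close> while \<open>exp s\<close> gains
  \<open>exp t ^ 7 \<ge> (1 + t) ^ 7\<close>.\<close>

lemma exp_ge_seventh_power:
  fixes s :: real assumes s: "s \<ge> 27"
  shows "25 * s ^ 7 \<le> exp s"
proof -
  have "41/32 \<le> exp (1/4 :: real)"
    using exp_lower_Taylor_quadratic[of "1/4 :: real"] by (simp add: power2_eq_square)
  then have "(41/32) ^ 108 \<le> exp (1/4 :: real) ^ 108" by (intro power_mono) auto
  also have "\<dots> = exp (27 :: real)" by (simp flip: exp_of_nat_mult)
  finally have "(41/32) ^ 108 \<le> exp (27 :: real)" .
  moreover have "25 * 27 ^ 7 \<le> ((41/32) ^ 108 :: real)" by (simp add: power_divide)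
  ultimately have 27: "25 * 27 ^ 7 \<le> exp (27 :: real)" by linarith
  define t where "t = (s - 27) / 7"
  have t: "t \<ge> 0" "s = 27 + 7 * t" using s by (simp_all add: t_def field_simps)
  have "25 * s ^ 7 \<le> 25 * (27 * (1 + t)) ^ 7"
    using t by (intro mult_left_mono power_mono) auto
  also have "\<dots> = (25 * 27 ^ 7) * (1 + t) ^ 7" by (simp only: power_mult_distrib mult.assoc)
  also have "\<dots> \<le> exp 27 * exp t ^ 7"
    using 27 t exp_ge_add_one_self[of t] by (intro mult_mono power_mono) auto
  also have "\<dots> = exp s" by (simp add: t(2) exp_add flip: exp_of_nat_mult)
  finally show ?thesis .
qed

section \<open>Error of the logarithmic approximation\<close>

definition log_error :: "nat \<Rightarrow> real" where
  "log_error n = ln (real (overpart n)) - (log_main (real n) + log_corr (real n) - ln 8)"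

lemma overpart_pos: "overpart n > 0"
proof -
  have "bounded_overpart 1 n > 0"
  proof (induction n)
    case 0
    then show ?case by (simp add: bounded_overpart_0 bounded_overpart_small[of 0 0, simplified])
  next
    case (Suc n)
    then show ?case using bounded_overpart_Suc[of 0 "Suc n"] by simp
  qed
  then show ?thesis using bounded_overpart_le[of 1 n] by linarith
qed

text \<open>The exponentially small relative error is weakened to order \<open>n^(-5/2)\<close>,
  comparable with the third difference of \<open>log_main\<close>, so that everything can be
  measured in the same powers of \<open>sqrt n\<close>.\<close>

lemma log_error_bound:
  fixes n :: nat assumes n: "n \<ge> 729"
  shows "\<bar>log_error n\<bar> \<le> 1 / (5 * sqrt (real n) ^ 5)"
proof -
  define s where "s = sqrt (real n)"
  have s: "s \<ge> 27" using n real_le_rsqrt[of 27 "real n"] by (simp add: s_def)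
  have ns: "real n = s\<^sup>2" by (simp add: s_def)
  define \<mu> where "\<mu> = pi * s"
  have \<mu>: "\<mu> \<ge> 81" unfolding \<mu>_def using mult_mono[of 3 pi 27 s] s pi_gt3 by simp
  define q where "q = 1 - 1 / \<mu>"
  have q: "q \<ge> 80/81" using \<mu> by (simp add: q_def field_simps)
  define X where "X = 8 * real n * exp (- \<mu>) * overpart n"
  have X: "\<bar>X - q\<bar> \<le> 2 * real n * exp (- s)"
    using overpart_estimate[OF n] by (simp add: X_def q_def \<mu>_def s_def)
  have es: "real n * exp (- s) \<le> 1 / (25 * s ^ 5)"
  proof -
    have "25 * s ^ 5 * s\<^sup>2 = 25 * s ^ 7" by (simp flip: power_add)
    then have E: "25 * s ^ 5 * s\<^sup>2 \<le> exp s" using exp_ge_seventh_power[OF s] by (simp only:)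
    have "real n * exp (- s) = s\<^sup>2 / exp s" by (simp add: ns exp_minus divide_inverse)
    also have "\<dots> \<le> s\<^sup>2 / (25 * s ^ 5 * s\<^sup>2)" using E s by (intro frac_le) auto
    also have "\<dots> = 1 / (25 * s ^ 5)" using s by simp
    finally show ?thesis .
  qed
  have Xpos: "X > 0" using overpart_pos[of n] n by (simp add: X_def)
  define d where "d = (X - q) / q"
  have "\<bar>d\<bar> = \<bar>X - q\<bar> / q" using q by (simp add: d_def abs_divide)
  also have "\<dots> \<le> (2 * (1 / (25 * s ^ 5))) / (80/81)"
    using X es q s by (intro frac_le) auto
  \<comment> \<open>The constant is \<open>2/25 * 81/80\<close>. Passing to
    \<open>ln (1 + d)\<close> at most doubles it, to \<open>162/1000 < 1/5\<close>.\<close>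
  finally have d: "\<bar>d\<bar> \<le> 81 / 1000 * (1 / s ^ 5)" by simp
  have s5: "1 \<le> s ^ 5" using s by (simp add: one_le_power)
  then have "1 / s ^ 5 \<le> 1 / 1" by (intro frac_le) auto
  then have "81 / 1000 * (1 / s ^ 5) \<le> 1 / 2" by linarith
  then have d2: "\<bar>d\<bar> \<le> 1 / 2" using d by linarith
  have "X = q * (1 + d)" using q by (simp add: d_def field_simps)
  then have "ln X = ln q + ln (1 + d)" using q d2 by (simp add: ln_mult)
  moreover have "ln X = ln 8 + ln (real n) - \<mu> + ln (real (overpart n))"
    unfolding X_def using n overpart_pos[of n] by (simp add: ln_mult)
  moreover have "log_main (real n) = \<mu> - ln (real n)" "log_corr (real n) = ln q"
    by (simp_all add: log_main_def log_corr_def \<mu>_def q_def s_def)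
  ultimately have "log_error n = ln (1 + d)" by (simp add: log_error_def)
  also have "\<bar>ln (1 + d)\<bar> \<le> \<bar>d\<bar> + 2 * d\<^sup>2"
    using abs_ln_one_plus_x_minus_x_bound[OF d2] by linarith
  also have "\<dots> \<le> 2 * \<bar>d\<bar>"
    using d2 mult_left_mono[OF d2, of "\<bar>d\<bar>"] by (simp add: power2_eq_square)
  also have "\<dots> \<le> 2 * (81 / 1000 * (1 / s ^ 5))" using d by simp
  also have "\<dots> \<le> 1 / (5 * s ^ 5)" using s by (simp add: field_simps)
  finally show ?thesis by (simp add: s_def)
qed

lemma log_corr_second_bound:
  assumes x: "x \<ge> 729"
  shows "\<bar>- (3/2 * pi * sqrt x - 1) / (2 * (pi * (x * sqrt x) - x)\<^sup>2)\<bar> \<le> 3/10 * (1 / sqrt x ^ 5)"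
proof -
  define y where "y = sqrt x"
  have y: "y \<ge> 27" using x real_le_rsqrt[of 27 x] by (simp add: y_def)
  have xy: "x = y\<^sup>2" using x by (simp add: y_def)
  have py: "pi * y \<ge> 81" using mult_mono[of 3 pi 27 y] y pi_gt3 by simp
  have "314/100 * y \<le> pi * y" using y pi_approx by (intro mult_right_mono) auto
  then have "3 * y \<le> pi * y - 1" using y by linarith
  then have "(3 * y) * y\<^sup>2 \<le> (pi * y - 1) * y\<^sup>2" by (intro mult_right_mono) auto
  then have "(3 * y ^ 3)\<^sup>2 \<le> (pi * (x * y) - x)\<^sup>2"
    using y by (intro power_mono) (auto simp: xy power2_eq_square power3_eq_cube algebra_simps)
  then have D: "2 * (9 * y ^ 6) \<le> 2 * (pi * (x * y) - x)\<^sup>2" by (simp add: power_mult_distrib)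
  have "\<bar>- (3/2 * pi * y - 1) / (2 * (pi * (x * y) - x)\<^sup>2)\<bar> = (3/2 * pi * y - 1) / (2 * (pi * (x * y) - x)\<^sup>2)"
    using py by (simp add: abs_divide)
  also have "\<dots> \<le> (3/2 * pi * y) / (2 * (9 * y ^ 6))"
    using D py y by (intro frac_le) auto
  also have "\<dots> = pi / 12 * (1 / y ^ 5)" using y by (simp add: field_simps eval_nat_numeral)
  also have "\<dots> \<le> 3/10 * (1 / y ^ 5)" using y pi_approx by (intro mult_right_mono) auto
  finally show ?thesis by (simp add: y_def)
qed

text \<open>\<open>u_op n\<close> and \<open>u_op (n + 1)\<close> are exponentials of two
  consecutive second differences \<open>S 0\<close>, \<open>S 1\<close> of the logarithm. An upper
  bound on each bounds \<open>a\<close> and \<open>b\<close> below by a multiple of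
  \<open>A\<close>, and a bound of order \<open>B\<close> on \<open>S 1 - S 0\<close> controls
  \<open>a - b\<close>.\<close>

lemma third_order_turan_large:
  fixes n :: nat assumes n: "n \<ge> 730"
  shows "4 * (1 - u_op n) * (1 - u_op (n + 1)) - (1 - u_op n * u_op (n + 1))^2 > 0"
proof -
  define m where "m = real (n - 1)"
  have m: "m \<ge> 729" using n by (simp add: m_def)
  define r where "r = sqrt m"
  have r: "r \<ge> 27" using m real_le_rsqrt[of 27 m] by (simp add: r_def)
  have mr: "m = r\<^sup>2" using m by (simp add: r_def)
  define A where "A = 1 / r ^ 3"
  define B where "B = 1 / r ^ 5"
  have r3: "r ^ 3 \<ge> 27 ^ 3" using r by (intro power_mono) auto
  have A0: "A > 0" "A \<le> 1 / 19683" using r r3 by (auto simp: A_def field_simps)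
  have B0: "B > 0" using r by (simp add: B_def)
  have BA: "B \<le> A / 729"
  proof -
    have "B = A / r\<^sup>2" by (simp add: A_def B_def flip: power_add)
    also have "\<dots> \<le> A / 729" using A0 m mr by (intro divide_left_mono) auto
    finally show ?thesis .
  qed
  define L where "L k = ln (real (overpart (n - 1 + k)))" for k
  define e where "e k = log_error (n - 1 + k)" for k
  have L: "L k = log_main (m + real k) + log_corr (m + real k) - ln 8 + e k" for k
    by (simp add: L_def e_def log_error_def m_def)
  have e: "\<bar>e k\<bar> \<le> B / 5" for k
  proof -
    have "\<bar>e k\<bar> \<le> 1 / (5 * sqrt (real (n - 1 + k)) ^ 5)"
      unfolding e_def by (rule log_error_bound) (use n in simp)
    also have "\<dots> \<le> 1 / (5 * r ^ 5)"
    proof -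
      have "r \<le> sqrt (real (n - 1 + k))" by (simp add: r_def m_def)
      then have "r ^ 5 \<le> sqrt (real (n - 1 + k)) ^ 5" using r by (intro power_mono) auto
      then show ?thesis using r by (intro frac_le) auto
    qed
    finally show ?thesis by (simp add: B_def)
  qed
  have sq: "r \<le> sqrt x" "r ^ k \<le> sqrt x ^ k" if "m \<le> x" for x k
  proof -
    show 1: "r \<le> sqrt x" using that by (simp add: r_def)
    show "r ^ k \<le> sqrt x ^ k" using 1 r by (intro power_mono) auto
  qed
  have sqx: "x * sqrt x = sqrt x ^ 3" "x\<^sup>2 * sqrt x = sqrt x ^ 5" "x\<^sup>2 = sqrt x ^ 4" "x ^ 3 = sqrt x ^ 6" if mx: "m \<le> x" for x
  proof -
    obtain y where "y \<ge> 0" "x = y\<^sup>2" using mx m by (intro that[of "sqrt x"]) auto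
    then show "x * sqrt x = sqrt x ^ 3" "x\<^sup>2 * sqrt x = sqrt x ^ 5" "x\<^sup>2 = sqrt x ^ 4" "x ^ 3 = sqrt x ^ 6"
      by (simp_all add: eval_nat_numeral)
  qed
  define c2 where "c2 x = - (3/2 * pi * sqrt x - 1) / (2 * (pi * (x * sqrt x) - x)\<^sup>2)" for x
  have c2: "\<bar>c2 x\<bar> \<le> 3/10 * B" if "m \<le> x" for x
  proof -
    have "\<bar>c2 x\<bar> \<le> 3/10 * (1 / sqrt x ^ 5)"
      unfolding c2_def by (rule log_corr_second_bound) (use that m in simp)
    also have "\<dots> \<le> 3/10 * B" unfolding B_def
      using sq(2)[OF that, of 5] r by (intro mult_left_mono frac_le) auto
    finally show ?thesis .
  qed
  \<comment> \<open>The sign is recorded too: two such differences lie in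
    \<open>[- 3/10 * B, 0]\<close>, so they differ by at most \<open>3/10 * B\<close> instead of
    twice that.\<close>
  have corr: "\<bar>log_corr (a + 2) - 2 * log_corr (a + 1) + log_corr a - 0\<bar> \<le> 3/10 * B
      \<and> log_corr (a + 2) - 2 * log_corr (a + 1) + log_corr a \<le> 0" if a: "m \<le> a" for a
  proof -
    obtain x where x: "a < x" "log_corr (a + 2) - 2 * log_corr (a + 1) + log_corr a = c2 x"
      by (rule second_difference[of a log_corr, OF log_corr_derivs, folded c2_def]) (use a m in auto)
    have "c2 x \<le> 0"
    proof -
      have "3/2 * pi * sqrt x \<ge> 1" using mult_mono[of 3 pi 27 "sqrt x"] sq(1)[of x] x a r pi_gt3 by simp
      then show ?thesis by (simp add: c2_def divide_nonpos_nonneg)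
    qed
    then show ?thesis using c2[of x] x a by simp
  qed
  define S where "S k = L (k + 2) - 2 * L (k + 1) + L k" for k
  \<comment> \<open>The budget in units of \<open>A\<close>:
    \<open>- 314/400 * 99/100 + 1/27\<close> is below \<open>- 0.74\<close>, the correction is
    nonpositive, and the four errors contribute at most \<open>4/5 * B\<close>, less than
    \<open>A / 900\<close>.\<close>
  have S: "S k \<le> - (73/100 * A)" if k: "k \<le> 1" for k
  proof -
    define a where "a = m + real k"
    have a: "m \<le> a" "a \<le> m + 1" using k by (auto simp: a_def)
    obtain x where x: "a < x" "x < a + 2"
      "log_main (a + 2) - 2 * log_main (a + 1) + log_main a = - pi / (4 * (x * sqrt x)) + 1 / x\<^sup>2"
      by (rule second_difference[of a log_main, OF log_main_derivs(1,2)]) (use a m in auto)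
    have mx: "m \<le> x" using a x by simp
    define y where "y = sqrt x"
    have ry: "r \<le> y" unfolding y_def by (rule sq(1)[OF mx])
    \<comment> \<open>The intermediate point satisfies \<open>x < m + 3\<close>, and
      \<open>m \<ge> 729\<close> makes the relative shift small; the cube of \<open>1.003\<close> is
      still below \<open>100/99\<close>.\<close>
    have y: "y \<le> 1003/1000 * r" unfolding y_def
    proof (rule real_le_lsqrt)
      have "m + 3 \<le> 1006/1000 * m" using m by simp
      also have "\<dots> \<le> (1003/1000)\<^sup>2 * m" using m by (intro mult_right_mono) (auto simp: power2_eq_square)
      finally show "x \<le> (1003/1000 * r)\<^sup>2" using a x by (simp only: power_mult_distrib mr[symmetric])
    qed (use r in simp)
    have y3: "99/100 * A \<le> 1 / y ^ 3"
    proof -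
      have "y ^ 3 \<le> (1003/1000 * r) ^ 3" using y ry r by (intro power_mono) auto
      also have "\<dots> \<le> 100/99 * r ^ 3" using r by (simp add: power_mult_distrib power_divide)
      finally have "1 / (100/99 * r ^ 3) \<le> 1 / y ^ 3" using ry r by (intro frac_le) auto
      then show ?thesis by (simp add: A_def)
    qed
    have y4: "1 / y ^ 4 \<le> A / 27"
    proof -
      have "27 * r ^ 3 \<le> y * y ^ 3" using ry r by (intro mult_mono power_mono) auto
      then have "1 / (y * y ^ 3) \<le> 1 / (27 * r ^ 3)" using r by (intro frac_le) auto
      then show ?thesis by (simp add: A_def eval_nat_numeral)
    qed
    have "log_main (a + 2) - 2 * log_main (a + 1) + log_main a = - (pi / 4) * (1 / y ^ 3) + 1 / y ^ 4"
      unfolding x(3) sqx(1,3)[OF mx] y_def by simp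
    also have "\<dots> \<le> - (314/400) * (99/100 * A) + A / 27"
    proof (rule add_mono[OF _ y4])
      have "(314/400) * (99/100 * A) \<le> (pi / 4) * (1 / y ^ 3)"
        using y3 A0 pi_approx by (intro mult_mono) auto
      then show "- (pi / 4) * (1 / y ^ 3) \<le> - (314/400) * (99/100 * A)" by linarith
    qed
    finally have main: "log_main (a + 2) - 2 * log_main (a + 1) + log_main a \<le> - (314/400) * (99/100 * A) + A / 27" .
    have "S k = (log_main (a + 2) - 2 * log_main (a + 1) + log_main a) +
        (log_corr (a + 2) - 2 * log_corr (a + 1) + log_corr a) + (e (k + 2) - 2 * e (k + 1) + e k)"
      by (simp add: S_def L a_def add_ac)
    then show ?thesis
      using main corr[OF a(1)] e[of k] e[of "k + 1"] e[of "k + 2"] BA A0 unfolding abs_le_iff by linarith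
  qed
  \<comment> \<open>In units of \<open>B\<close>: \<open>1.18\<close> from the third difference of
    \<open>log_main\<close>, since \<open>3 * pi / 8 < 1.18\<close>; \<open>0.3\<close> from the
    correction; and \<open>(1 + 3 + 3 + 1) / 5 = 1.6\<close> from the errors.\<close>
  have T: "\<bar>S 1 - S 0\<bar> \<le> 31/10 * B"
  proof -
    obtain x where x: "m < x" "log_main (m + 3) - 3 * log_main (m + 2) + 3 * log_main (m + 1) - log_main m =
        3 * pi / (8 * (x\<^sup>2 * sqrt x)) - 2 / x ^ 3"
      by (rule third_difference[of m log_main, OF log_main_derivs]) (use m in auto)
    have mx: "m \<le> x" using x by simp
    define y where "y = sqrt x"
    have ry: "r \<le> y" unfolding y_def by (rule sq(1)[OF mx])
    have y5: "1 / y ^ 5 \<le> B" unfolding B_def using ry r by (intro frac_le power_mono) auto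
    have y6: "0 \<le> 2 / y ^ 6" "2 / y ^ 6 \<le> 2 * (1 / y ^ 5)"
    proof -
      have "1 * y ^ 5 \<le> y * y ^ 5" using ry r by (intro mult_right_mono) auto
      then have "2 / (y * y ^ 5) \<le> 2 / y ^ 5" using ry r by (intro divide_left_mono) auto
      then show "2 / y ^ 6 \<le> 2 * (1 / y ^ 5)" by (simp add: eval_nat_numeral)
    qed (use ry r in simp)
    have "3 * pi / (8 * (x\<^sup>2 * sqrt x)) - 2 / x ^ 3 = (3 * pi / 8) * (1 / y ^ 5) - 2 / y ^ 6"
      unfolding sqx(2,4)[OF mx] y_def by simp
    moreover have "0 \<le> 1 / y ^ 5" using ry r by simp
    moreover from this have "(3 * pi / 8) * (1 / y ^ 5) \<le> 118/100 * (1 / y ^ 5)"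
      using pi_approx by (intro mult_right_mono) auto
    moreover from \<open>0 \<le> 1 / y ^ 5\<close> have "1 * (1 / y ^ 5) \<le> (3 * pi / 8) * (1 / y ^ 5)"
      using pi_approx by (intro mult_right_mono) auto
    ultimately have main: "\<bar>log_main (m + 3) - 3 * log_main (m + 2) + 3 * log_main (m + 1) - log_main m\<bar> \<le> 118/100 * B"
      unfolding x(2) using y5 y6 B0 \<open>0 \<le> 1 / y ^ 5\<close> by (intro abs_leI) linarith+
    have "S 1 - S 0 = (log_main (m + 3) - 3 * log_main (m + 2) + 3 * log_main (m + 1) - log_main m) +
        ((log_corr (m + 1 + 2) - 2 * log_corr (m + 1 + 1) + log_corr (m + 1)) -
         (log_corr (m + 2) - 2 * log_corr (m + 1) + log_corr m)) + (e 3 - 3 * e 2 + 3 * e 1 - e 0)"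
      by (simp add: S_def L add_ac eval_nat_numeral)
    then show ?thesis
      using main corr[of m] corr[of "m + 1"] e[of 0] e[of 1] e[of 2] e[of 3] B0 unfolding abs_le_iff by simp
  qed
  define a b where "a = 1 - u_op n" and "b = 1 - u_op (n + 1)"
  have expL: "exp (L k) = real (overpart (n - 1 + k))" for k
    unfolding L_def using overpart_pos by simp
  have u: "u_op n = exp (S 0)" "u_op (n + 1) = exp (S 1)"
  proof -
    have k: "exp (S k) = real (overpart (n - 1 + (k + 2))) * real (overpart (n - 1 + k)) / (real (overpart (n - 1 + (k + 1))))\<^sup>2" for k
    proof -
      have "S k = (L (k + 2) + L k) - (L (k + 1) + L (k + 1))" by (simp add: S_def)
      then show ?thesis unfolding expL[symmetric] by (simp only: exp_add exp_diff power2_eq_square)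
    qed
    show "u_op n = exp (S 0)" "u_op (n + 1) = exp (S 1)"
    proof -
      have i: "n - 1 + (0 + 2) = n + 1" "n - 1 + 0 = n - 1" "n - 1 + (0 + 1) = n"
        "n - 1 + (1 + 2) = n + 1 + 1" "n - 1 + 1 = n + 1 - 1" "n - 1 + (1 + 1) = n + 1" using n by simp_all
      show "u_op n = exp (S 0)" "u_op (n + 1) = exp (S 1)"
        unfolding k i u_op_def by (simp_all only: mult.commute)
    qed
  qed
  have ab_eq: "a = 1 - exp (S 0)" "b = 1 - exp (S 1)" by (simp_all only: a_def b_def u)
  \<comment> \<open>The drop from \<open>73/100\<close> to \<open>72/100\<close> absorbs the
    quadratic loss in \<open>1 - exp (- z) \<ge> z / (1 + z)\<close>.\<close>
  define \<alpha> where "\<alpha> = 72/100 * A"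
  have \<alpha>0: "\<alpha> > 0" using A0 by (simp add: \<alpha>_def)
  have low: "\<alpha> \<le> 1 - exp (S k)" if "k \<le> 1" for k
  proof -
    define z where "z = 73/100 * A"
    have z: "0 \<le> z" using A0 by (simp add: z_def)
    have "exp (S k) \<le> exp (- z)" using S[OF that] by (simp add: z_def)
    also have "\<dots> \<le> 1 / (1 + z)"
      unfolding exp_minus inverse_eq_divide using z exp_ge_add_one_self[of z] by (intro frac_le) auto
    also have "\<dots> \<le> 1 - \<alpha>"
    proof -
      have "1 \<le> (1 - \<alpha>) * (1 + z)"
      proof -
        have "A * A \<le> A * (1 / 19683)" using A0 by (intro mult_left_mono) auto
        then show ?thesis using A0 by (simp add: z_def \<alpha>_def algebra_simps)
      qed
      then show ?thesis using z by (simp add: divide_le_eq)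
    qed
    finally show ?thesis by simp
  qed
  have ab: "\<alpha> \<le> a" "\<alpha> \<le> b" "a \<le> 1" "b \<le> 1"
    using low[of 0] low[of 1] by (simp_all add: ab_eq)
  \<comment> \<open>Both exponents are nonpositive, and there \<open>exp\<close> is
    1-Lipschitz.\<close>
  have "\<bar>a - b\<bar> \<le> \<bar>S 1 - S 0\<bar>"
  proof -
    have le: "exp y - exp x \<le> y - x" if "x \<le> y" "y \<le> 0" for x y :: real
    proof -
      have "exp y - exp x = exp y * (1 - exp (x - y))" by (simp add: right_diff_distrib flip: exp_add)
      also have "\<dots> \<le> 1 * (1 - exp (x - y))" using that by (intro mult_right_mono) auto
      also have "\<dots> \<le> y - x" unfolding mult_1 using exp_ge_add_one_self[of "x - y"] by linarith
      finally show ?thesis .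
    qed
    have neg: "S 0 \<le> 0" "S 1 \<le> 0" using S[of 0] S[of 1] A0 by auto
    show ?thesis
    proof (cases "S 0 \<le> S 1")
      case True
      then show ?thesis using le[OF True] neg by (simp add: ab_eq)
    next
      case False
      then show ?thesis using le[of "S 1" "S 0"] neg by (simp add: ab_eq)
    qed
  qed
  then have "(a - b)\<^sup>2 \<le> (31/10 * B)\<^sup>2" using T B0 by (intro abs_le_square_iff[THEN iffD1]) linarith
  \<comment> \<open>The comparison is of \<open>9.61 / r^10\<close> with about
    \<open>0.746 / r^9\<close>, so \<open>r \<ge> 13\<close> would be enough at this point.\<close>
  also have "\<dots> < 2 * \<alpha> ^ 3"
  proof -
    have "(31/10 * B)\<^sup>2 = 961/100 * (1 / r ^ 10)" by (simp add: B_def power_mult_distrib power_divide flip: power_mult)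
    also have "\<dots> < 2 * (72/100) ^ 3 * r * (1 / r ^ 10)"
      using r by (intro mult_strict_right_mono) (auto simp: power_divide)
    also have "\<dots> = 2 * \<alpha> ^ 3" using r by (simp add: \<alpha>_def A_def power_mult_distrib power_divide field_simps flip: power_mult power_Suc)
    finally show ?thesis .
  qed
  also have "2 * \<alpha> ^ 3 = \<alpha> * \<alpha> * (\<alpha> + \<alpha>)" by (simp add: power3_eq_cube)
  also have "\<dots> \<le> a * b * (a + b)" using ab \<alpha>0 by (intro mult_mono add_mono) auto
  also have "\<dots> \<le> a * b * (2 * (a + b) - a * b)"
  proof (rule mult_left_mono)
    have "a * b \<le> a * 1" using ab \<alpha>0 by (intro mult_left_mono) auto
    then have "a * b \<le> a" by simp
    then show "a + b \<le> 2 * (a + b) - a * b" unfolding distrib_left using ab \<alpha>0 by linarith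
  qed (use ab \<alpha>0 in auto)
  finally have "0 < a * b * (2 * (a + b) - a * b) - (a - b)\<^sup>2" by simp
  also have "\<dots> = 4 * (1 - u_op n) * (1 - u_op (n + 1)) - (1 - u_op n * u_op (n + 1))\<^sup>2"
    by (simp add: a_def b_def power2_eq_square algebra_simps)
  finally show ?thesis by simp
qed

section \<open>The inequality for small n\<close>

text \<open>Counters are unary, as lists of units: evaluation by rewriting then consumes
  constructors and needs no arithmetic on natural numbers.\<close>

fun skip :: "unit list \<Rightarrow> int list \<Rightarrow> int list" where
  "skip [] xs = xs"
| "skip (_ # g) [] = []"
| "skip (_ # g) (x # xs) = skip g xs"

lemma skip_eq_drop: "skip g xs = drop (length g) xs"
  by (induction g xs rule: skip.induct) auto

text \<open>The counter is the number of entries between two selected ones. It grows by 2 each time,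
  as do the gaps between consecutive squares, so the alternating sum over square distances needs
  neither indexing nor squaring.\<close>

function alternating :: "unit list \<Rightarrow> int list \<Rightarrow> int" where
  "alternating g [] = 0"
| "alternating g (x # xs) = x - alternating (() # () # g) (skip g xs)"
  by pat_completeness auto
termination by (relation "Wellfounded.measure (length \<circ> snd)") (auto simp: skip_eq_drop)

lemma alternating_eq_sum:
  assumes "length xs \<le> N"
  shows "alternating g xs = (\<Sum>s<N. if s * (length g + s) < length xs then (-1) ^ s * xs ! (s * (length g + s)) else 0)"
  using assms
proof (induction g xs arbitrary: N rule: alternating.induct)
  case (2 g x xs)
  then obtain M where N: "N = Suc M" "length xs \<le> M" by (cases N) auto
  let ?L = "length g"
  have idx: "Suc t * (?L + Suc t) = Suc (?L + t * (Suc (Suc ?L) + t))" for t by (simp add: algebra_simps)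
  have "(\<Sum>s<N. if s * (?L + s) < length (x # xs) then (-1) ^ s * (x # xs) ! (s * (?L + s)) else 0) =
     x + (\<Sum>t<M. if Suc t * (?L + Suc t) < length (x # xs) then (-1) ^ Suc t * (x # xs) ! (Suc t * (?L + Suc t)) else 0)"
    unfolding N(1) by (subst sum.lessThan_Suc_shift) simp
  also have "(\<Sum>t<M. if Suc t * (?L + Suc t) < length (x # xs) then (-1) ^ Suc t * (x # xs) ! (Suc t * (?L + Suc t)) else 0) =
     - (\<Sum>t<M. if t * (length (() # () # g) + t) < length (skip g xs)
           then (-1) ^ t * skip g xs ! (t * (length (() # () # g) + t)) else 0)"
    unfolding sum_negf[symmetric] idx
    by (intro sum.cong) (auto simp: skip_eq_drop nth_append less_diff_conv add.commute)
  also have "\<dots> = - alternating (() # () # g) (skip g xs)"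
    using 2(1)[of M] N(2) by (simp add: skip_eq_drop)
  finally show ?case by simp
qed simp

definition overpart_list :: "nat \<Rightarrow> int list" where
  "overpart_list n = map (\<lambda>i. int (overpart i)) (rev [0..<n])"

lemma overpart_list_Suc: "overpart_list (Suc n) = int (overpart n) # overpart_list n"
  by (simp add: overpart_list_def)

lemma overpart_list_nth: "i < n \<Longrightarrow> overpart_list n ! i = int (overpart (n - Suc i))"
  by (simp add: overpart_list_def rev_nth)

text \<open>The list has the newest entry first, so \<open>overpart (n - (s + 1)^2)\<close> sits at
  position \<open>(s + 1)^2 - 1 = s * (s + 2)\<close>; hence the initial gap 2.\<close>

lemma overpart_alternating:
  assumes "0 < n"
  shows "int (overpart n) = 2 * alternating [(), ()] (overpart_list n)"
proof -
  have len: "length (overpart_list n) = n" by (simp add: overpart_list_def)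
  have "n < (Suc n)\<^sup>2" by (simp add: power2_eq_square)
  from overpart_recurrence[OF assms this]
  have "int (overpart n) = (\<Sum>s<n. if (Suc s)\<^sup>2 \<le> n then 2 * (-1) ^ Suc (Suc s) * int (overpart (n - (Suc s)\<^sup>2)) else 0)"
    by (simp add: sum.atLeast1_atMost_eq)
  also have "\<dots> = (\<Sum>s<n. 2 * (if s * (2 + s) < n then (-1) ^ s * overpart_list n ! (s * (2 + s)) else 0))"
  proof (rule sum.cong)
    fix s
    have sq: "(Suc s)\<^sup>2 = Suc (s * (2 + s))" by (simp add: power2_eq_square)
    show "(if (Suc s)\<^sup>2 \<le> n then 2 * (-1) ^ Suc (Suc s) * int (overpart (n - (Suc s)\<^sup>2)) else 0) =
        2 * (if s * (2 + s) < n then (-1) ^ s * overpart_list n ! (s * (2 + s)) else 0)"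
      unfolding sq using overpart_list_nth[of "s * (2 + s)" n] by (simp add: Suc_le_eq)
  qed simp
  also have "\<dots> = 2 * alternating [(), ()] (overpart_list n)"
  proof -
    have "length [(), ()] = 2" by simp
    then show ?thesis
      using alternating_eq_sum[of "overpart_list n" n "[(), ()]"] len by (simp only: sum_distrib_left)
  qed
  finally show ?thesis .
qed

section \<open>Interval arithmetic on truncated entries\<close>

definition truncate :: "unit list \<Rightarrow> int \<Rightarrow> int" where
  "truncate g x = x div 2 ^ length g"

text \<open>Division by a power of two becomes stripping binary digits from the numeral, one per
  counter element. The computation meets nonnegative arguments only.\<close>

lemma truncate_code [code]:
  "truncate [] x = x"
  "truncate (u # g) 0 = 0"
  "truncate (u # g) (Int.Pos num.One) = 0"
  "truncate (u # g) (Int.Pos (num.Bit0 m)) = truncate g (Int.Pos m)"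
  "truncate (u # g) (Int.Pos (num.Bit1 m)) = truncate g (Int.Pos m)"
  by (simp_all add: truncate_def zdiv_zmult2_eq)

text \<open>The width of the enclosing interval: 0 as long as no digit is dropped, when the entries
  are exact.\<close>

definition slack :: "unit list \<Rightarrow> int" where
  "slack g = (case g of [] \<Rightarrow> 0 | _ \<Rightarrow> 1)"

lemma truncate_bounds:
  "2 ^ length g * truncate g x \<le> x" "x \<le> 2 ^ length g * (truncate g x + slack g)"
proof -
  have "2 ^ length g * truncate g x + x mod 2 ^ length g = x" by (simp add: truncate_def)
  moreover have "0 \<le> x mod 2 ^ length g" "x mod 2 ^ length g < 2 ^ length g" by simp_all
  ultimately show "2 ^ length g * truncate g x \<le> x" by linarith
  show "x \<le> 2 ^ length g * (truncate g x + slack g)"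
  proof (cases g)
    case Nil
    then show ?thesis by (simp add: slack_def truncate_def)
  next
    case (Cons u g')
    then have "slack g = 1" by (simp add: slack_def)
    then show ?thesis
      using \<open>_ = x\<close> \<open>x mod 2 ^ length g < 2 ^ length g\<close> by (simp only: distrib_left mult_1_right)
  qed
qed

text \<open>The arguments \<open>a\<close> to \<open>d\<close> are lower ends of intervals of width
  \<open>e\<close>. \<open>X\<close> and \<open>Y\<close> bound the factors on the right from below,
  \<open>Z\<close> bounds the difference of products from above, and \<open>0 \<le> W\<close>
  certifies that this difference is nonnegative, so that its bound may be squared.\<close>

definition interval_test :: "int \<Rightarrow> int \<Rightarrow> int \<Rightarrow> int \<Rightarrow> int \<Rightarrow> bool" where
  "interval_test e a b c d = (let X = b * b - (a + e) * (c + e); Y = c * c - (b + e) * (d + e);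
     Z = (b + e) * (c + e) - a * d; W = b * c - (a + e) * (d + e)
     in 0 < X \<and> 0 < Y \<and> 0 \<le> W \<and> Z * Z < 4 * (X * Y))"

lemma interval_test_sound:
  fixes a b c d e :: int and A B C D :: real
  assumes test: "interval_test e a b c d" and pos: "0 \<le> a" "0 \<le> b" "0 \<le> c" "0 \<le> d" "0 \<le> e"
    and A: "a \<le> A" "A \<le> a + e" and B: "b \<le> B" "B \<le> b + e"
    and C: "c \<le> C" "C \<le> c + e" and D: "d \<le> D" "D \<le> d + e"
  shows "(B * C - A * D)\<^sup>2 < 4 * (B\<^sup>2 - A * C) * (C\<^sup>2 - B * D)"
proof -
  define X Y Z W where "X = b * b - (a + e) * (c + e)" and "Y = c * c - (b + e) * (d + e)"
    and "Z = (b + e) * (c + e) - a * d" and "W = b * c - (a + e) * (d + e)"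
  have t: "0 < X" "0 < Y" "0 \<le> W" "Z * Z < 4 * (X * Y)"
    using test by (auto simp: interval_test_def Let_def X_def Y_def Z_def W_def)
  have p: "0 \<le> A" "0 \<le> B" "0 \<le> C" "0 \<le> D" using pos A B C D by linarith+
  have X: "of_int X \<le> B\<^sup>2 - A * C"
  proof -
    have "of_int b * of_int b \<le> B * B" "A * C \<le> (of_int a + of_int e) * (of_int c + of_int e)"
      using pos p A B C by (intro mult_mono; simp)+
    then show ?thesis by (simp add: X_def power2_eq_square)
  qed
  have Y: "of_int Y \<le> C\<^sup>2 - B * D"
  proof -
    have "of_int c * of_int c \<le> C * C" "B * D \<le> (of_int b + of_int e) * (of_int d + of_int e)"
      using pos p B C D by (intro mult_mono; simp)+
    then show ?thesis by (simp add: Y_def power2_eq_square)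
  qed
  have Z: "B * C - A * D \<le> of_int Z"
  proof -
    have "of_int a * of_int d \<le> A * D" "B * C \<le> (of_int b + of_int e) * (of_int c + of_int e)"
      using pos p A B C D by (intro mult_mono; simp)+
    then show ?thesis by (simp add: Z_def)
  qed
  have W: "of_int W \<le> B * C - A * D"
  proof -
    have "of_int b * of_int c \<le> B * C" "A * D \<le> (of_int a + of_int e) * (of_int d + of_int e)"
      using pos p A B C D by (intro mult_mono; simp)+
    then show ?thesis by (simp add: W_def)
  qed
  have "0 \<le> real_of_int W" using t by simp
  then have "(B * C - A * D)\<^sup>2 \<le> (of_int Z)\<^sup>2" using Z W by (intro power_mono) auto
  also have "\<dots> = of_int (Z * Z)" by (simp add: power2_eq_square)
  also have "\<dots> < of_int (4 * (X * Y))" using t by (simp only: of_int_less_iff)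
  also have "\<dots> = 4 * (of_int X * of_int Y)" by simp
  also have "\<dots> \<le> 4 * ((B\<^sup>2 - A * C) * (C\<^sup>2 - B * D))"
    using X Y t by (intro mult_left_mono mult_mono) auto
  finally show ?thesis by (simp only: mult.assoc)
qed

definition turan_test :: "unit list \<Rightarrow> int \<Rightarrow> int \<Rightarrow> int \<Rightarrow> int \<Rightarrow> bool" where
  "turan_test g a b c d =
     interval_test (slack g) (truncate g a) (truncate g b) (truncate g c) (truncate g d)"

text \<open>The inequality is homogeneous of degree 4 in the four entries, so it may be tested after
  dividing all of them by the same power of two.\<close>

lemma turan_test_sound:
  fixes a b c d :: int
  assumes "turan_test g a b c d" "0 \<le> a" "0 \<le> b" "0 \<le> c" "0 \<le> d"
  shows "(of_int b * of_int c - of_int a * of_int d)\<^sup>2 <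
     4 * ((of_int b)\<^sup>2 - of_int a * of_int c) * ((of_int c)\<^sup>2 - of_int b * (of_int d :: real))"
proof -
  define K :: real where "K = 2 ^ length g"
  have K: "K > 0" by (simp add: K_def)
  have lo: "of_int (truncate g x) \<le> of_int x / K" and hi: "of_int x / K \<le> of_int (truncate g x + slack g)" for x
  proof -
    have "of_int (2 ^ length g * truncate g x) \<le> (of_int x :: real)"
      "(of_int x :: real) \<le> of_int (2 ^ length g * (truncate g x + slack g))"
      using truncate_bounds(1)[of g x] truncate_bounds(2)[of x g] by (simp_all only: of_int_le_iff)
    then show "of_int (truncate g x) \<le> of_int x / K" "of_int x / K \<le> of_int (truncate g x + slack g)"
      using K by (simp_all add: K_def field_simps)
  qed
  have nn: "0 \<le> truncate g x" if "0 \<le> x" for x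
    using that by (simp add: truncate_def pos_imp_zdiv_nonneg_iff)
  have "(of_int b / K * (of_int c / K) - of_int a / K * (of_int d / K))\<^sup>2 <
     4 * ((of_int b / K)\<^sup>2 - of_int a / K * (of_int c / K)) * ((of_int c / K)\<^sup>2 - of_int b / K * (of_int d / K))"
    using assms(2-5) by (intro interval_test_sound[OF assms(1)[unfolded turan_test_def]] nn lo hi)
       (simp_all add: slack_def split: list.split)
  moreover have "(of_int b / K * (of_int c / K) - of_int a / K * (of_int d / K))\<^sup>2 =
     (of_int b * of_int c - of_int a * of_int d)\<^sup>2 / K ^ 4"
    using K by (simp add: field_simps eval_nat_numeral)
  moreover have "4 * ((of_int b / K)\<^sup>2 - of_int a / K * (of_int c / K)) * ((of_int c / K)\<^sup>2 - of_int b / K * (of_int d / K)) =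
     4 * ((of_int b)\<^sup>2 - of_int a * of_int c) * ((of_int c)\<^sup>2 - of_int b * of_int d) / K ^ 4"
    using K by (simp add: field_simps eval_nat_numeral)
  ultimately show ?thesis using K by (simp add: divide_less_cancel)
qed

text \<open>The length of \<open>g\<close> is the number of binary digits that \<^const>\<open>turan_test\<close> drops. It grows with
  the entries so that about forty digits remain: enough for the test to succeed, and few enough for
  the multiplications to be cheap in the simplifier.\<close>

definition widen :: "unit list \<Rightarrow> int \<Rightarrow> unit list" where
  "widen g d = (if 2199023255552 < truncate g d then () # () # () # () # g else g)"

definition extend :: "int list \<Rightarrow> int list" where
  "extend xs = 2 * alternating [(), ()] xs # xs"

lemma extend_overpart_list: "0 < n \<Longrightarrow> extend (overpart_list n) = overpart_list (Suc n)"
  using overpart_alternating[of n] by (simp add: extend_def overpart_list_Suc)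

text \<open>The first argument is fuel, one element per window of four consecutive values. Running
  short of entries yields \<open>False\<close>, so success certifies a window for every element of
  fuel.\<close>

fun scan :: "unit list \<Rightarrow> unit list \<Rightarrow> int list \<Rightarrow> bool" where
  "scan [] g xs = True"
| "scan (_ # f) g (d # c # b # a # xs) =
    (if turan_test g a b c d then scan f (widen g d) (extend (d # c # b # a # xs)) else False)"
| "scan f g xs = False"

lemma scan_sound:
  assumes "scan f g (overpart_list (Suc m))" "3 \<le> m" "m \<le> k" "k < m + length f"
  shows "(real (overpart (k - 2)) * real (overpart (k - 1)) - real (overpart (k - 3)) * real (overpart k))\<^sup>2 <
    4 * ((real (overpart (k - 2)))\<^sup>2 - real (overpart (k - 3)) * real (overpart (k - 1))) *
      ((real (overpart (k - 1)))\<^sup>2 - real (overpart (k - 2)) * real (overpart k))"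
  using assms
proof (induction f arbitrary: g m)
  case (Cons u f)
  define l where "l = m - 3"
  have m: "m = Suc (Suc (Suc l))" using Cons.prems by (simp add: l_def)
  have step: "turan_test g (int (overpart l)) (int (overpart (Suc l))) (int (overpart (Suc (Suc l)))) (int (overpart m))"
    "scan f (widen g (int (overpart m))) (overpart_list (Suc (Suc m)))"
    using Cons.prems(1) extend_overpart_list[of "Suc m"]
    by (auto simp: m overpart_list_Suc split: if_splits)
  show ?case
  proof (cases "k = m")
    case True
    then show ?thesis using turan_test_sound[OF step(1)] by (simp add: m numeral_2_eq_2 numeral_3_eq_3)
  next
    case False
    then show ?thesis using Cons.IH[OF step(2)] Cons.prems by simp
  qed
qed simp

lemma fold_extend: "0 < n \<Longrightarrow> fold (\<lambda>_. extend) (f :: unit list) (overpart_list n) = overpart_list (n + length f)"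
  by (induction f arbitrary: n) (simp_all add: extend_overpart_list)

text \<open>Eighteen extensions of \<open>[1]\<close>, the list for index 0, put
  \<open>overpart 18\<close> at the head: the last entry of the window for \<open>n = 16\<close>.
  The \<open>714 = 730 - 16\<close> windows cover \<open>n\<close> from 16 to 729.\<close>

lemma scan_computation: "scan (replicate 714 ()) [] (fold (\<lambda>_. extend) (replicate 18 ()) [1])"
  by code_simp

lemma third_order_turan_small:
  assumes n: "16 \<le> n" "n < 730"
  shows "4 * (1 - u_op n) * (1 - u_op (n + 1)) - (1 - u_op n * u_op (n + 1))\<^sup>2 > 0"
proof -
  define A B C D where "A = real (overpart (n - 1))" and "B = real (overpart n)"
    and "C = real (overpart (n + 1))" and "D = real (overpart (n + 2))"
  have pos: "B > 0" "C > 0" using overpart_pos by (simp_all add: B_def C_def)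
  have "overpart_list (Suc 0) = [1]" by (simp add: overpart_list_def overpart_0)
  then have "scan (replicate 714 ()) [] (overpart_list (Suc 18))"
    using scan_computation fold_extend[of "Suc 0" "replicate 18 ()"] by simp
  from scan_sound[OF this, of "n + 2"] n
  have "(B * C - A * D)\<^sup>2 < 4 * (B\<^sup>2 - A * C) * (C\<^sup>2 - B * D)"
    by (simp add: A_def B_def C_def D_def numeral_3_eq_3)
  then have "0 < (4 * (B\<^sup>2 - A * C) * (C\<^sup>2 - B * D) - (B * C - A * D)\<^sup>2) / (B * C)\<^sup>2"
    using pos by simp
  \<comment> \<open>In the product of the two quotients \<open>B\<close> and \<open>C\<close> partly
    cancel, leaving \<open>A * D / (B * C)\<close>; so \<open>(B * C)^2\<close> is a common
    denominator.\<close>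
  also have "\<dots> = 4 * (1 - A * C / B\<^sup>2) * (1 - B * D / C\<^sup>2) - (1 - A * C / B\<^sup>2 * (B * D / C\<^sup>2))\<^sup>2"
    using pos by (simp add: divide_simps power2_eq_square)
  finally show ?thesis by (simp add: u_op_def A_def B_def C_def D_def)
qed

theorem theorem1p2:
  fixes n :: nat
  assumes "n \<ge> 16"
  shows "4 * (1 - u_op n) * (1 - u_op (n + 1)) - (1 - u_op n * u_op (n + 1))^2 > 0"
  using third_order_turan_small[of n] third_order_turan_large[of n] assms by (cases "n < 730") auto

end
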